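(* Let a compact abelian Lie group $G$ act continuously and transitively on a finite set $\bar{\mathbf{x}}$ (nonempty), and let $F$ be a $G$-equivariant topological complex vector bundle over $\bar{\mathbf{x}}$. Then $\Psi_F(w)$ is simply connected for each $w\in\mathrm{ext}\,F$.
   Context: All representations are finite-dimensional (continuous) complex representations. For $\bar{x}\in\bar{\mathbf{x}}$, $G_{\bar{x}}$ is the isotropy group and $F_{\bar{x}}$ is the fiber of $F$ over $\bar{x}$, regarded as a $G_{\bar{x}}$-representation. For vector spaces $V,W$, $\mathrm{iso}(V,W)$ is the set of all linear isomorphisms $V\to W$ (no group action considered). A pointwise clutching map with respect to $F$ is an element $\psi$ of $\prod_{(\bar{x},\bar{x}')\in\bar{\mathbf{x}}\times\bar{\mathbf{x}}}\mathrm{iso}(F_{\bar{x}},F_{\bar{x}'})$, with components $\psi(\bar{x},\bar{x}')$, such that for all $\bar{x},\bar{x}',\bar{x}''\in\bar{\mathbf{x}}$: $\psi(\bar{x},\bar{x})=\mathrm{id}_{F_{\bar{x}}}$; $\psi(\bar{x},\bar{x}')=\psi(\bar{x}',\bar{x})^{-1}$; $\psi(\bar{x},\bar{x}'')=\psi(\bar{x}',\bar{x}'')\psi(\bar{x},\bar{x}')$. The group $G$ acts on pointwise clutching maps by $(g\cdot\psi)(\bar{x},\bar{x}')\bar{u}=g\,\psi(g^{-1}\bar{x},g^{-1}\bar{x}')\,g^{-1}\bar{u}$; $\psi$ is equivariant if $g\cdot\psi=\psi$ for all $g\in G$. $\Psi_F$ is the set of all equivariant pointwise clutching maps with respect to $F$,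 with the subspace topology from the product topology. For a pointwise clutching map $\psi$, $F/\psi$ is the quotient of $F$ by $\bar{u}\sim\bar{u}' \iff \psi(\bar{x},\bar{x}')\bar{u}=\bar{u}'$ (for $\bar{u}\in F_{\bar{x}}$, $\bar{u}'\in F_{\bar{x}'}$), and $p_\psi:F\to F/\psi$ is the quotient map; $F/\psi$ has the unique vector space structure for which $p_\psi$ restricts to a linear isomorphism on each fiber. If $\psi$ is equivariant, $F/\psi$ carries a unique $G$-representation structure for which $p_\psi$ is $G$-equivariant, and $F/\psi$ denotes this representation. A complex $G$-representation $w$ is a representation extension of $F$ if $\mathrm{res}^G_{G_{\bar{x}}}w\cong F_{\bar{x}}$ as $G_{\bar{x}}$-representations for each $\bar{x}\in\bar{\mathbf{x}}$. $\mathrm{ext}\,F$ is the set of $G$-isomorphism classes of representation extensions of $F$. For $w\in\mathrm{ext}\,F$, $\Psi_F(w)$ is the subspace of all $\psi\in\Psi_F$ such that $F/\psi\cong w$ as $G$-representations. *)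

theory Defs
  imports "HOL-Analysis.Analysis" "HOL-Algebra.Module"
begin

section \<open>Lie groups\<close>

text \<open>
  Groups are types of class \<^class>\<open>topological_group_add\<close>, so the group law is written
  additively throughout: \<open>g + h\<close> is the product and \<open>- g\<close> the inverse.

  The model space of a manifold is a linear subspace \<open>V\<close> of a Euclidean space rather than a
  Euclidean space itself: every type of class \<^class>\<open>euclidean_space\<close> has positive dimension,
  and zero-dimensional (for instance finite) Lie groups must not be excluded.

  \<open>Ck_on k V S f\<close> says that \<open>f\<close> is of class \<open>C\<^sup>k\<close> on the set \<open>S\<close>, which is meant to be
  open in \<open>V\<close>.  The derivative is only determined on \<open>V\<close>, so only directional derivatives along
  vectors of \<open>V\<close> are required to be of class \<open>C\<^sup>k\<close> in the recursive step.
\<close>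

primrec Ck_on ::
  "nat \<Rightarrow> 'a::real_normed_vector set \<Rightarrow> 'a set \<Rightarrow> ('a \<Rightarrow> 'b::real_normed_vector) \<Rightarrow> bool" where
  "Ck_on 0 V S f \<longleftrightarrow> continuous_on S f"
| "Ck_on (Suc k) V S f \<longleftrightarrow>
     (\<exists>f'. (\<forall>x\<in>S. (f has_derivative f' x) (at x within S)) \<and>
           (\<forall>v\<in>V. Ck_on k V S (\<lambda>x. f' x v)))"

definition smooth_on ::
  "'a::real_normed_vector set \<Rightarrow> 'a set \<Rightarrow> ('a \<Rightarrow> 'b::real_normed_vector) \<Rightarrow> bool" where
  "smooth_on V S f \<longleftrightarrow> (\<forall>k. Ck_on k V S f)"

definition is_chart :: "'m::euclidean_space set \<Rightarrow> 'g::topological_space set \<times> ('g \<Rightarrow> 'm) \<Rightarrow> bool" where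
  "is_chart V = (\<lambda>(U, \<phi>). open U \<and> openin (top_of_set V) (\<phi> ` U) \<and>
     homeomorphism U (\<phi> ` U) \<phi> (inv_into U \<phi>))"

definition smooth_atlas ::
  "'m::euclidean_space set \<Rightarrow> ('g::topological_space set \<times> ('g \<Rightarrow> 'm)) set \<Rightarrow> bool" where
  "smooth_atlas V \<A> \<longleftrightarrow>
     subspace V \<and> (\<forall>c\<in>\<A>. is_chart V c) \<and> (\<Union>(U, \<phi>)\<in>\<A>. U) = UNIV \<and>
     (\<forall>(U, \<phi>)\<in>\<A>. \<forall>(U', \<phi>')\<in>\<A>. smooth_on V (\<phi> ` (U \<inter> U')) (\<lambda>s. \<phi>' (inv_into U \<phi> s)))"

definition lie_group ::
  "'m::euclidean_space set \<Rightarrow>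
    ('g::{topological_group_add, t2_space, second_countable_topology} set \<times> ('g \<Rightarrow> 'm)) set \<Rightarrow> bool" where
  "lie_group V \<A> \<longleftrightarrow>
     smooth_atlas V \<A> \<and>
     (\<forall>(U1, \<phi>1)\<in>\<A>. \<forall>(U2, \<phi>2)\<in>\<A>. \<forall>(U3, \<phi>3)\<in>\<A>.
        smooth_on (V \<times> V)
          {(s, t). s \<in> \<phi>1 ` U1 \<and> t \<in> \<phi>2 ` U2 \<and> inv_into U1 \<phi>1 s + inv_into U2 \<phi>2 t \<in> U3}
          (\<lambda>(s, t). \<phi>3 (inv_into U1 \<phi>1 s + inv_into U2 \<phi>2 t))) \<and>
     (\<forall>(U1, \<phi>1)\<in>\<A>. \<forall>(U2, \<phi>2)\<in>\<A>.
        smooth_on V {s \<in> \<phi>1 ` U1. - inv_into U1 \<phi>1 s \<in> U2} (\<lambda>s. \<phi>2 (- inv_into U1 \<phi>1 s)))"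

definition is_action :: "('g::group_add \<Rightarrow> 's \<Rightarrow> 's) \<Rightarrow> 's set \<Rightarrow> bool" where
  "is_action a S \<longleftrightarrow>
     (\<forall>g. \<forall>s\<in>S. a g s \<in> S) \<and> (\<forall>s\<in>S. a 0 s = s) \<and> (\<forall>g h. \<forall>s\<in>S. a (g + h) s = a g (a h s))"


section \<open>Complex vector spaces and representations\<close>

definition complex_field :: "complex ring" where
  "complex_field = \<lparr>carrier = UNIV, monoid.mult = (*), one = 1, ring.zero = 0, ring.add = (+)\<rparr>"

text \<open>
  A complex vector space is a \<open>module\<close> over \<^const>\<open>complex_field\<close>.  The fields \<open>mult\<close> and
  \<open>one\<close> which the record type inherits from rings play no role for modules; they are left
  \<^const>\<open>undefined\<close> below.
\<close>

definition lin_iso ::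
  "(complex, 'v, 'p) module_scheme \<Rightarrow> (complex, 'w, 'q) module_scheme \<Rightarrow> ('v \<Rightarrow> 'w) \<Rightarrow> bool" where
  "lin_iso V W f \<longleftrightarrow>
     bij_betw f (carrier V) (carrier W) \<and>
     (\<forall>u\<in>carrier V. \<forall>v\<in>carrier V. f (u \<oplus>\<^bsub>V\<^esub> v) = f u \<oplus>\<^bsub>W\<^esub> f v) \<and>
     (\<forall>c. \<forall>u\<in>carrier V. f (c \<odot>\<^bsub>V\<^esub> u) = c \<odot>\<^bsub>W\<^esub> f u)"

definition finite_dim :: "(complex, 'v, 'p) module_scheme \<Rightarrow> bool" where
  "finite_dim V \<longleftrightarrow>
     (\<exists>B. finite B \<and> B \<subseteq> carrier V \<and>
          (\<forall>v\<in>carrier V. \<exists>c. v = (\<Oplus>\<^bsub>V\<^esub>b\<in>B. c b \<odot>\<^bsub>V\<^esub> b)))"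

definition lin_functional :: "(complex, 'v, 'p) module_scheme \<Rightarrow> ('v \<Rightarrow> complex) \<Rightarrow> bool" where
  "lin_functional V l \<longleftrightarrow>
     (\<forall>u\<in>carrier V. \<forall>v\<in>carrier V. l (u \<oplus>\<^bsub>V\<^esub> v) = l u + l v) \<and>
     (\<forall>c. \<forall>u\<in>carrier V. l (c \<odot>\<^bsub>V\<^esub> u) = c * l u)"

text \<open>
  The coarsest topology making all linear functionals continuous.  On a finite-dimensional space
  this is the usual one, i.e. the only Hausdorff vector space topology.
\<close>

definition fd_topology :: "(complex, 'v, 'p) module_scheme \<Rightarrow> 'v topology" where
  "fd_topology V =
     topology_generated_by {{v \<in> carrier V. l v \<in> N} | l N. lin_functional V l \<and> open N}"

record ('g, 'v) rep = "(complex, 'v) module" +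
  act :: "'g \<Rightarrow> 'v \<Rightarrow> 'v"

definition representation :: "('g::topological_group_add, 'w) rep \<Rightarrow> bool" where
  "representation W \<longleftrightarrow>
     module complex_field W \<and> finite_dim W \<and>
     is_action (act W) (carrier W) \<and>
     (\<forall>g. lin_iso W W (act W g)) \<and>
     continuous_map (prod_topology euclidean (fd_topology W)) (fd_topology W) (\<lambda>(g, v). act W g v)"

text \<open>Isomorphisms of representations of a subgroup \<open>H\<close>; only the action of \<open>H\<close> matters.\<close>

definition rep_iso :: "'g set \<Rightarrow> ('g, 'v) rep \<Rightarrow> ('g, 'w) rep \<Rightarrow> ('v \<Rightarrow> 'w) \<Rightarrow> bool" where
  "rep_iso H V W f \<longleftrightarrow>
     lin_iso V W f \<and> (\<forall>g\<in>H. \<forall>v\<in>carrier V. f (act V g v) = act W g (f v))"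

definition isomorphic_rep :: "'g set \<Rightarrow> ('g, 'v) rep \<Rightarrow> ('g, 'w) rep \<Rightarrow> bool" where
  "isomorphic_rep H V W \<longleftrightarrow> (\<exists>f. rep_iso H V W f)"


section \<open>Equivariant vector bundles over a finite set\<close>

text \<open>
  The base is a type \<open>'x\<close> and the total space a type \<open>'e\<close>.  \<open>fadd\<close> is only meaningful for two
  vectors in the same fiber.
\<close>

record ('g, 'x, 'e) gbundle =
  proj :: "'e \<Rightarrow> 'x"
  fzero :: "'x \<Rightarrow> 'e"
  fadd :: "'e \<Rightarrow> 'e \<Rightarrow> 'e"
  fsmult :: "complex \<Rightarrow> 'e \<Rightarrow> 'e"
  base_act :: "'g \<Rightarrow> 'x \<Rightarrow> 'x"
  total_act :: "'g \<Rightarrow> 'e \<Rightarrow> 'e"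

text \<open>
  The total action is recorded in every fiber, although it maps the fiber over \<open>x\<close> to itself only
  for elements of the isotropy group of \<open>x\<close>.
\<close>

definition fiber :: "('g, 'x, 'e) gbundle \<Rightarrow> 'x \<Rightarrow> ('g, 'e) rep" where
  "fiber F x =
     \<lparr>carrier = {u. proj F u = x}, monoid.mult = undefined, one = undefined,
      ring.zero = fzero F x, ring.add = fadd F, smult = fsmult F, act = total_act F\<rparr>"

definition isotropy :: "('g, 'x, 'e) gbundle \<Rightarrow> 'x \<Rightarrow> 'g set" where
  "isotropy F x = {g. base_act F g x = x}"

text \<open>\<open>\<complex>\<^sup>n\<close> for arbitrary \<open>n \<ge> 0\<close>, as sequences vanishing from index \<open>n\<close> on.\<close>

definition coord_space :: "nat \<Rightarrow> (complex, nat \<Rightarrow> complex) module" where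
  "coord_space n =
     \<lparr>carrier = {v. \<forall>i\<ge>n. v i = 0}, monoid.mult = undefined, one = undefined,
      ring.zero = (\<lambda>i. 0), ring.add = (\<lambda>v w i. v i + w i), smult = (\<lambda>c v i. c * v i)\<rparr>"

definition vector_bundle :: "('g, 'x::topological_space, 'e::topological_space) gbundle \<Rightarrow> bool" where
  "vector_bundle F \<longleftrightarrow>
     continuous_on UNIV (proj F) \<and>
     (\<forall>x. module complex_field (fiber F x)) \<and>
     (\<forall>x. \<exists>U n \<phi> \<phi>'. open U \<and> x \<in> U \<and>
        homeomorphism (proj F -` U) (U \<times> carrier (coord_space n)) \<phi> \<phi>' \<and>
        (\<forall>u\<in>proj F -` U. fst (\<phi> u) = proj F u) \<and>
        (\<forall>y\<in>U. lin_iso (fiber F y) (coord_space n) (\<lambda>u. snd (\<phi> u))))"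

definition equivariant_bundle ::
  "('g::topological_group_add, 'x::topological_space, 'e::topological_space) gbundle \<Rightarrow> bool" where
  "equivariant_bundle F \<longleftrightarrow>
     vector_bundle F \<and>
     is_action (base_act F) UNIV \<and> continuous_on UNIV (\<lambda>(g, x). base_act F g x) \<and>
     is_action (total_act F) UNIV \<and> continuous_on UNIV (\<lambda>(g, u). total_act F g u) \<and>
     (\<forall>g u. proj F (total_act F g u) = base_act F g (proj F u)) \<and>
     (\<forall>g x. lin_iso (fiber F x) (fiber F (base_act F g x)) (total_act F g))"


section \<open>Pointwise clutching maps\<close>

text \<open>
  The component \<open>\<psi> x x'\<close> is a function on the whole type \<open>'e\<close> and is made unique by the value
  \<^const>\<open>undefined\<close> outside the fiber over \<open>x\<close>.
\<close>

definition clutching_map :: "('g, 'x, 'e) gbundle \<Rightarrow> ('x \<Rightarrow> 'x \<Rightarrow> 'e \<Rightarrow> 'e) \<Rightarrow> bool" where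
  "clutching_map F \<psi> \<longleftrightarrow>
     (\<forall>x x'. \<psi> x x' \<in> extensional (carrier (fiber F x)) \<and>
             lin_iso (fiber F x) (fiber F x') (\<psi> x x')) \<and>
     (\<forall>x. \<forall>u\<in>carrier (fiber F x). \<psi> x x u = u) \<and>
     (\<forall>x x'. \<forall>u\<in>carrier (fiber F x). \<psi> x x' u = inv_into (carrier (fiber F x')) (\<psi> x' x) u) \<and>
     (\<forall>x x' x''. \<forall>u\<in>carrier (fiber F x). \<psi> x x'' u = \<psi> x' x'' (\<psi> x x' u))"

definition clutching_act ::
  "('g::group_add, 'x, 'e) gbundle \<Rightarrow> 'g \<Rightarrow> ('x \<Rightarrow> 'x \<Rightarrow> 'e \<Rightarrow> 'e) \<Rightarrow> ('x \<Rightarrow> 'x \<Rightarrow> 'e \<Rightarrow> 'e)" where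
  "clutching_act F g \<psi> = (\<lambda>x x'. \<lambda>u\<in>carrier (fiber F x).
     total_act F g (\<psi> (base_act F (- g) x) (base_act F (- g) x') (total_act F (- g) u)))"

text \<open>
  As a subset of the function type \<open>'x \<Rightarrow> 'x \<Rightarrow> 'e \<Rightarrow> 'e\<close>, this set carries the subspace topology
  of the product over all pairs \<open>(x, x')\<close>, each set of isomorphisms having the topology of
  pointwise convergence; since fibers are finite-dimensional, the latter is the usual topology on
  linear isomorphisms.
\<close>

definition Psi :: "('g::group_add, 'x, 'e) gbundle \<Rightarrow> ('x \<Rightarrow> 'x \<Rightarrow> 'e \<Rightarrow> 'e) set" where
  "Psi F = {\<psi>. clutching_map F \<psi> \<and> (\<forall>g. clutching_act F g \<psi> = \<psi>)}"

definition clutching_rel :: "('g, 'x, 'e) gbundle \<Rightarrow> ('x \<Rightarrow> 'x \<Rightarrow> 'e \<Rightarrow> 'e) \<Rightarrow> ('e \<times> 'e) set" where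
  "clutching_rel F \<psi> = {(u, u'). \<psi> (proj F u) (proj F u') u = u'}"

definition quotient_map_of ::
  "('g, 'x, 'e) gbundle \<Rightarrow> ('x \<Rightarrow> 'x \<Rightarrow> 'e \<Rightarrow> 'e) \<Rightarrow> 'e \<Rightarrow> 'e set" where
  "quotient_map_of F \<psi> u = clutching_rel F \<psi> `` {u}"

text \<open>
  \<open>F/\<psi>\<close>.  The operations are those of representatives (in a common fiber, for the sum); as usual
  for quotients, the unions below are unions of copies of one and the same class.
\<close>

definition quotient_rep ::
  "('g, 'x, 'e) gbundle \<Rightarrow> ('x \<Rightarrow> 'x \<Rightarrow> 'e \<Rightarrow> 'e) \<Rightarrow> ('g, 'e set) rep" where
  "quotient_rep F \<psi> =
     \<lparr>carrier = UNIV // clutching_rel F \<psi>, monoid.mult = undefined, one = undefined,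
      ring.zero = (\<Union>x. quotient_map_of F \<psi> (fzero F x)),
      ring.add = (\<lambda>A B. \<Union>u\<in>A. \<Union>v\<in>{v \<in> B. proj F v = proj F u}. quotient_map_of F \<psi> (fadd F u v)),
      smult = (\<lambda>c A. \<Union>u\<in>A. quotient_map_of F \<psi> (fsmult F c u)),
      act = (\<lambda>g A. \<Union>u\<in>A. quotient_map_of F \<psi> (total_act F g u))\<rparr>"

definition rep_extension ::
  "('g::topological_group_add, 'x, 'e) gbundle \<Rightarrow> ('g, 'w) rep \<Rightarrow> bool" where
  "rep_extension F W \<longleftrightarrow>
     representation W \<and> (\<forall>x. isomorphic_rep (isotropy F x) W (fiber F x))"

definition Psi_ext ::
  "('g::group_add, 'x, 'e) gbundle \<Rightarrow> ('g, 'w) rep \<Rightarrow> ('x \<Rightarrow> 'x \<Rightarrow> 'e \<Rightarrow> 'e) set" where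
  "Psi_ext F W = {\<psi> \<in> Psi F. isomorphic_rep UNIV (quotient_rep F \<psi>) W}"

end

theory Submission
  imports Defs "HOL-Library.Function_Algebras" "HOL-Computational_Algebra.Fundamental_Theorem_Algebra"
    "Jordan_Normal_Form.Determinant"
begin

text \<open>
  Since \<open>G\<close> is compact and abelian, \<open>W\<close> is diagonal in suitable coordinates. An element of
  \<open>\<Psi>\<^sub>F(W)\<close> is the same as an equivariant trivialization \<open>F \<rightarrow> W\<close> up to automorphisms of \<open>W\<close>;
  comparing with a fixed trivialization over one point, \<open>\<Psi>\<^sub>F(W)\<close> becomes the quotient \<open>L \ Z\<close>, where
  \<open>Z\<close> and \<open>L\<close> are the groups of invertible matrices commuting with the isotropy group and with \<open>G\<close>.
  Both consist of block matrices, so \<open>L \ Z\<close> is a product of quotients of \<open>GL\<^sub>n\<close> by block diagonal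
  subgroups.

  This quotient is covered by the translates of the big cell, on which the leading block minors do
  not vanish. A matrix in the big cell is a product of a lower and an upper block triangular factor,
  and scaling the off-diagonal blocks to zero contracts the cell inside the quotient. Finite
  intersections of cells are images of nonempty Zariski open subsets of a complex vector space:
  two points of such a set lie on a complex line that meets its complement in finitely many points,
  so the intersections are path connected, and the theorem follows as in van Kampen's theorem.
\<close>

text \<open>The obstacle is topological. \<open>Psi_ext F W\<close> carries pointwise convergence of
  clutching maps, and a bijection with a set of cosets says nothing about its open sets. Passing
  continuously from clutching maps back to matrices requires local sections: a clutching map
  determines, as holonomies, the conjugates of the diagonal matrices \<open>D (r x)\<close> by the
  unknown matrix \<open>A\<close>, and averaging over the finite base recovers \<open>A\<close> up
  to a left factor commuting with the whole group. Openness of the charts and continuity of the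
  contractions are both tested on such sections.

  Complex scalars enter twice: they provide eigenvectors, and a complex line stays connected after
  removing finitely many points. Commutativity makes both matrix groups block groups, for the
  partitions of the coordinates by characters of the isotropy group and of \<open>G\<close>; the
  second partition refines the first. Since any finitely many cells have a common point, a single
  base point serves all pieces of a subdivided loop.\<close>

section \<open>Homotopies of paths and a van Kampen argument\<close>

lemma homotopic_paths_convex_image:
  fixes T :: "'b::real_normed_vector set" and f :: "'b \<Rightarrow> 'a::topological_space"
  assumes "convex T" "path a" "path b" "path_image a \<subseteq> T" "path_image b \<subseteq> T"
    "pathstart a = pathstart b" "pathfinish a = pathfinish b"
    and f: "continuous_on T f" "f ` T \<subseteq> X"
  shows "homotopic_paths X (f \<circ> a) (f \<circ> b)"
proof -
  have "homotopic_paths T a b"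
  proof (rule homotopic_paths_linear)
    show "closed_segment (a t) (b t) \<subseteq> T" if "t \<in> {0..1}" for t
      using that assms by (intro closed_segment_subset) (auto simp: path_image_def)
  qed (use assms in auto)
  then show ?thesis
    using f by (intro homotopic_paths_continuous_image[where S=T]) auto
qed

text \<open>Both sides are \<open>p\<close> composed with paths in the unit interval from
  \<open>u\<close> to \<open>w\<close>, and convexity of the interval makes those homotopic. All
  reparametrizations of pieces of a loop are absorbed in this way.\<close>

lemma homotopic_paths_join_segments:
  fixes p :: "real \<Rightarrow> 'a::topological_space"
  assumes p: "path p" "path_image p \<subseteq> X" and uvw: "u \<in> {0..1}" "v \<in> {0..1}" "w \<in> {0..1}"
  shows "homotopic_paths X ((p \<circ> linepath u v) +++ (p \<circ> linepath v w)) (p \<circ> linepath u w)"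
proof -
  have sub: "path_image (linepath s t) \<subseteq> {0..1}" if "s \<in> {0..1}" "t \<in> {0..1}" for s t :: real
    using that closed_segment_subset[of s "{0..1}" t] by auto
  have "homotopic_paths X (p \<circ> (linepath u v +++ linepath v w)) (p \<circ> linepath u w)"
    using p uvw by (intro homotopic_paths_convex_image[where T = "{0..1}"] path_join_imp
        subset_path_image_join sub) (auto simp: path_image_def path_def)
  then show ?thesis
    by (simp add: path_compose_join)
qed

text \<open>
  Each path is pushed along the deformation \<open>h\<close>: its homotopy class is determined by the tracks of
  its endpoints.
\<close>
lemma homotopic_paths_deformation:
  fixes h :: "real \<times> 'a::topological_space \<Rightarrow> 'a"
  assumes h: "continuous_on ({0..1} \<times> U) h" "h ` ({0..1} \<times> U) \<subseteq> X"
    and h1: "\<And>x. x \<in> U \<Longrightarrow> h (1, x) = x" and h0: "\<And>x. x \<in> U \<Longrightarrow> h (0, x) = c"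
    and p: "path p" "path_image p \<subseteq> U" and q: "path q" "path_image q \<subseteq> U"
    and "pathstart p = pathstart q" "pathfinish p = pathfinish q"
  shows "homotopic_paths X p q"
proof -
  \<comment> \<open>First coordinate: deformation time; second: path parameter. \<open>sq\<close>
    runs along three sides of the square, down to time 0, across, and up again. The fourth side is
    at time 1, where \<open>h\<close> is the identity. On the middle side \<open>h\<close> is
    constantly \<open>c\<close>, and on the other two only the endpoints of the path enter.\<close>
  define sq where "sq = linepath (1::real, 0::real) (0, 0) +++ linepath (0, 0) (0, 1) +++ linepath (0, 1) (1, 1)"
  define S where "S = {0..1::real} \<times> {0..1::real}"
  have S: "convex S" unfolding S_def by (intro convex_Times) auto
  have seg: "path_image (linepath a b) \<subseteq> S" if "a \<in> S" "b \<in> S" for a b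
    using S that closed_segment_subset by fastforce
  have sq: "path sq" "path_image sq \<subseteq> S" "pathstart sq = (1, 0)" "pathfinish sq = (1, 1)"
    unfolding sq_def by (simp, intro subset_path_image_join seg, simp_all add: S_def)
  have UX: "U \<subseteq> X"
  proof
    fix x assume "x \<in> U"
    then have "h (1, x) \<in> X" by (intro subsetD[OF h(2)] imageI) simp
    then show "x \<in> X" using h1 \<open>x \<in> U\<close> by simp
  qed
  have side: "path_image (linepath (1, 0) (1, 1)) \<subseteq> S"
    by (rule seg) (simp_all add: S_def)
  have *: "homotopic_paths X r ((\<lambda>z. h (fst z, r (snd z))) \<circ> sq)"
    if r: "path r" "path_image r \<subseteq> U" for r
  proof -
    have "continuous_on S (\<lambda>z. r (snd z))"
      by (rule continuous_on_compose2[of "{0..1}" r])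
        (use r in \<open>auto simp: S_def path_def intro: continuous_intros\<close>)
    then have "continuous_on S (\<lambda>z. (fst z, r (snd z)))"
      by (intro continuous_on_Pair continuous_on_fst continuous_on_id)
    then have "continuous_on S (\<lambda>z. h (fst z, r (snd z)))"
      by (rule continuous_on_compose2[OF h(1)]) (use r in \<open>auto simp: S_def path_image_def\<close>)
    moreover have "(\<lambda>z. h (fst z, r (snd z))) ` S \<subseteq> X"
      using r h(2) by (force simp: S_def path_image_def)
    ultimately have "homotopic_paths X ((\<lambda>z. h (fst z, r (snd z))) \<circ> linepath (1, 0) (1, 1))
       ((\<lambda>z. h (fst z, r (snd z))) \<circ> sq)"
      using sq side by (intro homotopic_paths_convex_image[OF S]) simp_all
    moreover have "homotopic_paths X r ((\<lambda>z. h (fst z, r (snd z))) \<circ> linepath (1, 0) (1, 1))"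
    proof (rule homotopic_paths_eq)
      show "path_image r \<subseteq> X"
        using r UX by blast
      show "r t = ((\<lambda>z. h (fst z, r (snd z))) \<circ> linepath (1, 0) (1, 1)) t" if "t \<in> {0..1}" for t
      proof -
        have "r t \<in> U" using r that by (auto simp: path_image_def)
        then show ?thesis using h1 by (simp add: linepath_def)
      qed
    qed (use r in simp)
    ultimately show ?thesis
      using homotopic_paths_trans by blast
  qed
  have "((\<lambda>z. h (fst z, p (snd z))) \<circ> sq) t = ((\<lambda>z. h (fst z, q (snd z))) \<circ> sq) t" if "t \<in> {0..1}" for t
  proof -
    have [simp]: "p 0 = q 0" "p 1 = q 1"
      using assms by (auto simp: pathstart_def pathfinish_def)
    have "h (0, p s) = h (0, q s)" if "s \<in> {0..1}" for s
      using that p q h0 by (auto simp: path_image_def image_subset_iff)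
    with that show ?thesis
      unfolding sq_def joinpaths_def linepath_def by auto
  qed
  then have "homotopic_paths X ((\<lambda>z. h (fst z, p (snd z))) \<circ> sq) ((\<lambda>z. h (fst z, q (snd z))) \<circ> sq)"
    using *[OF p] homotopic_paths_imp_path homotopic_paths_imp_subset
    by (intro homotopic_paths_eq) blast+
  with *[OF p] *[OF q] show ?thesis
    using homotopic_paths_trans homotopic_paths_sym by blast
qed

text \<open>Lebesgue number of the preimages of the cover. The sets in \<open>\<U>\<close> are only
  open in \<open>X\<close>, so their preimages are open relative to the unit interval;
  \<open>\<C>\<close> collects open sets of reals whose trace on the interval is mapped into one
  member of \<open>\<U>\<close>.\<close>

lemma loop_subdivision:
  fixes p :: "real \<Rightarrow> 'a::topological_space"
  assumes p: "path p" "path_image p \<subseteq> X" "X \<subseteq> \<Union>\<U>" and op: "\<And>U. U \<in> \<U> \<Longrightarrow> openin (top_of_set X) U"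
  obtains n :: nat and U where "n > 0"
    "\<And>i. i < n \<Longrightarrow> U i \<in> \<U> \<and> p ` {real i / real n .. real (Suc i) / real n} \<subseteq> U i"
proof -
  define \<C> where "\<C> = {T. open T \<and> (\<exists>U\<in>\<U>. p ` ({0..1} \<inter> T) \<subseteq> U)}"
  have pc: "continuous_on {0..1} p" "p ` {0..1} \<subseteq> X"
    using p by (auto simp: path_def path_image_def)
  have cov: "{0..1} \<subseteq> \<Union>\<C>"
  proof
    fix t :: real assume t: "t \<in> {0..1}"
    then obtain U where U: "U \<in> \<U>" "p t \<in> U" using pc p by blast
    have "openin (top_of_set {0..1}) ({0..1} \<inter> p -` U)"
      using continuous_openin_preimage[OF pc(1) _ op[OF U(1)]] pc(2) by auto
    then obtain T where "open T" "{0..1} \<inter> p -` U = {0..1} \<inter> T"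
      by (auto simp: openin_open)
    then show "t \<in> \<Union>\<C>"
      using U t unfolding \<C>_def by blast
  qed
  obtain \<delta> where \<delta>: "\<delta> > 0" "\<And>T. T \<subseteq> {0..1} \<Longrightarrow> diameter T < \<delta> \<Longrightarrow> \<exists>B\<in>\<C>. T \<subseteq> B"
  proof (rule Lebesgue_number_lemma[of "{0..1::real}" \<C>])
    show "\<C> \<noteq> {}" using cov by force
  qed (use cov in \<open>auto simp: \<C>_def\<close>)
  obtain n :: nat where n: "n > 0" "inverse (real n) < \<delta>"
    using \<delta>(1) by (metis ex_inverse_of_nat_less)
  have "\<exists>U\<in>\<U>. p ` {real i / real n .. real (Suc i) / real n} \<subseteq> U" if "i < n" for i
  proof -
    let ?I = "{real i / real n .. real (Suc i) / real n}"
    have "?I \<subseteq> {0..1}" using that n by (auto simp: field_simps)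
    moreover have "diameter ?I < \<delta>"
    proof -
      have "real i / real n \<le> real (Suc i) / real n" by (simp add: divide_right_mono)
      moreover have "real (Suc i) / real n - real i / real n = inverse (real n)"
        by (simp add: divide_inverse algebra_simps)
      ultimately show ?thesis using n by (simp add: diameter_closed_interval)
    qed
    ultimately obtain B where "B \<in> \<C>" "?I \<subseteq> B" using \<delta>(2) by blast
    then obtain U where "U \<in> \<U>" "p ` ({0..1} \<inter> B) \<subseteq> U" unfolding \<C>_def by blast
    moreover have "p ` ?I \<subseteq> p ` ({0..1} \<inter> B)"
      using \<open>?I \<subseteq> {0..1}\<close> \<open>?I \<subseteq> B\<close> by (intro image_mono) simp
    ultimately show ?thesis by (meson order_trans)
  qed
  then obtain U where "\<And>i. i < n \<Longrightarrow> U i \<in> \<U> \<and> p ` {real i / real n .. real (Suc i) / real n} \<subseteq> U i"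
    by metis
  with n that show ?thesis by blast
qed

text \<open>
  A van Kampen argument in which the charts are only required to be simply connected relative to
  the whole space.
\<close>
theorem simply_connected_by_open_cover:
  fixes X :: "'a::topological_space set"
  assumes cover: "X \<subseteq> \<Union>\<U>" and op: "\<And>U. U \<in> \<U> \<Longrightarrow> openin (top_of_set X) U"
    and conn: "\<And>U U'. U \<in> \<U> \<Longrightarrow> U' \<in> \<U> \<Longrightarrow> path_connected (U \<inter> U')"
    and common: "\<And>\<V>. finite \<V> \<Longrightarrow> \<V> \<noteq> {} \<Longrightarrow> \<V> \<subseteq> \<U> \<Longrightarrow> \<Inter>\<V> \<noteq> {}"
    and contr: "\<And>U p q. \<lbrakk>U \<in> \<U>; path p; path q; path_image p \<subseteq> U; path_image q \<subseteq> U;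
        pathstart p = pathstart q; pathfinish p = pathfinish q\<rbrakk> \<Longrightarrow> homotopic_paths X p q"
  shows "simply_connected X"
proof -
  have sub: "U \<subseteq> X" if "U \<in> \<U>" for U
    using op[OF that] openin_imp_subset by blast
  have null: "homotopic_paths X p (\<lambda>_. p 0)" if p: "path p" "path_image p \<subseteq> X" "p 1 = p 0" for p
  proof -
    obtain n U where n: "n > 0"
      and U: "\<And>i. i < n \<Longrightarrow> U i \<in> \<U> \<and> p ` {real i / real n .. real (Suc i) / real n} \<subseteq> U i"
      using loop_subdivision[OF p(1,2) cover op] by metis
    define t where "t i = real i / real n" for i :: nat
    have t: "t i \<in> {0..1}" if "i \<le> n" for i using that n by (auto simp: t_def field_simps)
    have tt: "t i \<le> t (Suc i)" for i by (simp add: t_def divide_right_mono)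
    have Ut: "U i \<in> \<U>" "p ` {t i..t (Suc i)} \<subseteq> U i" if "i < n" for i
      using U[OF that] by (auto simp: t_def)
    have "\<Inter>(U ` {..<n}) \<noteq> {}"
      using n Ut by (intro common) auto
    \<comment> \<open>One base point lying in every chart that the loop visits; this is where finite
      intersections of arbitrary length are required to be nonempty.\<close>
    then obtain c where c: "\<And>i. i < n \<Longrightarrow> c \<in> U i" by blast
    \<comment> \<open>The pieces are numbered cyclically: \<open>U (l i)\<close> and
      \<open>U (r i)\<close> contain the pieces ending and starting at \<open>t i\<close>, and
      \<open>t 0\<close>, \<open>t n\<close> give the same point of the loop.\<close>
    define l where "l i = (if i = 0 then n - 1 else i - 1)" for i
    define r where "r i = (if i = n then 0 else i)" for i
    have "\<exists>d. path d \<and> path_image d \<subseteq> U (l i) \<inter> U (r i) \<and> pathstart d = c \<and> pathfinish d = p (t i)"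
      if "i \<le> n" for i
    proof -
      have lr: "l i < n" "r i < n" using that n by (auto simp: l_def r_def)
      have "p (t i) \<in> U (l i)"
      proof (cases "i = 0")
        case True
        then have "p (t i) = p (t n)" using n p(3) by (simp add: t_def)
        then show ?thesis using Ut(2)[of "n - 1"] n tt[of "n - 1"] True by (auto simp: l_def)
      next
        case False
        then obtain j where j: "i = Suc j" by (cases i) auto
        then have "p (t i) \<in> p ` {t j..t (Suc j)}" using tt[of j] by (intro imageI) simp
        then show ?thesis using Ut(2)[of j] that j by (auto simp: l_def)
      qed
      moreover have "p (t i) \<in> U (r i)"
      proof (cases "i = n")
        case True
        then have "p (t i) = p (t 0)" using n p(3) by (simp add: t_def)
        then show ?thesis using Ut(2)[of 0] n tt[of 0] True by (auto simp: r_def)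
      next
        case False
        then show ?thesis using Ut(2)[of i] that tt[of i] by (auto simp: r_def)
      qed
      ultimately show ?thesis
        using conn[OF Ut(1)[OF lr(1)] Ut(1)[OF lr(2)]] c lr unfolding path_connected_def by blast
    qed
    then obtain d0 where d0: "\<And>i. i \<le> n \<Longrightarrow> path (d0 i) \<and> path_image (d0 i) \<subseteq> U (l i) \<inter> U (r i) \<and>
        pathstart (d0 i) = c \<and> pathfinish (d0 i) = p (t i)"
      by metis
    \<comment> \<open>\<open>d0 0\<close> and \<open>d0 n\<close> may be different paths; taking one
      of them for both ends makes the chain of triangles close up.\<close>
    define d where "d i = (if i = n then d0 0 else d0 i)" for i
    have pt: "p (t n) = p (t 0)" using n p(3) by (simp add: t_def)
    have d: "path (d i)" "pathstart (d i) = c" "pathfinish (d i) = p (t i)" if "i \<le> n" for i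
      using d0[OF that] d0[of 0] pt by (auto simp: d_def)
    have dr: "path_image (d i) \<subseteq> U i" if "i < n" for i
      using d0[of i] that by (auto simp: d_def r_def)
    have dl: "path_image (d (Suc i)) \<subseteq> U i" if "i < n" for i
      using d0[of "Suc i"] d0[of 0] that by (auto simp: d_def l_def)
    have seg: "path (p \<circ> linepath u v)" "path_image (p \<circ> linepath u v) = p ` closed_segment u v"
      if "u \<in> {0..1}" "v \<in> {0..1}" for u v
    proof -
      have "closed_segment u v \<subseteq> {0..1}" using that closed_segment_subset[of u "{0..1}" v] by auto
      then show "path (p \<circ> linepath u v)"
        using p(1) by (intro path_continuous_image) (auto simp: path_def intro: continuous_on_subset)
    qed (simp add: path_image_compose)
    have piece: "path (p \<circ> linepath (t i) (t (Suc i)))" "path_image (p \<circ> linepath (t i) (t (Suc i))) \<subseteq> U i"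
      if "i < n" for i
      using seg[of "t i" "t (Suc i)"] that t[of i] t[of "Suc i"] tt[of i] Ut(2)[OF that]
      by (force simp: closed_segment_eq_real_ivl)+
    \<comment> \<open>The triangle formed by \<open>d i\<close>, the \<open>i\<close>-th piece of
      \<open>p\<close> and \<open>d (Suc i)\<close> lies in the single chart \<open>U i\<close>,
      where \<open>contr\<close> collapses it.\<close>
    have step: "homotopic_paths X (d 0 +++ (p \<circ> linepath 0 (t i))) (d i)" if "i \<le> n" for i
      using that
    proof (induction i)
      case 0
      have "path_image (p \<circ> linepath 0 0) \<subseteq> U 0"
        using Ut(2)[OF n] tt[of 0] n by (auto simp: path_image_def linepath_def t_def)
      then show ?case
        using n d[of 0] dr[OF n] seg(1)[of 0 0] Ut(1)[OF n]
        by (intro contr[of "U 0"] path_join_imp subset_path_image_join)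
          (auto simp: t_def path_def pathstart_def pathfinish_def joinpaths_def)
    next
      case (Suc i)
      then have i: "i < n" "i \<le> n" by auto
      have dX: "path_image (d j) \<subseteq> X" if "j \<le> n" for j
      proof (cases "j = n")
        case True
        then show ?thesis using dl[of "n - 1"] sub[OF Ut(1)[of "n - 1"]] n by auto
      next
        case False
        then show ?thesis using dr[of j] sub[OF Ut(1)[of j]] that by auto
      qed
      have t0: "0 \<in> {0..1::real}" by simp
      have sX: "path_image (p \<circ> linepath u v) \<subseteq> X" if "u \<in> {0..1}" "v \<in> {0..1}" for u v
        using seg(2)[OF that] closed_segment_subset[of u "{0..1}" v] that p(2) by (auto simp: path_image_def)
      have "homotopic_paths X (d 0 +++ (p \<circ> linepath 0 (t (Suc i))))
          (d 0 +++ ((p \<circ> linepath 0 (t i)) +++ (p \<circ> linepath (t i) (t (Suc i)))))"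
        using homotopic_paths_sym[OF homotopic_paths_join_segments[OF p(1,2) t0 t[OF i(2)] t[OF Suc.prems]]]
          d[of 0] dX[of 0] by (intro homotopic_paths_join) (simp_all add: t_def pathstart_compose)
      also have "homotopic_paths X \<dots> ((d 0 +++ (p \<circ> linepath 0 (t i))) +++ (p \<circ> linepath (t i) (t (Suc i))))"
        using d[of 0] dX[of 0] sX[OF t0 t[OF i(2)]] sX[OF t[OF i(2)] t[OF Suc.prems]] seg(1)[OF t0 t[OF i(2)]] seg(1)[OF t[OF i(2)] t[OF Suc.prems]]
        by (intro homotopic_paths_assoc) (simp_all add: t_def pathstart_compose pathfinish_compose)
      also have "homotopic_paths X \<dots> (d i +++ (p \<circ> linepath (t i) (t (Suc i))))"
        using sX[OF t[OF i(2)] t[OF Suc.prems]] seg(1)[OF t[OF i(2)] t[OF Suc.prems]]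
        by (intro homotopic_paths_join Suc.IH[OF i(2)]) (simp_all add: pathstart_compose pathfinish_compose)
      also have "homotopic_paths X \<dots> (d (Suc i))"
        using d[OF i(2)] d[OF Suc.prems] dr[OF i(1)] dl[OF i(1)] piece[OF i(1)] Ut(1)[OF i(1)]
        by (intro contr[of "U i"] path_join_imp subset_path_image_join)
          (simp_all add: pathstart_compose pathfinish_compose)
      finally show ?case .
    qed
    have dd: "d n = d 0" using n by (simp add: d_def)
    \<comment> \<open>For \<open>i = n\<close> the chain has returned to its initial connecting
      path, so \<open>p\<close> can be cancelled against \<open>d 0\<close>.\<close>
    have hp: "homotopic_paths X (d 0 +++ p) (d 0)"
    proof -
      have "p \<circ> linepath 0 (t n) = p" using n by (auto simp: t_def linepath_def)
      then show ?thesis using step[of n] by (simp add: dd)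
    qed
    let ?r = "reversepath (d 0)"
    have d0: "path (d 0)" "path_image (d 0) \<subseteq> U 0" "pathstart (d 0) = c" "pathfinish (d 0) = p 0"
      using d[of 0] dr[OF n] by (auto simp: t_def)
    have U0: "U 0 \<in> \<U>" "U 0 \<subseteq> X" using Ut(1)[OF n] sub by auto
    have pX: "p 0 \<in> U 0" using d0 by (metis pathfinish_in_path_image subsetD)
    have const_path: "path (\<lambda>_. p 0)" "path_image (\<lambda>_. p 0) \<subseteq> U 0"
      "pathstart (\<lambda>_. p 0) = p 0" "pathfinish (\<lambda>_. p 0) = p 0"
      using pX by (auto simp: path_image_def path_def pathstart_def pathfinish_def)
    have loop: "homotopic_paths X (?r +++ d 0) (\<lambda>_. p 0)"
      using d0 U0 const_path
      by (intro contr[of "U 0"] path_join_imp subset_path_image_join) simp_all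
    have "homotopic_paths X p ((\<lambda>_. p 0) +++ p)"
    proof -
      have "p \<circ> linepath 0 0 = (\<lambda>_. p 0)" "p \<circ> linepath 0 1 = p" by (auto simp: linepath_def)
      then show ?thesis
        using homotopic_paths_sym[OF homotopic_paths_join_segments[OF p(1,2), of 0 0 1]] by simp
    qed
    also have "homotopic_paths X \<dots> ((?r +++ d 0) +++ p)"
      using homotopic_paths_sym[OF loop] p(1,2)
      by (intro homotopic_paths_join) (simp_all add: pathfinish_def pathstart_def)
    also have "homotopic_paths X \<dots> (?r +++ (d 0 +++ p))"
      using d0 p(1,2) U0 by (intro homotopic_paths_sym[OF homotopic_paths_assoc]) (auto simp: pathstart_def)
    also have "homotopic_paths X \<dots> (?r +++ d 0)"
      using d0 U0 by (intro homotopic_paths_join hp) auto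
    also note loop
    finally show ?thesis .
  qed
  \<comment> \<open>\<open>simply_connected\<close> compares loops with different base points, so
    constant loops must be joined too: through a common point of two charts, each of which is path
    connected.\<close>
  have const: "homotopic_loops X (\<lambda>_. a) (\<lambda>_. b)" if ab: "a \<in> X" "b \<in> X" for a b
  proof -
    obtain A B where AB: "A \<in> \<U>" "a \<in> A" "B \<in> \<U>" "b \<in> B" using ab cover by blast
    then obtain e where e: "e \<in> A" "e \<in> B" using common[of "{A, B}"] by auto
    have *: "homotopic_loops X (\<lambda>_. x) (\<lambda>_. y)" if Uxy: "U \<in> \<U>" "x \<in> U" "y \<in> U" for U x y
    proof -
      obtain g where g: "path g" "path_image g \<subseteq> U" "pathstart g = x" "pathfinish g = y"
        using conn[OF Uxy(1) Uxy(1)] Uxy unfolding path_connected_def Int_absorb by meson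
      have gX: "g s \<in> X" if "s \<in> {0..1}" for s
        using subsetD[OF g(2), of "g s"] subsetD[OF sub[OF Uxy(1)], of "g s"] that by (simp add: path_image_def)
      have "continuous_on ({0..1} \<times> {0..1}) (\<lambda>z::real \<times> real. g (fst z))"
        by (rule continuous_on_compose2[of "{0..1}" g])
          (use g in \<open>auto simp: path_def intro: continuous_intros\<close>)
      then show ?thesis
        unfolding homotopic_loops using g gX
        by (intro exI[of _ "\<lambda>z. g (fst z)"]) (auto simp: pathstart_def pathfinish_def)
    qed
    from *[OF AB(1,2) e(1)] *[OF AB(3) e(2) AB(4)] show ?thesis by (rule homotopic_loops_trans)
  qed
  show ?thesis
    unfolding simply_connected_def
  proof safe
    fix p q
    assume p: "path p" "pathfinish p = pathstart p" "path_image p \<subseteq> X"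
      and q: "path q" "pathfinish q = pathstart q" "path_image q \<subseteq> X"
    have nl: "homotopic_loops X r (\<lambda>_. r 0)" "r 0 \<in> X"
      if "path r" "pathfinish r = pathstart r" "path_image r \<subseteq> X" for r
      using null[of r] that
      by (auto intro!: homotopic_paths_imp_homotopic_loops simp: pathstart_def pathfinish_def path_image_def)
    show "homotopic_loops X p q"
      using nl[OF p] nl[OF q] const by (meson homotopic_loops_sym homotopic_loops_trans)
  qed
qed

section \<open>Families of complex matrices\<close>

lemma mult_mat_entry:
  assumes "A \<in> carrier_mat n n" "B \<in> carrier_mat n n" "i < n" "j < n"
  shows "(A * B) $$ (i, j) = (\<Sum>k<n. A $$ (i, k) * B $$ (k, j))"
  using assms by (simp add: scalar_prod_def atLeast0LessThan)

lemma eq_square_matI: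
  assumes "A \<in> carrier_mat n n" "B \<in> carrier_mat n n"
    and "\<And>i j. i < n \<Longrightarrow> j < n \<Longrightarrow> A $$ (i, j) = B $$ (i, j)"
  shows "A = B"
  by (rule eq_matI) (use assms in auto)

lemma square_mult_carrier [simp]:
  "A \<in> carrier_mat n n \<Longrightarrow> B \<in> carrier_mat n n \<Longrightarrow> A * B \<in> carrier_mat n n"
  by (rule mult_carrier_mat)

lemmas square_mult_assoc = assoc_mult_mat[of _ n n _ n _ n for n]

text \<open>The adjugate formula reduces continuity of inversion to that of determinants of
  submatrices. For a singular matrix it gives the zero matrix, since
  \<open>inverse 0 = 0\<close>.\<close>

definition mat_inv :: "complex mat \<Rightarrow> complex mat" where
  "mat_inv A = inverse (det A) \<cdot>\<^sub>m adj_mat A"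

lemma mat_inv_carrier [simp]: "A \<in> carrier_mat n n \<Longrightarrow> mat_inv A \<in> carrier_mat n n"
  by (simp add: mat_inv_def adj_mat)

lemma mat_inv:
  assumes "A \<in> carrier_mat n n" "det A \<noteq> 0"
  shows "A * mat_inv A = 1\<^sub>m n" "mat_inv A * A = 1\<^sub>m n"
proof -
  have "inverse (det A) \<cdot>\<^sub>m (det A \<cdot>\<^sub>m 1\<^sub>m n) = 1\<^sub>m n"
    using assms by (intro eq_matI) auto
  then show "A * mat_inv A = 1\<^sub>m n" "mat_inv A * A = 1\<^sub>m n"
    using adj_mat[OF assms(1)] assms(1)
    by (simp_all add: mat_inv_def mult_smult_distrib[of _ n n _ n] mult_smult_assoc_mat[of _ n n _ n])
qed

lemma det_mat_inv_nonzero: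
  assumes "A \<in> carrier_mat n n" "det A \<noteq> 0"
  shows "det (mat_inv A) \<noteq> 0"
  using mat_inv(1)[OF assms] det_mult[OF assms(1) mat_inv_carrier[OF assms(1)]] by auto

lemma det_mult_nonzero:
  fixes A B :: "complex mat"
  assumes "A \<in> carrier_mat n n" "B \<in> carrier_mat n n" "det A \<noteq> 0" "det B \<noteq> 0"
  shows "det (A * B) \<noteq> 0"
  using assms by (simp add: det_mult)

lemma mat_inv_unique:
  assumes "A \<in> carrier_mat n n" "B \<in> carrier_mat n n" "det A \<noteq> 0" "A * B = 1\<^sub>m n"
  shows "B = mat_inv A"
proof -
  have "B = mat_inv A * A * B"
    using assms by (simp add: mat_inv)
  also have "\<dots> = mat_inv A"
    using assms square_mult_assoc[of "mat_inv A" n A B] right_mult_one_mat[of "mat_inv A" n n] by simp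
  finally show ?thesis .
qed

lemma mat_inv_mult:
  assumes "A \<in> carrier_mat n n" "B \<in> carrier_mat n n" "det A \<noteq> 0" "det B \<noteq> 0"
  shows "mat_inv (A * B) = mat_inv B * mat_inv A"
proof (rule mat_inv_unique[symmetric])
  have "A * B * (mat_inv B * mat_inv A) = A * (B * mat_inv B) * mat_inv A"
    using assms by (simp add: square_mult_assoc[of _ n])
  then show "A * B * (mat_inv B * mat_inv A) = 1\<^sub>m n"
    using assms by (simp add: mat_inv)
qed (use assms in \<open>auto simp: det_mult\<close>)

text \<open>Matrices of all sizes share one type, so continuity is understood entrywise at a fixed
  size.\<close>

definition cont_mat :: "nat \<Rightarrow> 't::topological_space set \<Rightarrow> ('t \<Rightarrow> complex mat) \<Rightarrow> bool" where
  "cont_mat n S f \<longleftrightarrow> (\<forall>x\<in>S. f x \<in> carrier_mat n n) \<and>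
     (\<forall>i<n. \<forall>j<n. continuous_on S (\<lambda>x. f x $$ (i, j)))"

lemma cont_mat_const: "A \<in> carrier_mat n n \<Longrightarrow> cont_mat n S (\<lambda>_. A)"
  by (simp add: cont_mat_def)

lemma cont_mat_compose:
  assumes "cont_mat n S f" "continuous_on T g" "g ` T \<subseteq> S"
  shows "cont_mat n T (\<lambda>x. f (g x))"
  unfolding cont_mat_def
proof (intro conjI ballI allI impI)
  fix i j assume "i < n" "j < n"
  then have "continuous_on S (\<lambda>x. f x $$ (i, j))" using assms(1) by (simp add: cont_mat_def)
  then show "continuous_on T (\<lambda>x. f (g x) $$ (i, j))"
    using assms(2,3) by (rule continuous_on_compose2)
qed (use assms in \<open>auto simp: cont_mat_def\<close>)

lemma cont_mat_mat:
  assumes "\<And>i j. i < n \<Longrightarrow> j < n \<Longrightarrow> continuous_on S (\<lambda>x. f x i j)"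
  shows "cont_mat n S (\<lambda>x. mat n n (\<lambda>(i, j). f x i j))"
  using assms by (simp add: cont_mat_def)

lemma cont_mat_mult:
  assumes "cont_mat n S f" "cont_mat n S g"
  shows "cont_mat n S (\<lambda>x. f x * g x)"
  unfolding cont_mat_def
proof (intro conjI ballI allI impI)
  fix i j assume ij: "i < n" "j < n"
  have "continuous_on S (\<lambda>x. \<Sum>k<n. f x $$ (i, k) * g x $$ (k, j))"
    using assms ij unfolding cont_mat_def by (intro continuous_on_sum continuous_on_mult) auto
  then show "continuous_on S (\<lambda>x. (f x * g x) $$ (i, j))"
    using assms ij
    by (subst continuous_on_cong[OF refl mult_mat_entry]) (auto simp: cont_mat_def)
qed (use assms in \<open>auto simp: cont_mat_def intro!: mult_carrier_mat\<close>)

lemma cont_mat_det: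
  assumes "cont_mat n S f"
  shows "continuous_on S (\<lambda>x. det (f x))"
proof -
  have "continuous_on S (\<lambda>x. \<Sum>p | p permutes {0..<n}. of_int (sign p) * (\<Prod>i = 0..<n. f x $$ (i, p i)))"
    using assms unfolding cont_mat_def
    by (intro continuous_on_sum continuous_on_mult continuous_on_const continuous_on_prod)
      (auto dest: permutes_in_image)
  then show ?thesis
    using assms by (subst continuous_on_cong[OF refl det_def'[of _ n]]) (auto simp: cont_mat_def)
qed

lemma cont_mat_delete:
  assumes "cont_mat n S f" "i < n" "j < n"
  shows "cont_mat (n - 1) S (\<lambda>x. mat_delete (f x) i j)"
  unfolding cont_mat_def
proof (intro conjI ballI allI impI)
  fix k l assume kl: "k < n - 1" "l < n - 1"
  have "continuous_on S (\<lambda>x. f x $$ (if k < i then k else Suc k, if l < j then l else Suc l))"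
    using assms kl unfolding cont_mat_def by auto
  then show "continuous_on S (\<lambda>x. mat_delete (f x) i j $$ (k, l))"
    using assms kl by (subst continuous_on_cong[OF refl, of _ _
        "\<lambda>x. f x $$ (if k < i then k else Suc k, if l < j then l else Suc l)"])
      (auto simp: cont_mat_def mat_delete_def)
qed (use assms in \<open>auto simp: cont_mat_def mat_delete_def\<close>)

lemma cont_mat_inv:
  assumes f: "cont_mat n S f" and d: "\<And>x. x \<in> S \<Longrightarrow> det (f x) \<noteq> 0"
  shows "cont_mat n S (\<lambda>x. mat_inv (f x))"
  unfolding cont_mat_def
proof (intro conjI ballI allI impI)
  fix i j assume ij: "i < n" "j < n"
  have "continuous_on S (\<lambda>x. inverse (det (f x)) * ((- 1) ^ (j + i) * det (mat_delete (f x) j i)))"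
    using ij d by (intro continuous_on_mult continuous_on_inverse continuous_on_const
        cont_mat_det[OF f] cont_mat_det[OF cont_mat_delete[OF f]]) auto
  then show "continuous_on S (\<lambda>x. mat_inv (f x) $$ (i, j))"
    using f ij by (subst continuous_on_cong[OF refl, of _ _
        "\<lambda>x. inverse (det (f x)) * ((- 1) ^ (j + i) * det (mat_delete (f x) j i))"])
      (auto simp: cont_mat_def mat_inv_def adj_mat_def cofactor_def)
qed (use f in \<open>auto simp: cont_mat_def\<close>)

section \<open>Polynomial functions along complex lines\<close>

definition polyfun :: "(complex \<Rightarrow> complex) \<Rightarrow> bool" where
  "polyfun f \<longleftrightarrow> (\<exists>p. \<forall>z. f z = poly p z)"

lemma polyfun_const: "polyfun (\<lambda>_. c)"
  unfolding polyfun_def by (intro exI[of _ "[:c:]"]) auto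

lemma polyfun_affine: "polyfun (\<lambda>z. a + z * b)"
  unfolding polyfun_def by (intro exI[of _ "[:a, b:]"]) auto

lemma polyfun_add: "polyfun f \<Longrightarrow> polyfun g \<Longrightarrow> polyfun (\<lambda>z. f z + g z)"
  unfolding polyfun_def using poly_add by metis

lemma polyfun_mult: "polyfun f \<Longrightarrow> polyfun g \<Longrightarrow> polyfun (\<lambda>z. f z * g z)"
  unfolding polyfun_def using poly_mult by metis

lemma polyfun_sum: "(\<And>i. i \<in> I \<Longrightarrow> polyfun (f i)) \<Longrightarrow> polyfun (\<lambda>z. \<Sum>i\<in>I. f i z)"
  by (induction I rule: infinite_finite_induct) (simp_all add: polyfun_const polyfun_add)

lemma polyfun_prod: "(\<And>i. i \<in> I \<Longrightarrow> polyfun (f i)) \<Longrightarrow> polyfun (\<lambda>z. \<Prod>i\<in>I. f i z)"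
  by (induction I rule: infinite_finite_induct) (simp_all add: polyfun_const polyfun_mult)

lemma finite_zeros_polyfun:
  assumes "polyfun f" "f z \<noteq> 0"
  shows "finite {z. f z = 0}"
proof -
  obtain p where "f = poly p" unfolding fun_eq_iff using assms(1) by (auto simp: polyfun_def)
  moreover from this have "p \<noteq> 0" using assms(2) by auto
  ultimately show ?thesis using poly_roots_finite[of p] by simp
qed

lemma polyfun_det:
  assumes "\<And>z. f z \<in> carrier_mat n n" "\<And>i j. i < n \<Longrightarrow> j < n \<Longrightarrow> polyfun (\<lambda>z. f z $$ (i, j))"
  shows "polyfun (\<lambda>z. det (f z))"
  unfolding det_def'[OF assms(1)]
  using assms(2) by (intro polyfun_sum polyfun_mult polyfun_const polyfun_prod)
    (auto dest: permutes_in_image)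

text \<open>A one-variable substitute for polynomial functions on a matrix space: nonvanishing is
  only ever compared along the complex line through two given matrices.\<close>

definition line_polynomial :: "nat \<Rightarrow> (complex mat \<Rightarrow> complex) \<Rightarrow> bool" where
  "line_polynomial n F \<longleftrightarrow>
     (\<forall>A\<in>carrier_mat n n. \<forall>B\<in>carrier_mat n n. polyfun (\<lambda>z. F (A + z \<cdot>\<^sub>m (B - A))))"

lemma line_polynomial_prod:
  "(\<And>i. i \<in> I \<Longrightarrow> line_polynomial n (F i)) \<Longrightarrow> line_polynomial n (\<lambda>A. \<Prod>i\<in>I. F i A)"
  by (simp add: line_polynomial_def polyfun_prod)

lemma line_point:
  fixes A B :: "complex mat"
  assumes "A \<in> carrier_mat n n" "B \<in> carrier_mat n n"
  shows "A + 0 \<cdot>\<^sub>m (B - A) = A" "A + 1 \<cdot>\<^sub>m (B - A) = B"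
proof -
  show "A + 0 \<cdot>\<^sub>m (B - A) = A" by (rule eq_matI) (use carrier_matD[OF assms(1)] carrier_matD[OF assms(2)] in simp_all)
  show "A + 1 \<cdot>\<^sub>m (B - A) = B" by (rule eq_matI) (use carrier_matD[OF assms(1)] carrier_matD[OF assms(2)] in simp_all)
qed

text \<open>Irreducibility of an affine space. On the line from a common nonzero of the functions in
  \<open>I\<close> to a nonzero of \<open>F k\<close>, the product over \<open>I\<close> and
  \<open>F k\<close> each have finitely many zeros, so some point of the line avoids them
  all.\<close>

lemma common_nonzero:
  assumes "finite I" "M \<subseteq> carrier_mat n n" "M \<noteq> {}"
    and line: "\<And>A B z. A \<in> M \<Longrightarrow> B \<in> M \<Longrightarrow> A + z \<cdot>\<^sub>m (B - A) \<in> M"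
    and F: "\<And>i. i \<in> I \<Longrightarrow> line_polynomial n (F i)" and "\<And>i. i \<in> I \<Longrightarrow> \<exists>A\<in>M. F i A \<noteq> 0"
  shows "\<exists>A\<in>M. \<forall>i\<in>I. F i A \<noteq> 0"
  using assms(1,5,6)
proof (induction I)
  case empty
  then show ?case using \<open>M \<noteq> {}\<close> by auto
next
  case (insert k I)
  from insert obtain A where A: "A \<in> M" "\<forall>i\<in>I. F i A \<noteq> 0" by auto
  from insert.prems obtain B where B: "B \<in> M" "F k B \<noteq> 0" by auto
  have AB: "A \<in> carrier_mat n n" "B \<in> carrier_mat n n" using A B assms(2) by auto
  define G where "G z = (\<Prod>i\<in>I. F i (A + z \<cdot>\<^sub>m (B - A)))" for z
  have G: "polyfun G" "polyfun (\<lambda>z. F k (A + z \<cdot>\<^sub>m (B - A)))"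
    using insert.prems(1) AB polyfun_prod[of I "\<lambda>i z. F i (A + z \<cdot>\<^sub>m (B - A))"]
    by (simp_all add: G_def[abs_def] line_polynomial_def)
  have "G 0 \<noteq> 0" using A insert.hyps(1) by (simp add: G_def line_point(1)[OF AB])
  then have "finite {z. G z = 0}" by (rule finite_zeros_polyfun[OF G(1)])
  moreover have "finite {z. F k (A + z \<cdot>\<^sub>m (B - A)) = 0}"
    by (rule finite_zeros_polyfun[OF G(2), of 1]) (use B AB in \<open>simp add: line_point(2)[OF AB, simplified]\<close>)
  ultimately have "finite ({z. G z = 0} \<union> {z. F k (A + z \<cdot>\<^sub>m (B - A)) = 0})" by simp
  then obtain z where "z \<notin> {z. G z = 0} \<union> {z. F k (A + z \<cdot>\<^sub>m (B - A)) = 0}"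
    using ex_new_if_finite[OF infinite_UNIV_char_0] by metis
  then have "\<forall>i\<in>insert k I. F i (A + z \<cdot>\<^sub>m (B - A)) \<noteq> 0"
    using insert.hyps(1) by (auto simp: G_def)
  then show ?case using line[OF A(1) B(1)] by blast
qed

section \<open>Block matrices and triangular decomposition\<close>

text \<open>The blocks are the classes of indices with equal label \<open>r i\<close>. They need not
  be intervals, so eigenvalue classes can be used without reordering a basis.\<close>

definition block_mat :: "nat \<Rightarrow> (nat \<Rightarrow> nat) \<Rightarrow> complex mat \<Rightarrow> bool" where
  "block_mat n r A \<longleftrightarrow> A \<in> carrier_mat n n \<and> (\<forall>i<n. \<forall>j<n. r i \<noteq> r j \<longrightarrow> A $$ (i, j) = 0)"

lemma block_mat_carrier: "block_mat n r A \<Longrightarrow> A \<in> carrier_mat n n"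
  by (simp add: block_mat_def)

lemma block_mat_entry: "block_mat n r A \<Longrightarrow> i < n \<Longrightarrow> j < n \<Longrightarrow> r i \<noteq> r j \<Longrightarrow> A $$ (i, j) = 0"
  by (simp add: block_mat_def)

definition diag :: "nat \<Rightarrow> (nat \<Rightarrow> complex) \<Rightarrow> complex mat" where
  "diag n d = mat n n (\<lambda>(i, j). if i = j then d i else 0)"

lemma diag_carrier [simp]: "diag n d \<in> carrier_mat n n"
  by (simp add: diag_def)

lemma diag_entry: "i < n \<Longrightarrow> j < n \<Longrightarrow> diag n d $$ (i, j) = (if i = j then d i else 0)"
  by (simp add: diag_def)

lemma mult_diag_entry:
  assumes M: "M \<in> carrier_mat n n" and ij: "i < n" "j < n"
  shows "(M * diag n d) $$ (i, j) = M $$ (i, j) * d j" "(diag n d * M) $$ (i, j) = d i * M $$ (i, j)"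
proof -
  have "(\<Sum>k<n. M $$ (i, k) * diag n d $$ (k, j)) = (\<Sum>k<n. if k = j then M $$ (i, j) * d j else 0)"
    using ij by (intro sum.cong) (auto simp: diag_entry)
  then show "(M * diag n d) $$ (i, j) = M $$ (i, j) * d j"
    unfolding mult_mat_entry[OF M diag_carrier ij] using ij by simp
  have "(\<Sum>k<n. diag n d $$ (i, k) * M $$ (k, j)) = (\<Sum>k<n. if k = i then d i * M $$ (i, j) else 0)"
    using ij by (intro sum.cong) (auto simp: diag_entry)
  then show "(diag n d * M) $$ (i, j) = d i * M $$ (i, j)"
    unfolding mult_mat_entry[OF diag_carrier M ij] using ij by simp
qed

lemma block_mat_one: "block_mat n r (1\<^sub>m n)"
  by (auto simp: block_mat_def)

lemma block_mat_mult:
  assumes A: "block_mat n r A" and B: "block_mat n r B"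
  shows "block_mat n r (A * B)"
  unfolding block_mat_def
proof (intro conjI allI impI)
  fix i j assume ij: "i < n" "j < n" "r i \<noteq> r j"
  have "A $$ (i, k) * B $$ (k, j) = 0" if "k < n" for k
    using ij that block_mat_entry[OF A, of i k] block_mat_entry[OF B, of k j] by (cases "r i = r k") auto
  then show "(A * B) $$ (i, j) = 0"
    unfolding mult_mat_entry[OF block_mat_carrier[OF A] block_mat_carrier[OF B] ij(1,2)]
    by (intro sum.neutral) simp
qed (use A B in \<open>simp add: block_mat_carrier\<close>)

text \<open>Block matrices are the ones commuting with a diagonal matrix, so inverses are block matrices.\<close>
lemma block_mat_inv:
  assumes A: "block_mat n r A" and d: "det A \<noteq> 0"
  shows "block_mat n r (mat_inv A)"
proof -
  define D where "D = diag n (\<lambda>i. of_nat (r i))"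
  have c: "A \<in> carrier_mat n n" "D \<in> carrier_mat n n" "mat_inv A \<in> carrier_mat n n"
    using A by (simp_all add: block_mat_carrier D_def)
  have MD: "(M * D) $$ (i, j) = M $$ (i, j) * of_nat (r j)" "(D * M) $$ (i, j) = of_nat (r i) * M $$ (i, j)"
    if "M \<in> carrier_mat n n" "i < n" "j < n" for M i j
    using that by (simp_all add: D_def mult_diag_entry del: index_mult_mat(1))
  have comm: "A * D = D * A"
  proof (rule eq_square_matI[of _ n])
    fix i j assume ij: "i < n" "j < n"
    then show "(A * D) $$ (i, j) = (D * A) $$ (i, j)"
      using MD[OF c(1), of i j] block_mat_entry[OF A, of i j]
      by (cases "r i = r j") (simp_all del: index_mult_mat(1))
  qed (use c in simp_all)
  have "mat_inv A * D = mat_inv A * D * (A * mat_inv A)"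
    using c d by (simp add: mat_inv right_mult_one_mat[of _ n n])
  also have "\<dots> = mat_inv A * (D * A) * mat_inv A"
    using c by (simp add: square_mult_assoc[of _ n])
  also have "\<dots> = mat_inv A * A * D * mat_inv A"
    unfolding comm[symmetric] using c by (simp add: square_mult_assoc[of _ n])
  also have "\<dots> = D * mat_inv A"
    using c d by (simp add: mat_inv)
  finally have *: "mat_inv A * D = D * mat_inv A" .
  have "mat_inv A $$ (i, j) = 0" if "i < n" "j < n" "r i \<noteq> r j" for i j
    using MD[OF c(3), of i j] * that by (simp add: mult.commute del: index_mult_mat(1))
  then show ?thesis
    using c by (simp add: block_mat_def)
qed

text \<open>The corner of \<open>A\<close> with labels at most \<open>k\<close>, padded by the
  identity. The size stays \<open>n\<close>, and the determinant is the leading block minor even if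
  the labels are not in increasing order.\<close>

definition cut :: "nat \<Rightarrow> (nat \<Rightarrow> nat) \<Rightarrow> nat \<Rightarrow> complex mat \<Rightarrow> complex mat" where
  "cut n r k A = mat n n (\<lambda>(i, j). if r i \<le> k \<and> r j \<le> k then A $$ (i, j) else if i = j then 1 else 0)"

lemma cut_carrier [simp]: "cut n r k A \<in> carrier_mat n n"
  by (simp add: cut_def)

lemma cut_entry: "i < n \<Longrightarrow> j < n \<Longrightarrow>
    cut n r k A $$ (i, j) = (if r i \<le> k \<and> r j \<le> k then A $$ (i, j) else if i = j then 1 else 0)"
  by (simp add: cut_def)

lemma cut_one: "cut n r k (1\<^sub>m n) = 1\<^sub>m n"
  by (rule eq_matI) (auto simp: cut_def)

lemma cut_top: "A \<in> carrier_mat n n \<Longrightarrow> (\<And>i. i < n \<Longrightarrow> r i \<le> n) \<Longrightarrow> cut n r n A = A"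
  by (rule eq_matI) (auto simp: cut_def)

text \<open>Row \<open>i\<close> of \<open>l\<close> only involves indices with the label of
  \<open>i\<close>, so a row inside the corner never reaches outside it.\<close>

lemma cut_mult:
  assumes l: "block_mat n r l" and A: "A \<in> carrier_mat n n"
  shows "cut n r k (l * A) = cut n r k l * cut n r k A"
proof (rule eq_square_matI[of _ n])
  fix i j assume ij: "i < n" "j < n"
  have lc: "l \<in> carrier_mat n n" using l by (rule block_mat_carrier)
  have R: "(cut n r k l * cut n r k A) $$ (i, j) = (\<Sum>p<n. cut n r k l $$ (i, p) * cut n r k A $$ (p, j))"
    using ij by (simp add: mult_mat_entry[of _ n])
  consider "r i \<le> k" "r j \<le> k" | "r i \<le> k" "\<not> r j \<le> k" | "\<not> r i \<le> k" by blast
  then show "cut n r k (l * A) $$ (i, j) = (cut n r k l * cut n r k A) $$ (i, j)"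
  proof cases
    case 1
    have "(l * A) $$ (i, j) = (\<Sum>p<n. cut n r k l $$ (i, p) * cut n r k A $$ (p, j))"
      unfolding mult_mat_entry[OF lc A ij]
    proof (rule sum.cong)
      fix p assume "p \<in> {..<n}"
      then show "l $$ (i, p) * A $$ (p, j) = cut n r k l $$ (i, p) * cut n r k A $$ (p, j)"
        using 1 ij block_mat_entry[OF l, of i p] by (auto simp: cut_entry)
    qed simp
    then show ?thesis using 1 ij by (simp add: R cut_entry)
  next
    case 2
    have "(\<Sum>p<n. cut n r k l $$ (i, p) * cut n r k A $$ (p, j)) = 
        (\<Sum>p<n. if p = j then cut n r k l $$ (i, p) else 0)"
      using 2 ij by (intro sum.cong) (auto simp: cut_entry)
    then show ?thesis unfolding R using 2 ij by (auto simp: cut_entry)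
  next
    case 3
    have "(\<Sum>p<n. cut n r k l $$ (i, p) * cut n r k A $$ (p, j)) = 
        (\<Sum>p<n. if p = i then cut n r k A $$ (p, j) else 0)"
      using 3 ij by (intro sum.cong) (auto simp: cut_entry)
    then show ?thesis unfolding R using 3 ij by (auto simp: cut_entry)
  qed
qed simp_all

lemma block_mat_cut: "block_mat n s A \<Longrightarrow> block_mat n s (cut n r k A)"
  by (auto simp: block_mat_def cut_entry)

text \<open>By multiplicativity, the cut of the inverse of \<open>l\<close> is an inverse of the cut
  of \<open>l\<close>.\<close>

lemma det_cut_block:
  assumes l: "block_mat n r l" "det l \<noteq> 0"
  shows "det (cut n r k l) \<noteq> 0"
proof
  assume "det (cut n r k l) = 0"
  moreover have "cut n r k l * cut n r k (mat_inv l) = 1\<^sub>m n"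
    using cut_mult[OF l(1), of "mat_inv l" k] l block_mat_carrier[OF l(1)] by (simp add: mat_inv cut_one)
  ultimately show False
    using det_mult[of "cut n r k l" n "cut n r k (mat_inv l)"] by simp
qed

text \<open>The big cell. If all labels are at most \<open>n\<close>, the condition for
  \<open>k = n\<close> is \<open>det A \<noteq> 0\<close> itself.\<close>

definition minors_nonzero :: "nat \<Rightarrow> (nat \<Rightarrow> nat) \<Rightarrow> complex mat \<Rightarrow> bool" where
  "minors_nonzero n r A \<longleftrightarrow> A \<in> carrier_mat n n \<and> (\<forall>k\<le>n. det (cut n r k A) \<noteq> 0)"

lemma minors_nonzero_mult:
  assumes "block_mat n r l" "det l \<noteq> 0" "minors_nonzero n r A"
  shows "minors_nonzero n r (l * A)"
  using assms det_cut_block[OF assms(1,2)] block_mat_carrier[OF assms(1)]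
  by (simp add: minors_nonzero_def cut_mult det_mult_nonzero[of _ n])

text \<open>The lower block triangular matrix \<open>N\<close> for which \<open>N * A\<close> is
  upper triangular with identity diagonal blocks. Restricted to columns with labels at most
  \<open>r i\<close>, this says that row \<open>i\<close> of \<open>N\<close> times the leading
  corner is a unit vector, so that row is read off from the inverse of the corner.\<close>

definition lower_factor :: "nat \<Rightarrow> (nat \<Rightarrow> nat) \<Rightarrow> complex mat \<Rightarrow> complex mat" where
  "lower_factor n r A = mat n n (\<lambda>(i, j). if r j \<le> r i then mat_inv (cut n r (r i) A) $$ (i, j) else 0)"

lemma lower_factor_carrier [simp]: "lower_factor n r A \<in> carrier_mat n n"
  by (simp add: lower_factor_def)

lemma lower_factor_entry: "i < n \<Longrightarrow> j < n \<Longrightarrow>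
    lower_factor n r A $$ (i, j) = (if r j \<le> r i then mat_inv (cut n r (r i) A) $$ (i, j) else 0)"
  by (simp add: lower_factor_def)

text \<open>Row \<open>i\<close> of the lower factor only sees the rows of \<open>M\<close> with
  labels at most \<open>r i\<close>, so column \<open>j\<close> of \<open>M\<close> may be
  truncated. In the applications \<open>M'\<close> is a cut of \<open>M\<close>.\<close>

lemma lower_factor_mult_entry:
  assumes M: "M \<in> carrier_mat n n" and ij: "i < n" "j < n" "r j \<le> r i"
    and below: "\<And>p. p < n \<Longrightarrow> \<not> r p \<le> r i \<Longrightarrow> M' $$ (p, j) = 0"
    and same: "\<And>p. p < n \<Longrightarrow> r p \<le> r i \<Longrightarrow> M' $$ (p, j) = M $$ (p, j)" and M': "M' \<in> carrier_mat n n"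
  shows "(lower_factor n r A * M) $$ (i, j) = (mat_inv (cut n r (r i) A) * M') $$ (i, j)"
proof -
  have "(\<Sum>p<n. lower_factor n r A $$ (i, p) * M $$ (p, j)) =
      (\<Sum>p<n. mat_inv (cut n r (r i) A) $$ (i, p) * M' $$ (p, j))"
    by (intro sum.cong refl) (use below same ij in \<open>auto simp: lower_factor_entry\<close>)
  then show ?thesis
    using assms by (simp add: mult_mat_entry[of _ n])
qed

lemma lower_factor_mult_self:
  assumes A: "minors_nonzero n r A" and r: "\<And>i. i < n \<Longrightarrow> r i \<le> n" and ij: "i < n" "j < n" "r j \<le> r i"
  shows "(lower_factor n r A * A) $$ (i, j) = (if i = j then 1 else 0)"
proof -
  have Ac: "A \<in> carrier_mat n n" using A by (simp add: minors_nonzero_def)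
  have "(lower_factor n r A * A) $$ (i, j) = (mat_inv (cut n r (r i) A) * cut n r (r i) A) $$ (i, j)"
    using ij by (intro lower_factor_mult_entry Ac) (auto simp: cut_entry)
  also have "\<dots> = 1\<^sub>m n $$ (i, j)"
    using A r ij by (subst mat_inv[of _ n]) (auto simp: minors_nonzero_def)
  finally show ?thesis using ij by simp
qed

text \<open>Cutting is multiplicative on \<open>l * A\<close>, so the inverse of the cut of
  \<open>l * A\<close> times the cut of \<open>l\<close> is the inverse of the cut of
  \<open>A\<close>. This equivariance is what lets the contraction pass to the quotient.\<close>

lemma lower_factor_block_mult:
  assumes A: "minors_nonzero n r A" and l: "block_mat n r l" "det l \<noteq> 0"
    and r: "\<And>i. i < n \<Longrightarrow> r i \<le> n"
  shows "lower_factor n r (l * A) * l = lower_factor n r A"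
proof (rule eq_square_matI[of _ n])
  have c: "A \<in> carrier_mat n n" "l \<in> carrier_mat n n"
    using A l block_mat_carrier by (auto simp: minors_nonzero_def)
  fix i j assume ij: "i < n" "j < n"
  show "(lower_factor n r (l * A) * l) $$ (i, j) = lower_factor n r A $$ (i, j)"
  proof (cases "r j \<le> r i")
    case True
    let ?c = "\<lambda>M. cut n r (r i) M"
    have d: "det (?c A) \<noteq> 0" "det (?c l) \<noteq> 0"
      using A r ij det_cut_block[OF l] by (auto simp: minors_nonzero_def)
    have "(lower_factor n r (l * A) * l) $$ (i, j) = (mat_inv (?c (l * A)) * ?c l) $$ (i, j)"
      using True ij by (intro lower_factor_mult_entry c) (auto simp: cut_entry)
    also have "mat_inv (?c (l * A)) * ?c l = mat_inv (?c A) * (mat_inv (?c l) * ?c l)"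
      using d by (simp add: cut_mult[OF l(1) c(1)] mat_inv_mult[of _ n] square_mult_assoc[of _ n])
    also have "\<dots> = mat_inv (?c A)"
      using d by (simp add: mat_inv[of _ n] right_mult_one_mat[of _ n n])
    finally show ?thesis using True ij by (simp add: lower_factor_entry)
  next
    case False
    have "lower_factor n r (l * A) $$ (i, p) * l $$ (p, j) = 0" if "p < n" for p
      using False ij that block_mat_entry[OF l(1), of p j] by (cases "r p = r j") (auto simp: lower_factor_entry)
    then have "(lower_factor n r (l * A) * l) $$ (i, j) = 0"
      unfolding mult_mat_entry[OF lower_factor_carrier c(2) ij] by (intro sum.neutral) simp
    then show ?thesis
      using False ij by (simp add: lower_factor_entry)
  qed
qed (use block_mat_carrier[OF l(1)] in simp_all)

text \<open>A second partition \<open>s\<close> survives the decomposition, because cuts and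
  inverses respect it. This keeps the contraction inside the group of block matrices for
  \<open>s\<close>.\<close>

lemma block_mat_lower_factor:
  assumes "block_mat n s A" "minors_nonzero n r A" "\<And>i. i < n \<Longrightarrow> r i \<le> n"
  shows "block_mat n s (lower_factor n r A)"
proof -
  have "block_mat n s (mat_inv (cut n r (r i) A))" if "i < n" for i
    using that assms by (intro block_mat_inv block_mat_cut) (auto simp: minors_nonzero_def)
  then show ?thesis
    by (auto simp: block_mat_def lower_factor_entry)
qed

section \<open>Contraction of the triangular factors\<close>

text \<open>With truncated subtraction the exponent is the distance of the labels. For nonzero
  \<open>s\<close> this is conjugation by the diagonal matrix of the \<open>s ^ r i\<close> on lower
  triangular matrices and by its inverse on upper ones. At \<open>s = 0\<close> the convention
  \<open>0 ^ 0 = 1\<close> keeps exactly the diagonal blocks.\<close>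

definition scale :: "nat \<Rightarrow> (nat \<Rightarrow> nat) \<Rightarrow> complex \<Rightarrow> complex mat \<Rightarrow> complex mat" where
  "scale n r s A = mat n n (\<lambda>(i, j). A $$ (i, j) * s ^ ((r i - r j) + (r j - r i)))"

lemma scale_carrier [simp]: "scale n r s A \<in> carrier_mat n n"
  by (simp add: scale_def)

lemma scale_entry: "i < n \<Longrightarrow> j < n \<Longrightarrow>
    scale n r s A $$ (i, j) = A $$ (i, j) * s ^ ((r i - r j) + (r j - r i))"
  by (simp add: scale_def)

lemma scale_one: "A \<in> carrier_mat n n \<Longrightarrow> scale n r 1 A = A"
  by (rule eq_matI) (auto simp: scale_def)

lemma block_mat_scale: "block_mat n t A \<Longrightarrow> block_mat n t (scale n r s A)"
  by (auto simp: block_mat_def scale_entry)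

lemma block_mat_scale_zero: "block_mat n r (scale n r 0 A)"
  by (auto simp: block_mat_def scale_entry)

text \<open>Right multiplication by \<open>l\<close> mixes only columns with equal labels, and the
  scaling factor depends on labels alone.\<close>

lemma scale_mult_block:
  assumes A: "A \<in> carrier_mat n n" and l: "block_mat n r l"
  shows "scale n r s (A * l) = scale n r s A * l"
proof (rule eq_square_matI[of _ n])
  have lc: "l \<in> carrier_mat n n" using l by (rule block_mat_carrier)
  fix i j assume ij: "i < n" "j < n"
  have "(\<Sum>p<n. A $$ (i, p) * l $$ (p, j)) * s ^ ((r i - r j) + (r j - r i)) =
      (\<Sum>p<n. scale n r s A $$ (i, p) * l $$ (p, j))"
    unfolding sum_distrib_right
  proof (intro sum.cong refl)
    fix p assume "p \<in> {..<n}"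
    then show "A $$ (i, p) * l $$ (p, j) * s ^ ((r i - r j) + (r j - r i)) = scale n r s A $$ (i, p) * l $$ (p, j)"
      using ij block_mat_entry[OF l, of p j] by (cases "r p = r j") (auto simp: scale_entry)
  qed
  then show "scale n r s (A * l) $$ (i, j) = (scale n r s A * l) $$ (i, j)"
    using ij by (simp add: scale_entry mult_mat_entry[OF A lc ij] mult_mat_entry[OF scale_carrier lc ij]
        del: index_mult_mat(1))
qed (use block_mat_carrier[OF l] in simp_all)

text \<open>For nonzero \<open>s\<close> the scaled matrix is a conjugate of \<open>A\<close>. The
  determinant is polynomial in \<open>s\<close>, so the equality extends to \<open>s = 0\<close>,
  where no conjugation is available.\<close>

lemma det_scale_lower:
  assumes A: "A \<in> carrier_mat n n" and low: "\<And>i j. i < n \<Longrightarrow> j < n \<Longrightarrow> r i < r j \<Longrightarrow> A $$ (i, j) = 0"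
  shows "det (scale n r s A) = det A"
proof (rule ccontr)
  define f where "f s = det (scale n r s A) - det A" for s
  have nz: "f s = 0" if "s \<noteq> 0" for s
  proof -
    define S where "S t = diag n (\<lambda>i. t ^ r i)" for t
    have Sc: "S t \<in> carrier_mat n n" for t by (simp add: S_def)
    have MS: "(M * S t) $$ (i, j) = M $$ (i, j) * t ^ r j" "(S t * M) $$ (i, j) = t ^ r i * M $$ (i, j)"
      if "M \<in> carrier_mat n n" "i < n" "j < n" for M i j t
      using that by (simp_all add: S_def mult_diag_entry del: index_mult_mat(1))
    have "S s * S (inverse s) = 1\<^sub>m n"
    proof (rule eq_square_matI[of _ n])
      fix i j assume ij: "i < n" "j < n"
      show "(S s * S (inverse s)) $$ (i, j) = 1\<^sub>m n $$ (i, j)"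
        unfolding MS(1)[OF Sc ij] using ij that by (simp add: S_def diag_entry power_inverse)
    qed (simp_all add: Sc)
    then have "det (S s) \<noteq> 0"
      using det_mult[OF Sc Sc, of s "inverse s"] by auto
    moreover have "scale n r s A * S s = S s * A"
    proof (rule eq_square_matI[of _ n])
      fix i j assume ij: "i < n" "j < n"
      show "(scale n r s A * S s) $$ (i, j) = (S s * A) $$ (i, j)"
      proof (cases "r i < r j")
        case True
        then show ?thesis using ij A by (simp add: MS scale_entry low del: index_mult_mat(1))
      next
        case False
        then have "s ^ r i = s ^ (r i - r j + (r j - r i)) * s ^ r j"
          by (simp flip: power_add)
        then show ?thesis using ij A by (simp add: MS scale_entry del: index_mult_mat(1))
      qed
    qed (use A Sc in simp_all)
    then have "det (scale n r s A) * det (S s) = det (S s) * det A"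
      using det_mult[of "scale n r s A" n "S s"] det_mult[of "S s" n A] A Sc by (metis scale_carrier)
    ultimately show ?thesis by (simp add: f_def)
  qed
  have "polyfun f"
  proof -
    have "polyfun (\<lambda>s. det (scale n r s A))"
    proof (rule polyfun_det)
      show "polyfun (\<lambda>s. scale n r s A $$ (i, j))" if "i < n" "j < n" for i j
        using that unfolding polyfun_def
        by (intro exI[of _ "monom (A $$ (i, j)) ((r i - r j) + (r j - r i))"]) (simp add: scale_entry poly_monom)
    qed simp
    from polyfun_add[OF this polyfun_const[of "- det A"]] show ?thesis
      by (simp add: f_def[abs_def])
  qed
  assume "det (scale n r s A) \<noteq> det A"
  then have "f s \<noteq> 0" by (simp add: f_def)
  then have "finite {z. f z = 0}" using \<open>polyfun f\<close> by (rule finite_zeros_polyfun[rotated])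
  then have "finite (UNIV - {0 :: complex})"
    by (rule finite_subset[rotated]) (use nz in auto)
  then show False by (simp add: infinite_UNIV_char_0)
qed

lemma det_scale_upper:
  assumes A: "A \<in> carrier_mat n n" and up: "\<And>i j. i < n \<Longrightarrow> j < n \<Longrightarrow> r j < r i \<Longrightarrow> A $$ (i, j) = 0"
  shows "det (scale n r s A) = det A"
proof -
  have "det (scale n r s (transpose_mat A)) = det (transpose_mat A)"
    using A up by (intro det_scale_lower) auto
  moreover have "scale n r s (transpose_mat A) = transpose_mat (scale n r s A)"
    by (rule eq_matI) (use A in \<open>auto simp: scale_def add.commute\<close>)
  ultimately show ?thesis
    using A by (simp add: det_transpose[of _ n])
qed

text \<open>
  With \<open>N\<close> the lower factor, \<open>A = N\<inverse> (N A)\<close> is a product of a lower and an upper unipotent block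
  triangular matrix; conjugation by the powers \<open>s ^ r i\<close> shrinks both factors to block diagonal ones.
\<close>
definition shrink :: "nat \<Rightarrow> (nat \<Rightarrow> nat) \<Rightarrow> complex \<Rightarrow> complex mat \<Rightarrow> complex mat" where
  "shrink n r s A = mat_inv (scale n r s (lower_factor n r A)) * scale n r s (lower_factor n r A * A)"

context
  fixes n :: nat and r :: "nat \<Rightarrow> nat" and A :: "complex mat"
  assumes r: "\<And>i. i < n \<Longrightarrow> r i \<le> n" and A: "minors_nonzero n r A"
begin

lemma minors_nonzero_carrier: "A \<in> carrier_mat n n"
  using A by (simp add: minors_nonzero_def)

lemma scale_zero_upper: "scale n r 0 (lower_factor n r A * A) = 1\<^sub>m n"
  by (rule eq_matI)
    (auto simp: scale_def power_0_left lower_factor_mult_self[OF A r])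

text \<open>The determinant is independent of \<open>s\<close>, and at \<open>s = 0\<close> the
  matrix is the identity.\<close>

lemma det_scale_upper_factor: "det (scale n r s (lower_factor n r A * A)) = 1"
proof -
  have "det (scale n r s (lower_factor n r A * A)) = det (lower_factor n r A * A)" for s
    by (rule det_scale_upper) (auto simp: lower_factor_mult_self[OF A r] minors_nonzero_carrier)
  from this[of s] this[of 0] show ?thesis
    by (simp add: scale_zero_upper)
qed

lemma det_scale_lower_factor: "det (scale n r s (lower_factor n r A)) \<noteq> 0"
proof -
  have "det (scale n r s (lower_factor n r A)) = det (lower_factor n r A)"
    by (rule det_scale_lower) (auto simp: lower_factor_entry)
  moreover have "det (lower_factor n r A) * det A = 1"
    using det_scale_upper_factor[of 1] minors_nonzero_carrier
    by (simp add: scale_one det_mult[of _ n])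
  ultimately show ?thesis by auto
qed

lemma shrink_carrier: "shrink n r s A \<in> carrier_mat n n"
  by (simp add: shrink_def)

lemma det_shrink: "det (shrink n r s A) \<noteq> 0"
  unfolding shrink_def
  by (intro det_mult_nonzero[of _ n] det_mat_inv_nonzero[of _ n])
    (simp_all add: det_scale_lower_factor det_scale_upper_factor)

lemma shrink_one: "shrink n r 1 A = A"
  using mat_inv(2)[of "lower_factor n r A" n] det_scale_lower_factor[of 1] minors_nonzero_carrier
  by (simp add: shrink_def scale_one square_mult_assoc[of _ n, symmetric])

lemma block_mat_shrink_zero: "block_mat n r (shrink n r 0 A)"
  unfolding shrink_def scale_zero_upper
  by (intro block_mat_mult block_mat_inv block_mat_scale_zero block_mat_one det_scale_lower_factor)

lemma block_mat_shrink: "block_mat n t A \<Longrightarrow> block_mat n t (shrink n r s A)"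
  unfolding shrink_def using A r
  by (intro block_mat_mult block_mat_inv block_mat_scale det_scale_lower_factor block_mat_lower_factor)

text \<open>Replacing \<open>A\<close> by \<open>l * A\<close> multiplies the lower factor on the
  right by the inverse of \<open>l\<close> and leaves the upper factor unchanged. Scaling commutes
  with the block factor, so \<open>l\<close> reappears on the left of the result.\<close>

lemma shrink_block_mult:
  assumes l: "block_mat n r l" "det l \<noteq> 0"
  shows "shrink n r s (l * A) = l * shrink n r s A"
proof -
  have lc: "l \<in> carrier_mat n n" using l by (simp add: block_mat_carrier)
  let ?N = "lower_factor n r (l * A)"
  have N: "?N * l = lower_factor n r A"
    by (rule lower_factor_block_mult[OF A l r])
  have sN: "scale n r s (lower_factor n r A) = scale n r s ?N * l"
    unfolding N[symmetric] by (rule scale_mult_block) (simp_all add: l)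
  have d: "det (scale n r s ?N) \<noteq> 0"
    using det_scale_lower_factor[of s] lc unfolding sN by (auto simp: det_mult[of _ n])
  have "l * mat_inv (scale n r s (lower_factor n r A)) = l * mat_inv l * mat_inv (scale n r s ?N)"
    unfolding sN using d l lc by (simp add: mat_inv_mult[of _ n] square_mult_assoc[of _ n])
  also have "\<dots> = mat_inv (scale n r s ?N)"
    using l lc by (simp add: mat_inv[of _ n] left_mult_one_mat[of _ n n])
  finally have 1: "mat_inv (scale n r s ?N) = l * mat_inv (scale n r s (lower_factor n r A))" ..
  have 2: "?N * (l * A) = lower_factor n r A * A"
    using lc minors_nonzero_carrier by (simp add: N square_mult_assoc[of _ n, symmetric])
  show ?thesis
    unfolding shrink_def 1 2 using lc by (simp add: square_mult_assoc[of _ n])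
qed

end

lemma cont_mat_cut:
  assumes "cont_mat n S f"
  shows "cont_mat n S (\<lambda>x. cut n r k (f x))"
  unfolding cut_def
proof (rule cont_mat_mat)
  fix i j assume "i < n" "j < n"
  then show "continuous_on S (\<lambda>x. if r i \<le> k \<and> r j \<le> k then f x $$ (i, j) else if i = j then 1 else 0)"
    using assms by (cases "r i \<le> k \<and> r j \<le> k"; cases "i = j") (simp_all add: cont_mat_def if_not_P cong: if_cong)
qed

lemma cont_mat_lower_factor:
  assumes f: "cont_mat n S f" "\<And>x. x \<in> S \<Longrightarrow> minors_nonzero n r (f x)" and r: "\<And>i. i < n \<Longrightarrow> r i \<le> n"
  shows "cont_mat n S (\<lambda>x. lower_factor n r (f x))"
  unfolding lower_factor_def
proof (rule cont_mat_mat)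
  fix i j assume ij: "i < n" "j < n"
  have "cont_mat n S (\<lambda>x. mat_inv (cut n r (r i) (f x)))"
    by (rule cont_mat_inv[OF cont_mat_cut[OF f(1)]]) (use f(2) r ij in \<open>auto simp: minors_nonzero_def\<close>)
  then show "continuous_on S (\<lambda>x. if r j \<le> r i then mat_inv (cut n r (r i) (f x)) $$ (i, j) else 0)"
    using ij by (cases "r j \<le> r i") (simp_all add: cont_mat_def)
qed

lemma cont_mat_scale:
  assumes "cont_mat n S f" "continuous_on S s"
  shows "cont_mat n S (\<lambda>x. scale n r (s x) (f x))"
  unfolding scale_def
  by (rule cont_mat_mat, intro continuous_on_mult continuous_on_power)
    (use assms in \<open>auto simp: cont_mat_def\<close>)

lemma cont_mat_shrink:
  assumes f: "cont_mat n S f" "\<And>x. x \<in> S \<Longrightarrow> minors_nonzero n r (f x)" and r: "\<And>i. i < n \<Longrightarrow> r i \<le> n"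
    and s: "continuous_on S s"
  shows "cont_mat n S (\<lambda>x. shrink n r (s x) (f x))"
  unfolding shrink_def
  by (intro cont_mat_mult cont_mat_inv cont_mat_scale cont_mat_lower_factor s r f)
    (simp_all add: det_scale_lower_factor[OF r f(2)])

section \<open>Orbits under block matrices\<close>

text \<open>
  \<open>X\<close> is the quotient of the group of invertible block matrices for \<open>s\<close> by the subgroup of block
  matrices for the finer partition \<open>t\<close>, with local sections.
\<close>
locale block_orbit =
  fixes n :: nat and s t :: "nat \<Rightarrow> nat" and X :: "'a::topological_space set" and q :: "complex mat \<Rightarrow> 'a"
  assumes t_le: "i < n \<Longrightarrow> t i \<le> n"
    and finer: "i < n \<Longrightarrow> j < n \<Longrightarrow> t i = t j \<Longrightarrow> s i = s j"
    and surj: "\<psi> \<in> X \<Longrightarrow> \<exists>A. block_mat n s A \<and> det A \<noteq> 0 \<and> q A = \<psi>"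
    and q_in: "block_mat n s A \<Longrightarrow> det A \<noteq> 0 \<Longrightarrow> q A \<in> X"
    and q_eqD: "\<lbrakk>block_mat n s A; det A \<noteq> 0; block_mat n s B; det B \<noteq> 0; q A = q B\<rbrakk>
        \<Longrightarrow> \<exists>l. block_mat n t l \<and> det l \<noteq> 0 \<and> B = l * A"
    and q_mult: "\<lbrakk>block_mat n t l; det l \<noteq> 0; block_mat n s A; det A \<noteq> 0\<rbrakk> \<Longrightarrow> q (l * A) = q A"
    and q_cont: "continuous_on {a. block_mat n s (mat n n (\<lambda>(i, j). a i j)) \<and> det (mat n n (\<lambda>(i, j). a i j)) \<noteq> 0}
        (\<lambda>a. q (mat n n (\<lambda>(i, j). a i j)))"
    and sections: "block_mat n s C \<Longrightarrow> det C \<noteq> 0 \<Longrightarrow> \<exists>\<sigma>. cont_mat n X \<sigma> \<and> (\<forall>\<psi>\<in>X. block_mat n s (\<sigma> \<psi>)) \<and>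
        det (\<sigma> (q C)) \<noteq> 0 \<and> (\<forall>\<psi>\<in>X. det (\<sigma> \<psi>) \<noteq> 0 \<longrightarrow> q (\<sigma> \<psi>) = \<psi>)"
begin

definition Z where "Z = {A. block_mat n s A \<and> det A \<noteq> 0}"

lemma Z_carrier: "A \<in> Z \<Longrightarrow> A \<in> carrier_mat n n"
  by (auto simp: Z_def block_mat_carrier)

lemma Z_det: "A \<in> Z \<Longrightarrow> det A \<noteq> 0"
  by (simp add: Z_def)

lemma Z_mult: "A \<in> Z \<Longrightarrow> B \<in> Z \<Longrightarrow> A * B \<in> Z"
  unfolding Z_def using block_mat_mult det_mult_nonzero block_mat_carrier by blast

lemma Z_inv: "A \<in> Z \<Longrightarrow> mat_inv A \<in> Z"
  unfolding Z_def using block_mat_inv det_mat_inv_nonzero block_mat_carrier by blast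

lemma one_Z: "1\<^sub>m n \<in> Z"
  by (simp add: Z_def block_mat_one)

lemma finer_Z:
  assumes "block_mat n t l" "det l \<noteq> 0"
  shows "l \<in> Z"
  using assms(2) block_mat_carrier[OF assms(1)] block_mat_entry[OF assms(1)] finer
  unfolding Z_def block_mat_def by blast

text \<open>\<open>q_cont\<close> speaks of matrices as functions of two indices. Extending the
  entries by zero outside the square turns an entrywise continuous family into a continuous map to
  that function space.\<close>

lemma cont_q:
  assumes f: "cont_mat n T f" "\<And>x. x \<in> T \<Longrightarrow> f x \<in> Z"
  shows "continuous_on T (\<lambda>x. q (f x))"
proof -
  define e where "e x i j = (if i < n \<and> j < n then f x $$ (i, j) else 0)" for x i j
  have e: "mat n n (\<lambda>(i, j). e x i j) = f x" if "x \<in> T" for x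
    by (rule eq_matI) (use Z_carrier[OF f(2)[OF that]] in \<open>auto simp: e_def\<close>)
  have "continuous_on T e"
  proof (intro continuous_on_coordinatewise_then_product)
    fix i j show "continuous_on T (\<lambda>x. e x i j)"
      using f(1) by (cases "i < n \<and> j < n") (auto simp: e_def cont_mat_def)
  qed
  then have "continuous_on T (\<lambda>x. q (mat n n (\<lambda>(i, j). e x i j)))"
    by (rule continuous_on_compose2[OF q_cont]) (use e f(2) in \<open>auto simp: Z_def\<close>)
  then show ?thesis
    by (rule continuous_on_eq) (simp add: e)
qed

text \<open>The big cell translated on the right by \<open>g\<close>. Right translation commutes
  with the left action of the block matrices for \<open>t\<close>, so the image under
  \<open>q\<close> is a chart containing \<open>q g\<close>.\<close>

definition good :: "complex mat \<Rightarrow> complex mat \<Rightarrow> bool" where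
  "good g A \<longleftrightarrow> A \<in> Z \<and> minors_nonzero n t (A * mat_inv g)"

definition chart :: "complex mat \<Rightarrow> 'a set" where
  "chart g = q ` {A. good g A}"

lemma good_Z: "good g A \<Longrightarrow> A \<in> Z"
  by (simp add: good_def)

lemma good_mult:
  assumes "g \<in> Z" "good g A" "block_mat n t l" "det l \<noteq> 0"
  shows "good g (l * A)"
proof -
  have "l * A * mat_inv g = l * (A * mat_inv g)"
    using Z_carrier[OF good_Z[OF assms(2)]] Z_carrier[OF assms(1)] block_mat_carrier[OF assms(3)]
    by (intro square_mult_assoc[of _ n]) simp_all
  then show ?thesis
    using assms by (simp add: good_def Z_mult finer_Z minors_nonzero_mult)
qed

text \<open>Representatives of a point differ by a left block factor for \<open>t\<close>, which
  preserves goodness; hence any representative decides membership.\<close>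

lemma good_iff_chart:
  assumes g: "g \<in> Z" and A: "A \<in> Z"
  shows "q A \<in> chart g \<longleftrightarrow> good g A"
proof
  assume "q A \<in> chart g"
  then obtain B where B: "good g B" "q B = q A" unfolding chart_def by (metis imageE mem_Collect_eq)
  then obtain l where "block_mat n t l" "det l \<noteq> 0" "A = l * B"
    using q_eqD[OF _ _ _ _ B(2)] A good_Z[OF B(1)] unfolding Z_def by blast
  then show "good g A" using good_mult[OF g B(1)] by simp
qed (auto simp: chart_def)

lemma good_self: "g \<in> Z \<Longrightarrow> good g g"
  by (simp add: good_def minors_nonzero_def mat_inv[of _ n] Z_carrier Z_det cut_one)

lemma local_section:
  assumes "\<psi>0 \<in> X"
  shows "\<exists>\<sigma>. cont_mat n X \<sigma> \<and> det (\<sigma> \<psi>0) \<noteq> 0 \<and>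
    (\<forall>\<psi>\<in>X. det (\<sigma> \<psi>) \<noteq> 0 \<longrightarrow> \<sigma> \<psi> \<in> Z \<and> q (\<sigma> \<psi>) = \<psi>)"
proof -
  obtain C where C: "block_mat n s C" "det C \<noteq> 0" "q C = \<psi>0" using surj[OF assms] by blast
  from sections[OF C(1,2)] obtain \<sigma> where "cont_mat n X \<sigma>" "\<forall>\<psi>\<in>X. block_mat n s (\<sigma> \<psi>)"
    "det (\<sigma> (q C)) \<noteq> 0" "\<forall>\<psi>\<in>X. det (\<sigma> \<psi>) \<noteq> 0 \<longrightarrow> q (\<sigma> \<psi>) = \<psi>"
    by blast
  then show ?thesis
    by (intro exI[of _ \<sigma>]) (simp add: C(3) Z_def)
qed

text \<open>The topology of \<open>X\<close> is not defined as a quotient topology, so openness is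
  checked on a local section: near the given point, membership means that finitely many continuous
  minors of the section do not vanish.\<close>

lemma openin_chart:
  assumes g: "g \<in> Z"
  shows "openin (top_of_set X) (chart g)"
proof (subst openin_subopen, intro ballI)
  fix \<psi>0 assume "\<psi>0 \<in> chart g"
  moreover have "chart g \<subseteq> X" using q_in by (auto simp: chart_def good_def Z_def)
  ultimately have \<psi>0: "\<psi>0 \<in> X" by blast
  then obtain \<sigma> where \<sigma>: "cont_mat n X \<sigma>" "det (\<sigma> \<psi>0) \<noteq> 0"
    "\<And>\<psi>. \<psi> \<in> X \<Longrightarrow> det (\<sigma> \<psi>) \<noteq> 0 \<Longrightarrow> \<sigma> \<psi> \<in> Z \<and> q (\<sigma> \<psi>) = \<psi>"
    using local_section by metis
  \<comment> \<open>The factor \<open>det (\<sigma> \<psi>)\<close> discards the points where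
    \<open>\<sigma>\<close> fails to be a section; there the minors carry no information about
    \<open>\<psi>\<close>.\<close>
  define F where "F \<psi> = det (\<sigma> \<psi>) * (\<Prod>k\<le>n. det (cut n t k (\<sigma> \<psi> * mat_inv g)))" for \<psi>
  have "continuous_on X F"
    unfolding F_def
    by (intro continuous_on_mult continuous_on_prod cont_mat_det[of n] \<sigma>(1) cont_mat_cut cont_mat_mult cont_mat_const
        mat_inv_carrier Z_carrier g)
  then have op: "openin (top_of_set X) (X \<inter> F -` (- {0}))"
    by (intro continuous_openin_preimage_gen) auto
  have F: "F \<psi> \<noteq> 0 \<longleftrightarrow> \<psi> \<in> chart g \<and> det (\<sigma> \<psi>) \<noteq> 0" if "\<psi> \<in> X" for \<psi>
  proof (cases "det (\<sigma> \<psi>) = 0")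
    case False
    then have *: "\<sigma> \<psi> \<in> Z" "q (\<sigma> \<psi>) = \<psi>" using \<sigma>(3)[OF that] by auto
    have "\<psi> \<in> chart g \<longleftrightarrow> good g (\<sigma> \<psi>)"
      using good_iff_chart[OF g *(1)] *(2) by simp
    then show ?thesis
      using * False g by (auto simp: F_def good_def minors_nonzero_def Z_carrier)
  qed (simp add: F_def)
  show "\<exists>T. openin (top_of_set X) T \<and> \<psi>0 \<in> T \<and> T \<subseteq> chart g"
    using op F \<psi>0 \<open>\<psi>0 \<in> chart g\<close> \<sigma>(2) by (intro exI[of _ "X \<inter> F -` (- {0})"]) auto
qed

lemma chart_subset: "g \<in> Z \<Longrightarrow> chart g \<subseteq> X"
  using openin_chart openin_imp_subset by blast

definition minor :: "complex mat \<times> nat \<Rightarrow> complex mat \<Rightarrow> complex" where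
  "minor = (\<lambda>(g, k) A. det (cut n t k (A * mat_inv g)))"

lemma line_polynomial_minor:
  assumes g: "g \<in> Z"
  shows "line_polynomial n (minor (g, k))"
  unfolding line_polynomial_def minor_def prod.case
proof (intro ballI polyfun_det cut_carrier)
  fix A B :: "complex mat" and i j
  assume AB: "A \<in> carrier_mat n n" "B \<in> carrier_mat n n" and ij: "i < n" "j < n"
  let ?G = "mat_inv g"
  have G: "?G \<in> carrier_mat n n" using g by (simp add: Z_carrier)
  have "polyfun (\<lambda>z. (A + z \<cdot>\<^sub>m (B - A)) $$ (i, p))" if "p < n" for p
    using polyfun_affine[of "A $$ (i, p)" "B $$ (i, p) - A $$ (i, p)"] AB ij that by simp
  then have "polyfun (\<lambda>z. \<Sum>p<n. (A + z \<cdot>\<^sub>m (B - A)) $$ (i, p) * ?G $$ (p, j))"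
    by (intro polyfun_sum polyfun_mult polyfun_const) auto
  moreover have "((A + z \<cdot>\<^sub>m (B - A)) * ?G) $$ (i, j) = (\<Sum>p<n. (A + z \<cdot>\<^sub>m (B - A)) $$ (i, p) * ?G $$ (p, j))" for z
    using AB by (intro mult_mat_entry G ij) auto
  ultimately have "polyfun (\<lambda>z. ((A + z \<cdot>\<^sub>m (B - A)) * ?G) $$ (i, j))" by simp
  then show "polyfun (\<lambda>z. cut n t k ((A + z \<cdot>\<^sub>m (B - A)) * ?G) $$ (i, j))"
    unfolding cut_entry[OF ij] by (cases "t i \<le> k \<and> t j \<le> k"; cases "i = j") (simp_all add: polyfun_const if_not_P)
qed simp_all

text \<open>The last minor is \<open>det A\<close> up to a nonzero factor, so invertibility of
  \<open>A\<close> is part of the minor conditions and only the linear condition of being a block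
  matrix remains.\<close>

lemma good_iff_minor:
  assumes "g \<in> Z" "block_mat n s A"
  shows "good g A \<longleftrightarrow> (\<forall>k\<le>n. minor (g, k) A \<noteq> 0)"
proof -
  have c: "A \<in> carrier_mat n n" "mat_inv g \<in> carrier_mat n n" using assms by (simp_all add: Z_carrier block_mat_carrier)
  have "det A \<noteq> 0" if "minor (g, n) A \<noteq> 0"
    using that c t_le cut_top[of "A * mat_inv g" n t] by (auto simp: minor_def det_mult[of _ n])
  with c assms show ?thesis
    by (auto simp: good_def minors_nonzero_def minor_def Z_def)
qed

lemma block_line:
  assumes "block_mat n s A" "block_mat n s B"
  shows "block_mat n s (A + z \<cdot>\<^sub>m (B - A))"
  using assms by (auto simp: block_mat_def)

lemma common_point:
  assumes "finite G" "G \<subseteq> Z"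
  shows "\<exists>A\<in>Z. \<forall>g\<in>G. good g A"
proof -
  \<comment> \<open>The identity is added to \<open>G\<close> so that the point found is invertible
    also when \<open>G\<close> is empty.\<close>
  have "\<exists>A\<in>{A. block_mat n s A}. \<forall>i\<in>insert (1\<^sub>m n) G \<times> {..n}. minor i A \<noteq> 0"
  proof (rule common_nonzero)
    show "{A. block_mat n s A} \<noteq> {}" using block_mat_one by blast
    fix i assume i: "i \<in> insert (1\<^sub>m n) G \<times> {..n}"
    then obtain g k where gk: "i = (g, k)" "g \<in> Z" "k \<le> n" using assms one_Z by auto
    show "line_polynomial n (minor i)" using gk line_polynomial_minor by simp
    show "\<exists>A\<in>{A. block_mat n s A}. minor i A \<noteq> 0"
      using gk good_self[OF gk(2)] good_iff_minor[OF gk(2), of g] by (auto simp: Z_def)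
  qed (use assms in \<open>auto simp: block_line block_mat_carrier\<close>)
  then obtain A where A: "block_mat n s A" "\<And>g k. g \<in> insert (1\<^sub>m n) G \<Longrightarrow> k \<le> n \<Longrightarrow> minor (g, k) A \<noteq> 0"
    by auto
  then have "good g A" if "g \<in> insert (1\<^sub>m n) G" for g
    using that assms one_Z good_iff_minor[of g A] by auto
  then show ?thesis using good_Z by blast
qed

text \<open>A representative that is good for one chart is good for the other as well, since
  goodness depends only on its image. The zeros of \<open>F\<close> are the parameters at which the
  line through two such representatives leaves one of the charts. The case \<open>g = g'\<close>
  gives path connectedness of a single chart.\<close>

lemma path_connected_charts:
  assumes g: "g \<in> Z" "g' \<in> Z"
  shows "path_connected (chart g \<inter> chart g')"
  unfolding path_connected_component
proof (intro ballI)
  fix x y assume "x \<in> chart g \<inter> chart g'" "y \<in> chart g \<inter> chart g'"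
  then obtain A B where A: "good g A" "good g' A" "q A = x" and B: "good g B" "good g' B" "q B = y"
  proof -
    assume that: "\<And>A B. \<lbrakk>good g A; good g' A; q A = x; good g B; good g' B; q B = y\<rbrakk> \<Longrightarrow> thesis"
    assume xy: "x \<in> chart g \<inter> chart g'" "y \<in> chart g \<inter> chart g'"
    have *: "\<exists>A. good g A \<and> good g' A \<and> q A = z" if "z \<in> chart g \<inter> chart g'" for z
    proof -
      obtain A where "good g A" "q A = z" using \<open>z \<in> chart g \<inter> chart g'\<close> unfolding chart_def by blast
      then show ?thesis using good_iff_chart[OF g(2), of A] good_Z \<open>z \<in> chart g \<inter> chart g'\<close> by auto
    qed
    from *[OF xy(1)] *[OF xy(2)] that show thesis by blast
  qed
  have bAB: "block_mat n s A" "block_mat n s B" using A B by (auto simp: good_def Z_def)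
  have c: "A \<in> carrier_mat n n" "B \<in> carrier_mat n n" using bAB by (auto simp: block_mat_carrier)
  let ?L = "\<lambda>z. A + z \<cdot>\<^sub>m (B - A)"
  define I where "I = {g, g'} \<times> {..n}"
  define F where "F z = (\<Prod>i\<in>I. minor i (?L z))" for z
  have fin: "finite I" by (simp add: I_def)
  have "line_polynomial n (\<lambda>A. \<Prod>i\<in>I. minor i A)"
    using g by (intro line_polynomial_prod) (auto simp: I_def line_polynomial_minor)
  then have F: "polyfun F" using c by (simp add: line_polynomial_def F_def[abs_def])
  have Fg: "F z \<noteq> 0 \<longleftrightarrow> good g (?L z) \<and> good g' (?L z)" for z
    using g block_line[OF bAB] fin by (auto simp: F_def I_def good_iff_minor)
  have F0: "F 0 \<noteq> 0" and F1: "F 1 \<noteq> 0"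
    using Fg[of 0] Fg[of 1] A B line_point[OF c] by auto
  have "finite {z. F z = 0}" by (rule finite_zeros_polyfun[OF F F0])
  then have "path_connected (- {z. F z = 0})"
    by (intro path_connected_complement_countable countable_finite) simp_all
  then have "path_component (- {z. F z = 0}) 0 1"
    using F0 F1 by (auto simp: path_connected_component)
  then obtain \<gamma> where \<gamma>: "path \<gamma>" "path_image \<gamma> \<subseteq> - {z. F z = 0}" "pathstart \<gamma> = 0" "pathfinish \<gamma> = 1"
    by (auto simp: path_component_def)
  have "continuous_on (- {z. F z = 0}) (\<lambda>z. q (?L z))"
  proof (rule cont_q)
    show "cont_mat n (- {z. F z = 0}) ?L"
      using c by (auto simp: cont_mat_def intro!: continuous_intros)
  qed (use Fg in \<open>auto simp: good_Z\<close>)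
  then have cont: "continuous_on (path_image \<gamma>) (\<lambda>z. q (?L z))"
    using \<gamma>(2) by (rule continuous_on_subset)
  show "path_component (chart g \<inter> chart g') x y"
    unfolding path_component_def
  proof (intro exI conjI)
    show "path ((\<lambda>z. q (?L z)) \<circ> \<gamma>)"
      using \<gamma>(1) cont by (rule path_continuous_image)
    show "path_image ((\<lambda>z. q (?L z)) \<circ> \<gamma>) \<subseteq> chart g \<inter> chart g'"
      using \<gamma>(2) Fg by (auto simp: path_image_compose chart_def)
  qed (use \<gamma> A B line_point[OF c] in \<open>simp_all add: pathstart_compose pathfinish_compose\<close>)
qed

section \<open>Contraction of a chart\<close>

text \<open>The representative is picked by \<open>SOME\<close>; equivariance of
  \<open>shrink\<close> makes the result independent of it, as \<open>contract_eq\<close>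
  records.\<close>

definition contract :: "complex mat \<Rightarrow> real \<times> 'a \<Rightarrow> 'a" where
  "contract g = (\<lambda>(u, \<psi>). q (shrink n t (of_real u) ((SOME A. A \<in> Z \<and> q A = \<psi>) * mat_inv g) * g))"

lemma shrink_Z:
  assumes g: "g \<in> Z" and A: "good g A"
  shows "shrink n t u (A * mat_inv g) * g \<in> Z"
proof -
  have m: "minors_nonzero n t (A * mat_inv g)" and "A * mat_inv g \<in> Z"
    using A g by (simp_all add: good_def Z_mult Z_inv)
  then have "shrink n t u (A * mat_inv g) \<in> Z"
    using block_mat_shrink[OF t_le m] det_shrink[OF t_le m] by (simp add: Z_def)
  then show ?thesis using g by (rule Z_mult)
qed

lemma contract_eq:
  assumes g: "g \<in> Z" and A: "good g A"
  shows "contract g (u, q A) = q (shrink n t (of_real u) (A * mat_inv g) * g)"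
proof -
  define B where "B = (SOME B. B \<in> Z \<and> q B = q A)"
  have "B \<in> Z \<and> q B = q A"
    unfolding B_def by (rule someI[of _ A]) (use A in \<open>simp add: good_Z\<close>)
  then obtain l where l: "block_mat n t l" "det l \<noteq> 0" "B = l * A"
    using q_eqD[of A B] good_Z[OF A] by (auto simp: Z_def)
  have m: "minors_nonzero n t (A * mat_inv g)" using A by (simp add: good_def)
  have c: "A \<in> carrier_mat n n" "g \<in> carrier_mat n n" "l \<in> carrier_mat n n"
    "shrink n t (of_real u) (A * mat_inv g) \<in> carrier_mat n n"
    using good_Z[OF A] g l by (simp_all add: Z_carrier block_mat_carrier shrink_carrier[OF _ m] t_le)
  have "shrink n t (of_real u) (B * mat_inv g) * g = l * (shrink n t (of_real u) (A * mat_inv g) * g)"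
    unfolding l(3) using c shrink_block_mult[OF _ m l(1,2)] t_le
    by (simp add: square_mult_assoc[of _ n])
  then show ?thesis
    using q_mult[OF l(1,2)] shrink_Z[OF g A, of "of_real u", unfolded Z_def]
    by (simp add: contract_def B_def[symmetric])
qed

text \<open>The chosen representatives need not vary continuously. Near each point they are replaced
  by a continuous local section, which yields the same map there; continuity is a local
  property.\<close>

lemma continuous_contract:
  assumes g: "g \<in> Z"
  shows "continuous_on ({0..1} \<times> chart g) (contract g)"
  unfolding continuous_on_def
proof (intro ballI)
  fix z :: "real \<times> 'a" assume z: "z \<in> {0..1} \<times> chart g"
  let ?S = "{0..1 :: real} \<times> chart g"
  have "snd z \<in> X" using z chart_subset[OF g] by auto
  then obtain \<sigma> where \<sigma>: "cont_mat n X \<sigma>" "det (\<sigma> (snd z)) \<noteq> 0"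
    "\<And>\<psi>. \<psi> \<in> X \<Longrightarrow> det (\<sigma> \<psi>) \<noteq> 0 \<Longrightarrow> \<sigma> \<psi> \<in> Z \<and> q (\<sigma> \<psi>) = \<psi>"
    using local_section by metis
  have "openin (top_of_set X) (X \<inter> (\<lambda>\<psi>. det (\<sigma> \<psi>)) -` (- {0}))"
    by (intro continuous_openin_preimage_gen cont_mat_det[OF \<sigma>(1)]) auto
  then obtain T where T: "open T" "X \<inter> (\<lambda>\<psi>. det (\<sigma> \<psi>)) -` (- {0}) = X \<inter> T"
    by (auto simp: openin_open)
  let ?S' = "{0..1 :: real} \<times> (chart g \<inter> T)"
  have \<sigma>g: "\<sigma> \<psi> \<in> Z \<and> q (\<sigma> \<psi>) = \<psi> \<and> good g (\<sigma> \<psi>)" if "\<psi> \<in> chart g" "\<psi> \<in> T" for \<psi>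
  proof -
    have "\<psi> \<in> X" using that chart_subset[OF g] by auto
    then have "det (\<sigma> \<psi>) \<noteq> 0" using T(2) that by auto
    with \<sigma>(3)[OF \<open>\<psi> \<in> X\<close>] good_iff_chart[OF g, of "\<sigma> \<psi>"] that(1) show ?thesis by auto
  qed
  have cz: "cont_mat n ?S' (\<lambda>z. \<sigma> (snd z))"
    by (rule cont_mat_compose[OF \<sigma>(1)]) (use chart_subset[OF g] in \<open>auto intro: continuous_intros\<close>)
  have "continuous_on ?S' (\<lambda>z. q (shrink n t (of_real (fst z)) (\<sigma> (snd z) * mat_inv g) * g))"
  proof (rule cont_q)
    show "cont_mat n ?S' (\<lambda>z. shrink n t (of_real (fst z)) (\<sigma> (snd z) * mat_inv g) * g)"
      by (intro cont_mat_mult cont_mat_shrink cz cont_mat_const t_le continuous_intros)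
        (use \<sigma>g g in \<open>auto simp: good_def Z_carrier\<close>)
    show "shrink n t (of_real (fst z)) (\<sigma> (snd z) * mat_inv g) * g \<in> Z" if "z \<in> ?S'" for z
      by (rule shrink_Z[OF g]) (use that \<sigma>g in auto)
  qed
  then have "continuous_on ?S' (contract g)"
  proof (rule continuous_on_eq)
    fix z assume "z \<in> ?S'"
    then obtain u :: real and \<psi> where z: "z = (u, \<psi>)" "\<psi> \<in> chart g" "\<psi> \<in> T" by auto
    with \<sigma>g[of \<psi>] contract_eq[OF g, of "\<sigma> \<psi>" u]
    show "q (shrink n t (of_real (fst z)) (\<sigma> (snd z) * mat_inv g) * g) = contract g z" by simp
  qed
  moreover have zT: "z \<in> ?S'"
  proof -
    have "snd z \<in> X \<inter> T" using T(2) \<sigma>(2) \<open>snd z \<in> X\<close> by blast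
    with z show ?thesis by auto
  qed
  ultimately have "(contract g \<longlongrightarrow> contract g z) (at z within ?S')"
    unfolding continuous_on_def by blast
  moreover have "at z within ?S' = at z within ?S"
    by (rule at_within_nhd[of z "UNIV \<times> T"]) (use zT T(1) in \<open>auto intro: open_Times\<close>)
  ultimately show "(contract g \<longlongrightarrow> contract g z) (at z within ?S)" by simp
qed

theorem simply_connected_orbit: "simply_connected X"
proof (rule simply_connected_by_open_cover[of X "chart ` Z"])
  show "X \<subseteq> \<Union>(chart ` Z)"
  proof
    fix \<psi> assume "\<psi> \<in> X"
    then obtain A where "A \<in> Z" "q A = \<psi>" using surj by (auto simp: Z_def)
    then show "\<psi> \<in> \<Union>(chart ` Z)" using good_self[of A] by (auto simp: chart_def)
  qed
next
  fix \<V> assume "finite \<V>" "\<V> \<noteq> {}" "\<V> \<subseteq> chart ` Z"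
  then obtain G where G: "finite G" "G \<subseteq> Z" "\<V> = chart ` G"
    using finite_subset_image[of \<V> chart Z] by metis
  then obtain A where "A \<in> Z" "\<forall>g\<in>G. good g A" using common_point by blast
  then have "q A \<in> \<Inter>\<V>" using G by (auto simp: chart_def)
  then show "\<Inter>\<V> \<noteq> {}" by blast
next
  fix U p p' assume U: "U \<in> chart ` Z" and p: "path p" "path p'" "path_image p \<subseteq> U" "path_image p' \<subseteq> U"
    "pathstart p = pathstart p'" "pathfinish p = pathfinish p'"
  then obtain g where g: "g \<in> Z" "U = chart g" by auto
  show "homotopic_paths X p p'"
  proof (rule homotopic_paths_deformation[of U "contract g" X "q g"])
    show "continuous_on ({0..1} \<times> U) (contract g)" using continuous_contract g by simp
    have q: "\<exists>A. good g A \<and> q A = \<psi>" if "\<psi> \<in> U" for \<psi> using that g by (auto simp: chart_def)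
    show "contract g ` ({0..1} \<times> U) \<subseteq> X"
      using q contract_eq[OF g(1)] shrink_Z[OF g(1)] q_in by (fastforce simp: Z_def)
    have m: "minors_nonzero n t (A * mat_inv g)" if "good g A" for A using that by (simp add: good_def)
    show "contract g (1, \<psi>) = \<psi>" if \<psi>: "\<psi> \<in> U" for \<psi>
    proof -
      obtain A where A: "good g A" "q A = \<psi>" using q[OF \<psi>] by blast
      have "A * mat_inv g * g = A"
        using g(1) good_Z[OF A(1)] by (simp add: square_mult_assoc[of _ n] Z_carrier mat_inv[of _ n] Z_det right_mult_one_mat[of _ n n])
      then show ?thesis
        using contract_eq[OF g(1) A(1), of 1] shrink_one[OF _ m[OF A(1)]] A(2) t_le by simp
    qed
    \<comment> \<open>At time 0 the shrunken matrix is a block matrix for \<open>t\<close> and is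
      absorbed by \<open>q\<close>, so every point ends at the centre of the chart.\<close>
    show "contract g (0, \<psi>) = q g" if \<psi>: "\<psi> \<in> U" for \<psi>
    proof -
      obtain A where A: "good g A" "q A = \<psi>" using q[OF \<psi>] by blast
      have "q (shrink n t 0 (A * mat_inv g) * g) = q g"
        using g(1) m[OF A(1)] t_le by (intro q_mult block_mat_shrink_zero det_shrink) (auto simp: Z_def)
      then show ?thesis
        using contract_eq[OF g(1) A(1), of 0] A(2) by simp
    qed
  qed (use p in auto)
qed (auto simp: openin_chart path_connected_charts)

end

section \<open>Bounded commuting operators are simultaneously diagonalizable\<close>

definition basis_vec :: "nat \<Rightarrow> nat \<Rightarrow> complex" where
  "basis_vec j i = (if i = j then 1 else 0)"

definition fscale :: "complex \<Rightarrow> (nat \<Rightarrow> complex) \<Rightarrow> nat \<Rightarrow> complex" where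
  "fscale c v = (\<lambda>i. c * v i)"

interpretation cfun: vector_space fscale
  by unfold_locales (auto simp: fscale_def fun_eq_iff algebra_simps)

text \<open>Bounded coefficients along orbits stand in for compactness, so that diagonalization
  becomes a statement about a commutative group of operators.\<close>

locale bounded_action =
  fixes n :: nat and T :: "'g::ab_group_add \<Rightarrow> (nat \<Rightarrow> complex) \<Rightarrow> nat \<Rightarrow> complex" and V
  assumes V_def: "V = {v. \<forall>i\<ge>n. v i = 0}"
    and T_V: "v \<in> V \<Longrightarrow> T g v \<in> V"
    and T_add: "u \<in> V \<Longrightarrow> v \<in> V \<Longrightarrow> T g (u + v) = T g u + T g v"
    and T_scale: "v \<in> V \<Longrightarrow> T g (fscale c v) = fscale c (T g v)"
    and T_0: "v \<in> V \<Longrightarrow> T 0 v = v"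
    and T_plus: "v \<in> V \<Longrightarrow> T (g + h) v = T g (T h v)"
    and T_bounded: "v \<in> V \<Longrightarrow> \<exists>B. \<forall>g. cmod (T g v i) \<le> B"
begin

lemma V_subspace: "cfun.subspace V"
  by (auto simp: cfun.subspace_def V_def fscale_def)

lemma V_add: "u \<in> V \<Longrightarrow> v \<in> V \<Longrightarrow> u + v \<in> V"
  and V_diff: "u \<in> V \<Longrightarrow> v \<in> V \<Longrightarrow> u - v \<in> V"
  and V_scale: "v \<in> V \<Longrightarrow> fscale c v \<in> V"
  and V_0: "0 \<in> V"
  using V_subspace by (auto simp: cfun.subspace_add cfun.subspace_diff cfun.subspace_scale cfun.subspace_0)

lemma T_zero: "T g 0 = 0"
  using T_scale[OF V_0, of g 0] by simp

lemma T_diff: "u \<in> V \<Longrightarrow> v \<in> V \<Longrightarrow> T g (u - v) = T g u - T g v"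
  using T_add[of u "fscale (-1) v" g] T_scale[of v g "-1"] V_scale[of v "-1"] by simp

lemma T_commute: "v \<in> V \<Longrightarrow> T g (T h v) = T h (T g v)"
  using T_plus[of v g h] T_plus[of v h g] by (simp add: add.commute)

text \<open>On a Jordan block of size two the powers of \<open>T g\<close> would grow linearly.\<close>
lemma semisimple:
  assumes v: "v \<in> V" and w: "w = T g v - fscale \<kappa> v" and Tw: "T g w = fscale \<kappa> w"
  shows "w = 0"
proof (rule ccontr)
  assume "w \<noteq> 0"
  then obtain i where i: "w i \<noteq> 0" by (auto simp: fun_eq_iff)
  have wV: "w \<in> V" using v by (simp add: w V_diff V_scale T_V)
  have Tv: "T g v = fscale \<kappa> v + w" by (simp add: w)
  have inv: "T (- g) (T g u) = u" if "u \<in> V" for u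
    using T_plus[OF that, of "- g" g] T_0[OF that] by simp
  have \<kappa>: "\<kappa> \<noteq> 0"
    using inv[OF wV] i Tw T_zero by (auto simp: fscale_def zero_fun_def)
  have inv_w: "T (- g) w = fscale (inverse \<kappa>) w"
  proof -
    have "T (- g) (fscale \<kappa> w) = w" using inv[OF wV] Tw by simp
    then have "fscale \<kappa> (T (- g) w) = w" using T_scale[OF wV] by simp
    then have "fscale (inverse \<kappa>) (fscale \<kappa> (T (- g) w)) = fscale (inverse \<kappa>) w" by simp
    then show ?thesis using \<kappa> by simp
  qed
  \<comment> \<open>Here \<open>h\<close> is the \<open>k\<close>-fold multiple of \<open>g\<close>;
    the coefficient \<open>k / \<kappa>\<close> comes from expanding the power of a Jordan
    block.\<close>
  have 1: "\<exists>h. T h w = fscale (\<kappa> ^ k) w \<and> T h v = fscale (\<kappa> ^ k) (v + fscale (of_nat k / \<kappa>) w)" for k :: nat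
  proof (induction k)
    case 0
    show ?case using T_0 v wV by (intro exI[of _ 0]) simp
  next
    case (Suc k)
    then obtain h where h: "T h w = fscale (\<kappa> ^ k) w" "T h v = fscale (\<kappa> ^ k) (v + fscale (of_nat k / \<kappa>) w)" by blast
    have "T (g + h) w = fscale (\<kappa> ^ Suc k) w"
      using wV by (simp add: T_plus h T_scale Tw mult.commute)
    moreover have "T (g + h) v = fscale (\<kappa> ^ Suc k) (v + fscale (of_nat (Suc k) / \<kappa>) w)"
      using v wV \<kappa> by (simp add: T_plus h T_scale T_add V_add V_scale Tw Tv)
        (simp add: fscale_def fun_eq_iff field_simps)
    ultimately show ?case by blast
  qed
  have 2: "\<exists>h. T h w = fscale (inverse \<kappa> ^ k) w" for k :: nat
  proof (induction k)
    case 0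
    show ?case using T_0 wV by (intro exI[of _ 0]) simp
  next
    case (Suc k)
    then obtain h where h: "T h w = fscale (inverse \<kappa> ^ k) w" by blast
    have "T (- g + h) w = fscale (inverse \<kappa> ^ Suc k) w"
      using wV unfolding T_plus[OF wV] by (simp add: h T_scale inv_w mult.commute)
    then show ?case by blast
  qed
  obtain B where B: "\<And>h. cmod (T h v i) \<le> B" using T_bounded[OF v] by blast
  obtain C where C: "\<And>h. cmod (T h w i) \<le> C" using T_bounded[OF wV] by blast
  \<comment> \<open>The modulus of \<open>\<kappa>\<close> is unknown. Pairing the
    \<open>k\<close>-th power on \<open>v\<close> with the inverse power on \<open>w\<close> cancels
    it and leaves a quantity growing linearly in \<open>k\<close>.\<close>
  have bound: "cmod (v i + of_nat k / \<kappa> * w i) * cmod (w i) \<le> B * C" for k :: nat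
  proof -
    obtain h where "T h v = fscale (\<kappa> ^ k) (v + fscale (of_nat k / \<kappa>) w)" using 1 by blast
    then have b: "cmod (\<kappa> ^ k) * cmod (v i + of_nat k / \<kappa> * w i) \<le> B"
      using B[of h] by (simp add: fscale_def norm_mult)
    obtain h where "T h w = fscale (inverse \<kappa> ^ k) w" using 2 by blast
    then have c: "cmod (inverse \<kappa> ^ k) * cmod (w i) \<le> C"
      using C[of h] by (simp add: fscale_def norm_mult)
    have "cmod (v i + of_nat k / \<kappa> * w i) * cmod (w i) =
        (cmod (\<kappa> ^ k) * cmod (v i + of_nat k / \<kappa> * w i)) * (cmod (inverse \<kappa> ^ k) * cmod (w i))"
    proof -
      have "cmod (\<kappa> ^ k) * cmod (inverse \<kappa> ^ k) = 1"
        using \<kappa> by (simp flip: norm_mult power_mult_distrib)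
      then have "\<And>x y. x * y = (cmod (\<kappa> ^ k) * x) * (cmod (inverse \<kappa> ^ k) * y)"
        by (metis mult.left_commute mult.assoc mult.right_neutral)
      then show ?thesis .
    qed
    also have "\<dots> \<le> B * C"
      using b c by (intro mult_mono) (auto intro: order_trans[OF _ b])
    finally show ?thesis .
  qed
  define D where "D = B * C / cmod (w i) + cmod (v i)"
  have "real k * (cmod (w i) / cmod \<kappa>) \<le> D" for k :: nat
  proof -
    have "cmod (of_nat k / \<kappa> * w i) \<le> cmod (v i + of_nat k / \<kappa> * w i) + cmod (v i)"
      using norm_triangle_ineq4[of "v i + of_nat k / \<kappa> * w i" "v i"] by simp
    also have "cmod (v i + of_nat k / \<kappa> * w i) \<le> B * C / cmod (w i)"
      using bound[of k] i by (simp add: pos_le_divide_eq)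
    finally show ?thesis by (simp add: D_def norm_mult norm_divide)
  qed
  moreover have "cmod (w i) / cmod \<kappa> > 0" using i \<kappa> by simp
  ultimately show False
    using reals_Archimedean3[of "cmod (w i) / cmod \<kappa>"] by (meson not_le)
qed

section \<open>Polynomials in one operator\<close>

text \<open>The polynomial \<open>p\<close> evaluated at the operator \<open>T g\<close> and applied
  to \<open>v\<close>, by Horner's scheme.\<close>

definition poly_op :: "'g \<Rightarrow> complex poly \<Rightarrow> (nat \<Rightarrow> complex) \<Rightarrow> nat \<Rightarrow> complex" where
  "poly_op g p v = fold_coeffs (\<lambda>a w. fscale a v + T g w) p 0"

lemma poly_op_0 [simp]: "poly_op g 0 v = 0"
  by (simp add: poly_op_def)

lemma poly_op_pCons: "poly_op g (pCons a p) v = fscale a v + T g (poly_op g p v)"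
proof (cases "a = 0 \<and> p = 0")
  case False
  then show ?thesis by (auto simp: poly_op_def fold_coeffs_pCons_coeff_not_0_eq fold_coeffs_pCons_not_0_0_eq)
qed (simp add: T_zero)

lemma poly_op_V: "v \<in> V \<Longrightarrow> poly_op g p v \<in> V"
  by (induction p) (simp_all add: V_0 poly_op_pCons V_add V_scale T_V)

lemma poly_op_add: "v \<in> V \<Longrightarrow> poly_op g (p + q) v = poly_op g p v + poly_op g q v"
proof (induction p q rule: poly_induct2)
  case (pCons a p b q)
  then show ?case
    by (simp only: add_pCons poly_op_pCons T_add poly_op_V cfun.scale_left_distrib add_ac)
qed simp

lemma poly_op_smult: "v \<in> V \<Longrightarrow> poly_op g (Polynomial.smult c p) v = fscale c (poly_op g p v)"
  by (induction p) (simp_all add: poly_op_pCons T_scale poly_op_V cfun.scale_right_distrib)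

lemma poly_op_shift: "v \<in> V \<Longrightarrow> poly_op g p (T g v) = T g (poly_op g p v)"
  by (induction p) (simp_all add: T_zero poly_op_pCons T_add T_scale poly_op_V V_scale T_V)

lemma poly_op_arg: "u \<in> V \<Longrightarrow> v \<in> V \<Longrightarrow> poly_op g p (u - v) = poly_op g p u - poly_op g p v"
  by (induction p) (simp_all add: poly_op_pCons T_diff poly_op_V cfun.scale_right_diff_distrib)

lemma poly_op_arg_scale: "v \<in> V \<Longrightarrow> poly_op g p (fscale c v) = fscale c (poly_op g p v)"
  by (induction p) (simp_all add: poly_op_pCons T_scale poly_op_V cfun.scale_right_distrib mult.commute)

lemma poly_op_linear_factor:
  assumes v: "v \<in> V"
  shows "poly_op g ([:- \<kappa>, 1:] * r) v = poly_op g r (T g v - fscale \<kappa> v)"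
proof -
  have "[:- \<kappa>, 1:] * r = pCons 0 r + Polynomial.smult (- \<kappa>) r" by simp
  then have "poly_op g ([:- \<kappa>, 1:] * r) v = T g (poly_op g r v) - fscale \<kappa> (poly_op g r v)"
    using v by (simp only: poly_op_add poly_op_smult poly_op_pCons) simp
  then show ?thesis
    using v by (simp add: poly_op_arg poly_op_arg_scale poly_op_shift T_V V_scale)
qed

lemma span_V: "A \<subseteq> V \<Longrightarrow> cfun.span A \<subseteq> V"
  using cfun.span_minimal V_subspace by blast

lemma basis_vec_V: "j < n \<Longrightarrow> basis_vec j \<in> V"
  by (auto simp: V_def basis_vec_def)

lemma sum_apply: "sum f A i = (\<Sum>a\<in>A. f a i)" for f :: "'b \<Rightarrow> nat \<Rightarrow> complex"
  by (induction A rule: infinite_finite_induct) auto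

lemma basis_vec_expansion: "v \<in> V \<Longrightarrow> v = (\<Sum>j<n. fscale (v j) (basis_vec j))"
  by (auto simp: fun_eq_iff sum_apply fscale_def basis_vec_def V_def if_distrib cong: if_cong)

lemma V_span: "V = cfun.span (basis_vec ` {..<n})"
proof
  show "V \<subseteq> cfun.span (basis_vec ` {..<n})"
  proof
    fix v assume "v \<in> V"
    moreover have "(\<Sum>j<n. fscale (v j) (basis_vec j)) \<in> cfun.span (basis_vec ` {..<n})"
      by (rule cfun.span_sum, rule cfun.span_scale, rule cfun.span_base) simp
    ultimately show "v \<in> cfun.span (basis_vec ` {..<n})"
      using basis_vec_expansion by metis
  qed
qed (intro span_V, use basis_vec_V in auto)

lemma independent_finite: "cfun.independent S \<Longrightarrow> S \<subseteq> V \<Longrightarrow> finite S"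
  using cfun.independent_span_bound[of "basis_vec ` {..<n}" S] V_span by simp

lemma poly_op_sum: "v \<in> V \<Longrightarrow> poly_op g (\<Sum>k\<in>K. p k) v = (\<Sum>k\<in>K. poly_op g (p k) v)"
  by (induction K rule: infinite_finite_induct) (simp_all add: poly_op_add)

lemma poly_op_monom: "v \<in> V \<Longrightarrow> poly_op g (monom c k) v = fscale c ((T g ^^ k) v)"
proof (induction k arbitrary: c)
  case 0
  then show ?case by (simp add: monom_0 poly_op_pCons T_zero)
next
  case (Suc k)
  have "(T g ^^ k) v \<in> V" using Suc.prems by (induction k) (auto simp: T_V)
  with Suc show ?case by (simp add: monom_Suc poly_op_pCons T_scale)
qed

text \<open>The iterates of \<open>v\<close> lie in a finite-dimensional space, hence are dependent.
  Linear dependence of a set ignores repetitions, so the case of two equal iterates is treated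
  separately.\<close>

lemma annihilating_poly:
  assumes v: "v \<in> V"
  shows "\<exists>p. p \<noteq> 0 \<and> poly_op g p v = 0"
proof (cases "inj (\<lambda>k. (T g ^^ k) v)")
  case True
  have TV: "(T g ^^ k) v \<in> V" for k by (induction k) (use v in \<open>auto simp: T_V\<close>)
  have "infinite (range (\<lambda>k. (T g ^^ k) v))"
    using True by (simp add: range_inj_infinite)
  then have "cfun.dependent (range (\<lambda>k. (T g ^^ k) v))"
    using independent_finite TV by blast
  then obtain t u x where t: "finite t" "t \<subseteq> range (\<lambda>k. (T g ^^ k) v)" "x \<in> t" "u x \<noteq> 0"
    "(\<Sum>v\<in>t. fscale (u v) v) = 0"
    unfolding cfun.dependent_explicit by blast
  then obtain K where K: "finite K" "t = (\<lambda>k. (T g ^^ k) v) ` K"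
    using finite_subset_image[OF t(1,2)] by metis
  define p where "p = (\<Sum>k\<in>K. monom (u ((T g ^^ k) v)) k)"
  have "inj_on (\<lambda>k. (T g ^^ k) v) K" using True by (rule inj_on_subset) simp
  then have "poly_op g p v = 0"
    using t(5) v by (simp add: p_def poly_op_sum poly_op_monom K(2) sum.reindex)
  moreover obtain k where "k \<in> K" "x = (T g ^^ k) v" using K t(3) by auto
  then have "coeff p k \<noteq> 0" using t(4) K(1) by (simp add: p_def coeff_sum)
  ultimately show ?thesis by (intro exI[of _ p]) auto
next
  case False
  then obtain i j where "i \<noteq> j" "(T g ^^ i) v = (T g ^^ j) v" by (auto simp: inj_def)
  then have "poly_op g (monom 1 i + monom (-1) j) v = 0"
    using v by (simp add: poly_op_add poly_op_monom)
  moreover have "coeff (monom 1 i + monom (-1 :: complex) j) i \<noteq> 0" using \<open>i \<noteq> j\<close> by simp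
  then have "monom 1 i + monom (-1 :: complex) j \<noteq> 0" by (metis coeff_0)
  ultimately show ?thesis by blast
qed

text \<open>For a root \<open>\<kappa>\<close> of \<open>p\<close>, the vector
  \<open>u = T g v - \<kappa> v\<close> is killed by a polynomial of smaller degree and lies in the
  span of \<open>E\<close>. Splitting \<open>u\<close> as \<open>(T g - \<kappa>) a + e\<close> with
  a \<open>\<kappa>\<close>-eigenvector \<open>e\<close> gives
  \<open>e = (T g - \<kappa>) (v - a)\<close>. Boundedness excludes such a Jordan block, so
  \<open>e = 0\<close> and \<open>v - a\<close> is an eigenvector. Working in an invariant
  \<open>U\<close> permits iteration over several operators.\<close>

lemma eigenvector_decomposition_aux:
  assumes U: "cfun.subspace U" "U \<subseteq> V" "\<And>u. u \<in> U \<Longrightarrow> T g u \<in> U"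
  defines "E \<equiv> {u \<in> U. \<exists>\<mu>. T g u = fscale \<mu> u}"
  shows "v \<in> U \<Longrightarrow> p \<noteq> 0 \<Longrightarrow> poly_op g p v = 0 \<Longrightarrow> v \<in> cfun.span E"
proof (induction "degree p" arbitrary: p v)
  case 0
  then obtain a where "p = [:a:]" "a \<noteq> 0" by (metis degree_eq_zeroE pCons_0_0)
  have "poly_op g p v = fscale a v"
    by (simp only: \<open>p = [:a:]\<close> poly_op_pCons poly_op_0 T_zero add_0_right)
  then have "fscale a v = 0" using 0 by metis
  then have "v = 0" using \<open>a \<noteq> 0\<close> cfun.scale_eq_0_iff by blast
  then show ?case using cfun.span_zero by metis
next
  case (Suc d)
  then have "\<not> constant (poly p)" by (simp add: constant_degree)
  then obtain \<kappa> where "poly p \<kappa> = 0" using fundamental_theorem_of_algebra by blast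
  then obtain r where r: "p = [:- \<kappa>, 1:] * r" by (auto simp: poly_eq_0_iff_dvd)
  have "r \<noteq> 0" using Suc.prems r by auto
  then have "degree r = d" using Suc.hyps(2) unfolding r by (subst (asm) degree_mult_eq) auto
  have vV: "v \<in> V" using Suc.prems U by auto
  define u where "u = T g v - fscale \<kappa> v"
  have "u \<in> U" using Suc.prems(1) U by (simp add: u_def cfun.subspace_diff cfun.subspace_scale)
  moreover have "poly_op g r u = 0"
    using Suc.prems vV by (simp add: r poly_op_linear_factor u_def del: mult_pCons_left)
  ultimately have uE: "u \<in> cfun.span E" using Suc.hyps(1) \<open>degree r = d\<close> \<open>r \<noteq> 0\<close> by blast
  \<comment> \<open>This property is linear in \<open>u\<close>, so it is checked on eigenvectors:
    for an eigenvalue \<open>\<mu>\<close> other than \<open>\<kappa>\<close> one divides by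
    \<open>\<mu> - \<kappa>\<close>, and a \<open>\<kappa>\<close>-eigenvector is its own
    \<open>e\<close>.\<close>
  define good where "good u \<longleftrightarrow> (\<exists>a e. a \<in> cfun.span E \<and> e \<in> U \<and> T g e = fscale \<kappa> e \<and>
      u = T g a - fscale \<kappa> a + e)" for u
  have goodI: "good u" if "a \<in> cfun.span E" "e \<in> U" "T g e = fscale \<kappa> e" "u = T g a - fscale \<kappa> a + e" for a e u
    unfolding good_def using that by blast
  have EV: "cfun.span E \<subseteq> U"
    using U(1) by (intro cfun.span_minimal) (auto simp: E_def)
  have "good u" using uE
  proof (induction rule: cfun.span_induct)
    case base
    show ?case
      unfolding cfun.subspace_def mem_Collect_eq
    proof (intro conjI ballI allI)
      show "good 0"
        by (rule goodI[of 0 0]) (simp_all add: U(1) T_zero cfun.span_zero cfun.subspace_0)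
    next
      fix x y assume "x \<in> Collect good" "y \<in> Collect good"
      then obtain a e b f where *: "a \<in> cfun.span E" "e \<in> U" "T g e = fscale \<kappa> e" "x = T g a - fscale \<kappa> a + e"
        "b \<in> cfun.span E" "f \<in> U" "T g f = fscale \<kappa> f" "y = T g b - fscale \<kappa> b + f"
        by (auto simp: good_def)
      then have "a \<in> V" "b \<in> V" "e \<in> V" "f \<in> V" using EV U by auto
      then show "good (x + y)" using * U(1)
        by (intro goodI[of "a + b" "e + f"])
          (simp_all add: T_add cfun.span_add cfun.subspace_add cfun.scale_right_distrib)
    next
      fix c x assume "x \<in> Collect good"
      then obtain a e where *: "a \<in> cfun.span E" "e \<in> U" "T g e = fscale \<kappa> e" "x = T g a - fscale \<kappa> a + e"
        by (auto simp: good_def)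
      then have "a \<in> V" "e \<in> V" using EV U by auto
      then show "good (fscale c x)" using * U(1)
        by (intro goodI[of "fscale c a" "fscale c e"])
          (simp_all add: T_scale cfun.span_scale cfun.subspace_scale cfun.scale_right_distrib
            cfun.scale_right_diff_distrib mult.commute)
    qed
  next
    case (step x)
    then obtain \<mu> where x: "x \<in> U" "T g x = fscale \<mu> x" by (auto simp: E_def)
    show ?case
    proof (cases "\<mu> = \<kappa>")
      case True
      then show ?thesis
        using x by (intro goodI[of 0 x]) (simp_all add: T_zero cfun.span_zero)
    next
      case False
      have xV: "x \<in> V" using x U by auto
      show ?thesis
      proof (rule goodI[of "fscale (1 / (\<mu> - \<kappa>)) x" 0])
        show "fscale (1 / (\<mu> - \<kappa>)) x \<in> cfun.span E"
          using step by (intro cfun.span_scale cfun.span_base)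
        show "x = T g (fscale (1 / (\<mu> - \<kappa>)) x) - fscale \<kappa> (fscale (1 / (\<mu> - \<kappa>)) x) + 0"
        proof -
          have "\<mu> / (\<mu> - \<kappa>) - \<kappa> / (\<mu> - \<kappa>) = 1"
            using False by (simp flip: diff_divide_distrib)
          then have "fscale (\<mu> / (\<mu> - \<kappa>)) x - fscale (\<kappa> / (\<mu> - \<kappa>)) x = x"
            by (simp flip: cfun.scale_left_diff_distrib)
          then show ?thesis using xV by (simp add: T_scale x)
        qed
      qed (use U(1) in \<open>simp_all add: T_zero cfun.subspace_0\<close>)
    qed
  qed
  then obtain a e where ae: "a \<in> cfun.span E" "e \<in> U" "T g e = fscale \<kappa> e" "u = T g a - fscale \<kappa> a + e"
    by (auto simp: good_def)
  have aV: "a \<in> U" "a \<in> V" using ae(1) EV U by auto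
  have "e = T g (v - a) - fscale \<kappa> (v - a)"
    using ae(4) vV aV by (simp add: u_def T_diff cfun.scale_right_diff_distrib algebra_simps)
  then have "e = 0"
    using semisimple[of "v - a" e g \<kappa>] vV aV ae(3) by (simp add: V_diff)
  then have "T g (v - a) = fscale \<kappa> (v - a)"
    using \<open>e = T g (v - a) - fscale \<kappa> (v - a)\<close> by simp
  moreover have "v - a \<in> U" using Suc.prems aV U(1) by (simp add: cfun.subspace_diff)
  ultimately have "v - a \<in> cfun.span E" by (intro cfun.span_base) (auto simp: E_def)
  then have "(v - a) + a \<in> cfun.span E" using ae(1) by (rule cfun.span_add)
  then show ?case by simp
qed

section \<open>Joint eigenvectors\<close>

definition joint :: "'g set \<Rightarrow> (nat \<Rightarrow> complex) set" where
  "joint S = {v \<in> V. \<forall>g\<in>S. \<exists>\<mu>. T g v = fscale \<mu> v}"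

text \<open>Fixing the eigenvalues of a joint eigenvector for \<open>S\<close> defines a subspace
  \<open>U\<close> that \<open>T g\<close> preserves by commutativity. Decomposing inside
  \<open>U\<close> keeps the vectors eigenvectors for all of \<open>S\<close>.\<close>

lemma span_joint_finite: "finite S \<Longrightarrow> V \<subseteq> cfun.span (joint S)"
proof (induction S rule: finite_induct)
  case empty
  then show ?case by (auto simp: joint_def intro: cfun.span_base)
next
  case (insert g S)
  have "joint S \<subseteq> cfun.span (joint (insert g S))"
  proof
    fix e assume "e \<in> joint S"
    then obtain \<mu> where e: "e \<in> V" "\<And>h. h \<in> S \<Longrightarrow> T h e = fscale (\<mu> h) e"
      unfolding joint_def mem_Collect_eq by metis
    define U where "U = {u \<in> V. \<forall>h\<in>S. T h u = fscale (\<mu> h) u}"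
    have U: "cfun.subspace U" "U \<subseteq> V"
      using V_subspace by (auto simp: U_def cfun.subspace_def T_zero T_add T_scale cfun.scale_right_distrib mult.commute)
    have "T g u \<in> U" if "u \<in> U" for u
      using that by (auto simp: U_def T_V T_commute[of u _ g] T_scale)
    moreover obtain p where "p \<noteq> 0" "poly_op g p e = 0" using annihilating_poly[OF e(1)] by blast
    moreover have "e \<in> U" using e by (simp add: U_def)
    ultimately have "e \<in> cfun.span {u \<in> U. \<exists>\<nu>. T g u = fscale \<nu> u}"
      using eigenvector_decomposition_aux[OF U, of g e p] by blast
    moreover have "{u \<in> U. \<exists>\<nu>. T g u = fscale \<nu> u} \<subseteq> joint (insert g S)"
      by (auto simp: U_def joint_def)
    ultimately show "e \<in> cfun.span (joint (insert g S))" using cfun.span_mono by blast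
  qed
  then have "cfun.span (joint S) \<subseteq> cfun.span (joint (insert g S))"
    by (intro cfun.span_minimal cfun.subspace_span)
  with insert.IH show ?case by blast
qed

text \<open>The operators \<open>T g\<close> span a finite-dimensional space, so finitely many of them suffice.\<close>
lemma joint_finite: "\<exists>S. finite S \<and> joint S = joint UNIV"
proof -
  \<comment> \<open>The matrix of \<open>T g\<close> as one vector of length \<open>n * n\<close>:
    entry \<open>(i, j)\<close> stands at position \<open>j * n + i\<close>. Flattening makes the
    independence bound for sequences applicable to operators; \<open>ap\<close> applies a flattened
    matrix.\<close>
  define code where "code g m = (if m < n * n then T g (basis_vec (m div n)) (m mod n) else 0)" for g m
  define ap where "ap w v = (\<lambda>i. if i < n then \<Sum>j<n. w (j * n + i) * v j else 0)"
    for w v :: "nat \<Rightarrow> complex"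
  have idx: "j * n + i < n * n" "(j * n + i) div n = j" "(j * n + i) mod n = i" if "i < n" "j < n" for i j
  proof -
    have "j * n + i < Suc j * n" using that by simp
    also have "\<dots> \<le> n * n" using that by (intro mult_le_mono1) simp
    finally show "j * n + i < n * n" .
  qed (use that in auto)
  have T_sum: "T g (\<Sum>j\<in>J. fscale (c j) (basis_vec j)) = (\<Sum>j\<in>J. fscale (c j) (T g (basis_vec j)))"
    if "finite J" "J \<subseteq> {..<n}" for g c J
    using that
  proof (induction J rule: finite_induct)
    case (insert j J)
    then have "(\<Sum>j\<in>J. fscale (c j) (basis_vec j)) \<in> V"
      by (intro cfun.subspace_sum V_subspace V_scale basis_vec_V) auto
    moreover have u: "basis_vec j \<in> V" using insert basis_vec_V by auto
    moreover have "T g (\<Sum>j\<in>J. fscale (c j) (basis_vec j)) = (\<Sum>j\<in>J. fscale (c j) (T g (basis_vec j)))"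
      using insert by simp
    ultimately show ?case
      unfolding sum.insert[OF insert.hyps(1,2)] using T_add[OF V_scale[OF u]] T_scale[OF u] by metis
  qed (simp add: T_zero)
  have ap: "ap (code g) v = T g v" if v: "v \<in> V" for g v
  proof
    fix i
    have "T g v = (\<Sum>j<n. fscale (v j) (T g (basis_vec j)))"
      using T_sum[of "{..<n}" g v] basis_vec_expansion[OF v] by simp
    then have "T g v i = (\<Sum>j<n. v j * T g (basis_vec j) i)"
      by (simp add: sum_apply fscale_def)
    moreover have "T g v i = 0" if "\<not> i < n" using T_V[OF v, of g] that by (simp add: V_def)
    ultimately show "ap (code g) v i = T g v i"
      by (simp add: ap_def code_def idx mult.commute)
  qed
  obtain B where B: "B \<subseteq> range code" "cfun.independent B" "range code \<subseteq> cfun.span B"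
    using cfun.maximal_independent_subset[of "range code"] by blast
  have "range code \<subseteq> cfun.span (basis_vec ` {..<n * n})"
  proof
    fix w assume "w \<in> range code"
    then have "w = (\<Sum>m<n * n. fscale (w m) (basis_vec m))"
      by (auto simp: fun_eq_iff sum_apply fscale_def basis_vec_def code_def if_distrib cong: if_cong)
    then show "w \<in> cfun.span (basis_vec ` {..<n * n})"
      by (rule ssubst) (rule cfun.span_sum, rule cfun.span_scale, rule cfun.span_base, simp)
  qed
  then have "finite B"
    using cfun.independent_span_bound[of "basis_vec ` {..<n * n}" B] B by auto
  then obtain S where S: "finite S" "B = code ` S"
    using finite_subset_image[OF _ B(1)] by metis
  \<comment> \<open>For a fixed \<open>v\<close>, the flattened matrices having \<open>v\<close> as
    eigenvector form a subspace; it contains the codes of \<open>S\<close>, hence their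
    span.\<close>
  have "\<exists>\<mu>. T g v = fscale \<mu> v" if v: "v \<in> joint S" for g v
  proof -
    have vV: "v \<in> V" using v by (simp add: joint_def)
    have "code g \<in> cfun.span B" using B by auto
    then have "\<exists>\<mu>. ap (code g) v = fscale \<mu> v"
    proof (induction rule: cfun.span_induct)
      case base
      show ?case
        unfolding cfun.subspace_def mem_Collect_eq
      proof (intro conjI ballI allI)
        show "\<exists>\<mu>. ap 0 v = fscale \<mu> v"
          by (intro exI[of _ 0]) (simp add: ap_def fun_eq_iff)
      next
        fix x y assume "x \<in> {w. \<exists>\<mu>. ap w v = fscale \<mu> v}" "y \<in> {w. \<exists>\<mu>. ap w v = fscale \<mu> v}"
        then obtain \<mu> \<nu> where "ap x v = fscale \<mu> v" "ap y v = fscale \<nu> v" by blast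
        moreover have "ap (x + y) v = ap x v + ap y v"
          by (auto simp: ap_def fun_eq_iff sum.distrib algebra_simps)
        ultimately show "\<exists>\<mu>. ap (x + y) v = fscale \<mu> v"
          by (intro exI[of _ "\<mu> + \<nu>"]) (simp add: cfun.scale_left_distrib)
      next
        fix c x assume "x \<in> {w. \<exists>\<mu>. ap w v = fscale \<mu> v}"
        then obtain \<mu> where "ap x v = fscale \<mu> v" by blast
        moreover have "ap (fscale c x) v = fscale c (ap x v)"
          by (auto simp: ap_def fun_eq_iff fscale_def sum_distrib_left algebra_simps)
        ultimately show "\<exists>\<mu>. ap (fscale c x) v = fscale \<mu> v"
          by (intro exI[of _ "c * \<mu>"]) simp
      qed
    next
      case (step w)
      then obtain h where h: "h \<in> S" "w = code h" using S by auto
      then show ?case using v ap[OF vV, of h] by (auto simp: joint_def)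
    qed
    then show ?thesis by (simp add: ap[OF vV])
  qed
  then have "joint S = joint UNIV" by (auto simp: joint_def)
  with S(1) show ?thesis by blast
qed

text \<open>A maximal independent set of joint eigenvectors is a basis of \<open>V\<close>.
  \<open>k\<close> takes coordinates in this basis, \<open>m\<close> is its size, and
  \<open>\<theta> g i\<close> is the eigenvalue of \<open>T g\<close> on the \<open>i\<close>-th
  basis vector.\<close>

theorem diagonalization:
  "\<exists>m (k :: (nat \<Rightarrow> complex) \<Rightarrow> nat \<Rightarrow> complex) \<theta>. bij_betw k V {v. \<forall>i\<ge>m. v i = 0} \<and>
     (\<forall>u\<in>V. \<forall>v\<in>V. k (u + v) = k u + k v) \<and> (\<forall>c. \<forall>v\<in>V. k (fscale c v) = fscale c (k v)) \<and>
     (\<forall>g. \<forall>v\<in>V. k (T g v) = (\<lambda>i. \<theta> g i * k v i))"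
proof -
  obtain S where S: "finite S" "joint S = joint UNIV" using joint_finite by blast
  obtain B where B: "B \<subseteq> joint UNIV" "cfun.independent B" "joint UNIV \<subseteq> cfun.span B"
    using cfun.maximal_independent_subset[of "joint UNIV"] by blast
  have BV: "B \<subseteq> V" using B(1) by (auto simp: joint_def)
  then have fin: "finite B" using independent_finite B by blast
  have span: "cfun.span B = V"
  proof
    show "V \<subseteq> cfun.span B"
      using span_joint_finite[OF S(1)] S(2) B(3) cfun.span_minimal[OF B(3) cfun.subspace_span] by simp
  qed (rule span_V[OF BV])
  define m where "m = card B"
  obtain b where b: "bij_betw b {..<m} B"
    using fin m_def bij_betw_from_nat_into_finite by (metis ex_bij_betw_nat_finite atLeast0LessThan)
  then have b_inj: "inj_on b {..<m}" and b_B: "\<And>i. i < m \<Longrightarrow> b i \<in> B" by (auto simp: bij_betw_def)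
  define c where "c w = (\<Sum>i<m. fscale (w i) (b i))" for w :: "nat \<Rightarrow> complex"
  define k where "k v = (\<lambda>i. if i < m then cfun.representation B v (b i) else 0)" for v
  let ?M = "{v :: nat \<Rightarrow> complex. \<forall>i\<ge>m. v i = 0}"
  have cV: "c w \<in> V" for w
    using BV b_B by (auto simp: c_def intro!: cfun.subspace_sum V_subspace V_scale)
  have rep_B: "cfun.representation B (b j) (b i) = (if i = j then 1 else 0)" if "i < m" "j < m" for i j
    using cfun.representation_basis[OF B(2) b_B[OF that(2)]] that b_inj by (auto simp: inj_on_def)
  have kc: "k (c w) = w" if w: "w \<in> ?M" for w
  proof
    fix i
    show "k (c w) i = w i"
    proof (cases "i < m")
      case True
      have "cfun.representation B (c w) (b i) = (\<Sum>j<m. cfun.representation B (fscale (w j) (b j)) (b i))"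
        unfolding c_def by (subst cfun.representation_sum[OF B(2)]) (use b_B in \<open>auto intro: cfun.span_scale cfun.span_base\<close>)
      also have "\<dots> = (\<Sum>j<m. w j * cfun.representation B (b j) (b i))"
        by (intro sum.cong) (use b_B in \<open>auto simp: cfun.representation_scale[OF B(2)] cfun.span_base\<close>)
      also have "\<dots> = w i" using True by (simp add: rep_B if_distrib cong: if_cong)
      finally show ?thesis using True by (simp add: k_def)
    qed (use w in \<open>auto simp: k_def\<close>)
  qed
  have ck: "c (k v) = v" if v: "v \<in> V" for v
  proof -
    have "c (k v) = (\<Sum>i<m. fscale (cfun.representation B v (b i)) (b i))"
      by (simp add: c_def k_def)
    also have "\<dots> = (\<Sum>x\<in>B. fscale (cfun.representation B v x) x)"
      using b by (rule sum.reindex_bij_betw)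
    also have "\<dots> = v"
      using v span by (intro cfun.sum_representation_eq[OF B(2)]) (auto simp: fin)
    finally show ?thesis .
  qed
  have k_add: "k (u + v) = k u + k v" if "u \<in> V" "v \<in> V" for u v
    using that span by (auto simp: k_def fun_eq_iff cfun.representation_add[OF B(2)])
  have k_scale: "k (fscale a v) = fscale a (k v)" if "v \<in> V" for a v
  proof
    fix i show "k (fscale a v) i = fscale a (k v) i"
      unfolding fscale_def[of a "k v"] using that span by (simp add: k_def cfun.representation_scale[OF B(2)])
  qed
  have "\<forall>g. \<forall>i. \<exists>\<mu>. i < m \<longrightarrow> T g (b i) = fscale \<mu> (b i)"
    using B(1) b_B by (auto simp: joint_def)
  then obtain \<theta> where \<theta>: "\<And>g i. i < m \<Longrightarrow> T g (b i) = fscale (\<theta> g i) (b i)" by metis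
  have Tc: "T g (c w) = c (\<lambda>i. \<theta> g i * w i)" for g w
  proof -
    have "T g (\<Sum>i\<in>I. fscale (w i) (b i)) = (\<Sum>i\<in>I. fscale (\<theta> g i * w i) (b i))"
      if "finite I" "I \<subseteq> {..<m}" for I
      using that
    proof (induction I rule: finite_induct)
      case (insert i I)
      then have "(\<Sum>i\<in>I. fscale (w i) (b i)) \<in> V"
        using BV b_B by (intro cfun.subspace_sum V_subspace V_scale) auto
      moreover have bV: "b i \<in> V" using insert BV b_B by auto
      moreover have "T g (\<Sum>i\<in>I. fscale (w i) (b i)) = (\<Sum>i\<in>I. fscale (\<theta> g i * w i) (b i))"
        using insert by simp
      moreover have "T g (fscale (w i) (b i)) = fscale (\<theta> g i * w i) (b i)"
        using insert bV by (simp add: T_scale \<theta> mult.commute)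
      ultimately show ?case
        unfolding sum.insert[OF insert.hyps(1,2)] using T_add[OF V_scale[OF bV]] by metis
    qed (simp add: T_zero)
    then show ?thesis by (simp add: c_def)
  qed
  have kM: "k v \<in> ?M" for v by (auto simp: k_def)
  have "k (T g v) = (\<lambda>i. \<theta> g i * k v i)" if "v \<in> V" for g v
  proof -
    have "T g v = c (\<lambda>i. \<theta> g i * k v i)" using Tc[of g "k v"] ck[OF that] by simp
    then show ?thesis using kc[of "\<lambda>i. \<theta> g i * k v i"] kM[of v] by auto
  qed
  moreover have "bij_betw k V ?M"
    by (rule bij_betwI[where g = c]) (use kM cV kc ck in auto)
  ultimately show ?thesis using k_add k_scale
    by (intro exI[of _ m] exI[of _ k] exI[of _ \<theta>]) blast
qed

end

section \<open>Clutching maps and trivializations\<close>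

text \<open>What inverting a \<open>lin_iso\<close> requires of its domain; the spaces in between
  are handled without establishing module axioms for them.\<close>

definition lin_closed :: "(complex, 'v, 'p) module_scheme \<Rightarrow> bool" where
  "lin_closed V \<longleftrightarrow> (\<forall>u\<in>carrier V. \<forall>v\<in>carrier V. u \<oplus>\<^bsub>V\<^esub> v \<in> carrier V) \<and>
     (\<forall>c. \<forall>u\<in>carrier V. c \<odot>\<^bsub>V\<^esub> u \<in> carrier V)"

lemma lin_closed_module:
  assumes "module complex_field V"
  shows "lin_closed V"
proof -
  interpret module complex_field V by fact
  have "carrier complex_field = UNIV" by (simp add: complex_field_def)
  then show ?thesis by (simp add: lin_closed_def)
qed

lemma lin_isoD:
  assumes "lin_iso V W f"
  shows "inj_on f (carrier V)" "f ` carrier V = carrier W"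
    "\<And>u. u \<in> carrier V \<Longrightarrow> f u \<in> carrier W"
    "\<And>u v. u \<in> carrier V \<Longrightarrow> v \<in> carrier V \<Longrightarrow> f (u \<oplus>\<^bsub>V\<^esub> v) = f u \<oplus>\<^bsub>W\<^esub> f v"
    "\<And>c u. u \<in> carrier V \<Longrightarrow> f (c \<odot>\<^bsub>V\<^esub> u) = c \<odot>\<^bsub>W\<^esub> f u"
  using assms by (auto simp: lin_iso_def bij_betw_def)

lemma lin_iso_inv:
  assumes f: "lin_iso V W f" and V: "lin_closed V"
  shows "lin_iso W V (inv_into (carrier V) f)"
proof -
  note D = lin_isoD[OF f]
  have inv: "inv_into (carrier V) f (f u) = u" if "u \<in> carrier V" for u
    using D(1) that by (rule inv_into_f_f)
  show ?thesis
    unfolding lin_iso_def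
  proof (intro conjI ballI allI)
    show "bij_betw (inv_into (carrier V) f) (carrier W) (carrier V)"
      using f by (simp add: lin_iso_def bij_betw_inv_into)
  next
    fix w w' assume "w \<in> carrier W" "w' \<in> carrier W"
    then obtain u u' where u: "u \<in> carrier V" "w = f u" "u' \<in> carrier V" "w' = f u'"
      using D(2) by blast
    have "inv_into (carrier V) f (f (u \<oplus>\<^bsub>V\<^esub> u')) = u \<oplus>\<^bsub>V\<^esub> u'"
      using u V by (intro inv) (simp add: lin_closed_def)
    then show "inv_into (carrier V) f (w \<oplus>\<^bsub>W\<^esub> w') = inv_into (carrier V) f w \<oplus>\<^bsub>V\<^esub> inv_into (carrier V) f w'"
      using u by (simp add: D(4) inv)
  next
    fix c w assume "w \<in> carrier W"
    then obtain u where u: "u \<in> carrier V" "w = f u" using D(2) by blast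
    have "inv_into (carrier V) f (f (c \<odot>\<^bsub>V\<^esub> u)) = c \<odot>\<^bsub>V\<^esub> u"
      using u V by (intro inv) (simp add: lin_closed_def)
    then show "inv_into (carrier V) f (c \<odot>\<^bsub>W\<^esub> w) = c \<odot>\<^bsub>V\<^esub> inv_into (carrier V) f w"
      using u by (simp add: D(5) inv)
  qed
qed

lemma lin_iso_compose:
  assumes "lin_iso U V f" "lin_iso V W g"
  shows "lin_iso U W (\<lambda>u. g (f u))"
  unfolding lin_iso_def
proof (intro conjI ballI allI)
  show "bij_betw (\<lambda>u. g (f u)) (carrier U) (carrier W)"
    using assms bij_betw_trans[of f "carrier U" "carrier V" g "carrier W"] by (simp add: lin_iso_def comp_def)
qed (simp_all add: lin_isoD(3-5)[OF assms(1)] lin_isoD(4,5)[OF assms(2)])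

lemma lin_iso_cong:
  assumes "lin_iso V W f" "\<And>u. u \<in> carrier V \<Longrightarrow> f u = f' u" "lin_closed V"
  shows "lin_iso V W f'"
  unfolding lin_iso_def
proof (intro conjI ballI allI)
  show "bij_betw f' (carrier V) (carrier W)"
    by (rule iffD1[OF bij_betw_cong[OF assms(2)]]) (use assms(1) in \<open>simp_all add: lin_iso_def\<close>)
qed (use assms(3) lin_isoD(4,5)[OF assms(1)] in \<open>simp_all add: lin_closed_def flip: assms(2)\<close>)

section \<open>Equivariant trivializations and their clutching maps\<close>

text \<open>An equivariant isomorphism from \<open>F\<close> to the product bundle with fiber
  \<open>W\<close>, given by its second component.\<close>

definition trivialization :: "('g, 'x, 'e) gbundle \<Rightarrow> ('g, 'w) rep \<Rightarrow> ('e \<Rightarrow> 'w) \<Rightarrow> bool" where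
  "trivialization F W a \<longleftrightarrow> (\<forall>x. lin_iso (fiber F x) W a) \<and>
     (\<forall>g u. a (total_act F g u) = act W g (a u))"

definition clutch :: "('g, 'x, 'e) gbundle \<Rightarrow> ('e \<Rightarrow> 'w) \<Rightarrow> 'x \<Rightarrow> 'x \<Rightarrow> 'e \<Rightarrow> 'e" where
  "clutch F a = (\<lambda>x x'. \<lambda>u\<in>carrier (fiber F x). inv_into (carrier (fiber F x')) a (a u))"

lemma carrier_fiber [simp]: "carrier (fiber F x) = {u. proj F u = x}"
  by (simp add: fiber_def)

lemma fiber_ops [simp]: "u \<oplus>\<^bsub>fiber F x\<^esub> v = fadd F u v" "c \<odot>\<^bsub>fiber F x\<^esub> u = fsmult F c u"
  by (simp_all add: fiber_def)

locale equivariant_gbundle =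
  fixes F :: "('g::topological_group_add, 'x::topological_space, 'e::topological_space) gbundle"
  assumes F: "equivariant_bundle F"
begin

lemma fiber_closed: "lin_closed (fiber F x)"
  using F lin_closed_module by (auto simp: equivariant_bundle_def vector_bundle_def)

lemma fadd_fiber: "proj F u = x \<Longrightarrow> proj F v = x \<Longrightarrow> proj F (fadd F u v) = x"
  and fsmult_fiber: "proj F u = x \<Longrightarrow> proj F (fsmult F c u) = x"
  using fiber_closed[of x] by (simp_all add: lin_closed_def)

lemma proj_act: "proj F (total_act F g u) = base_act F g (proj F u)"
  using F by (simp add: equivariant_bundle_def)

lemma total_act_0 [simp]: "total_act F 0 u = u"
  and total_act_plus: "total_act F (g + h) u = total_act F g (total_act F h u)"
  and base_act_0 [simp]: "base_act F 0 x = x"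
  and base_act_plus: "base_act F (g + h) x = base_act F g (base_act F h x)"
  using F by (simp_all add: equivariant_bundle_def is_action_def)

lemma total_act_inverse [simp]:
  "total_act F (- g) (total_act F g u) = u" "total_act F g (total_act F (- g) u) = u"
  by (simp_all flip: total_act_plus)

lemma base_act_inverse [simp]:
  "base_act F (- g) (base_act F g x) = x" "base_act F g (base_act F (- g) x) = x"
  by (simp_all flip: base_act_plus)

lemma total_act_linear: "lin_iso (fiber F x) (fiber F (base_act F g x)) (total_act F g)"
  using F by (simp add: equivariant_bundle_def)

context
  fixes W :: "('g, 'w) rep" and a :: "'e \<Rightarrow> 'w"
  assumes a: "trivialization F W a"
begin

lemma triv_lin_iso: "lin_iso (fiber F x) W a"
  using a by (simp add: trivialization_def)

lemma triv_act: "a (total_act F g u) = act W g (a u)"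
  using a by (simp add: trivialization_def)

lemma triv_inj: "proj F u = proj F v \<Longrightarrow> a u = a v \<Longrightarrow> u = v"
  using lin_isoD(1)[OF triv_lin_iso[of "proj F u"]] by (auto simp: inj_on_def)

lemma triv_carrier: "a u \<in> carrier W"
  using lin_isoD(3)[OF triv_lin_iso[of "proj F u"], of u] by simp

lemma triv_surj: "w \<in> carrier W \<Longrightarrow> \<exists>u. proj F u = x \<and> a u = w"
proof -
  assume "w \<in> carrier W"
  then have "w \<in> a ` {u. proj F u = x}" using lin_isoD(2)[OF triv_lin_iso[of x]] by simp
  then show ?thesis by auto
qed

lemma clutch_eq_iff:
  assumes "proj F u = x" "proj F v = x'"
  shows "clutch F a x x' u = v \<longleftrightarrow> a u = a v"
proof -
  obtain v' where v': "proj F v' = x'" "a v' = a u" using triv_surj[OF triv_carrier] by blast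
  then have "inv_into {u. proj F u = x'} a (a u) = v'"
    using lin_isoD(1)[OF triv_lin_iso[of x']] by (intro inv_into_f_eq) auto
  then have "clutch F a x x' u = v'" using assms by (simp add: clutch_def)
  then show ?thesis using v' assms triv_inj[of v' v] by auto
qed

lemma clutch_proj:
  assumes "proj F u = x"
  shows "proj F (clutch F a x x' u) = x'" "a (clutch F a x x' u) = a u"
proof -
  obtain v where v: "proj F v = x'" "a v = a u" using triv_surj[OF triv_carrier] by blast
  with clutch_eq_iff[OF assms v(1)] show "proj F (clutch F a x x' u) = x'" "a (clutch F a x x' u) = a u"
    by auto
qed

text \<open>All fibers are compared with the one space \<open>W\<close>: vectors correspond exactly
  when they have the same image under \<open>a\<close>. The cocycle identities and equivariance are
  inherited from equality in \<open>W\<close>.\<close>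

lemma clutch_Psi: "clutch F a \<in> Psi F"
proof -
  have L: "lin_iso (fiber F x) (fiber F x') (clutch F a x x')" for x x'
    by (rule lin_iso_cong[OF lin_iso_compose[OF triv_lin_iso lin_iso_inv[OF triv_lin_iso fiber_closed]]])
      (simp_all add: clutch_def fiber_closed)
  have inv: "clutch F a x x' u = inv_into (carrier (fiber F x')) (clutch F a x' x) u"
    if u: "proj F u = x" for x x' u
  proof -
    have "clutch F a x' x (clutch F a x x' u) = u"
      using clutch_proj[OF u, of x'] u by (subst clutch_eq_iff) auto
    then show ?thesis
      using lin_isoD(1)[OF L] clutch_proj[OF u, of x'] by (intro inv_into_f_eq[symmetric]) auto
  qed
  have trans: "clutch F a x x'' u = clutch F a x' x'' (clutch F a x x' u)" if u: "proj F u = x" for x x' x'' u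
    using clutch_proj[OF u, of x'] clutch_proj[OF clutch_proj(1)[OF u, of x'], of x''] u
    by (subst clutch_eq_iff) auto
  have self: "clutch F a x x u = u" if u: "proj F u = x" for x u
    using u by (subst clutch_eq_iff) auto
  have extl: "clutch F a x x' \<in> extensional (carrier (fiber F x))" for x x'
    by (simp add: clutch_def)
  have "clutching_map F (clutch F a)"
    unfolding clutching_map_def
    by (intro conjI allI ballI extl L self inv trans; simp)
  moreover have "clutching_act F g (clutch F a) = clutch F a" for g
  proof (intro ext)
    fix x x' u
    show "clutching_act F g (clutch F a) x x' u = clutch F a x x' u"
    proof (cases "proj F u = x")
      case True
      let ?v = "clutch F a (base_act F (- g) x) (base_act F (- g) x') (total_act F (- g) u)"
      have v: "proj F ?v = base_act F (- g) x'" "a ?v = a (total_act F (- g) u)"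
        using True by (intro clutch_proj; simp add: proj_act)+
      have "a (total_act F g ?v) = a (total_act F g (total_act F (- g) u))"
        unfolding triv_act v(2) ..
      then have "clutch F a x x' u = total_act F g ?v"
        using True v(1) by (subst clutch_eq_iff) (simp_all add: proj_act)
      then show ?thesis using True by (simp add: clutching_act_def)
    qed (simp add: clutching_act_def clutch_def)
  qed
  ultimately show ?thesis by (simp add: Psi_def)
qed

end

section \<open>The quotient by a clutching map\<close>

context
  fixes \<psi>
  assumes \<psi>: "\<psi> \<in> Psi F"
begin

lemmas clutching = \<psi>[unfolded Psi_def mem_Collect_eq, THEN conjunct1, unfolded clutching_map_def]

lemma psi_lin_iso: "lin_iso (fiber F x) (fiber F x') (\<psi> x x')"
  and psi_extensional: "\<psi> x x' \<in> extensional {u. proj F u = x}"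
  using clutching[THEN conjunct1] by simp_all

lemma psi_self: "proj F u = x \<Longrightarrow> \<psi> x x u = u"
  using clutching[THEN conjunct2, THEN conjunct1] by auto

lemma psi_trans: "proj F u = x \<Longrightarrow> \<psi> x' x'' (\<psi> x x' u) = \<psi> x x'' u"
proof -
  assume "proj F u = x"
  then have "u \<in> carrier (fiber F x)" by simp
  then show ?thesis using clutching[THEN conjunct2, THEN conjunct2, THEN conjunct2] by metis
qed

lemma psi_proj: "proj F u = x \<Longrightarrow> proj F (\<psi> x x' u) = x'"
  using lin_isoD(3)[OF psi_lin_iso[of x x'], of u] by simp

lemma psi_act:
  assumes "proj F u = x"
  shows "total_act F g (\<psi> x x' u) = \<psi> (base_act F g x) (base_act F g x') (total_act F g u)"
proof -
  have "clutching_act F g \<psi> = \<psi>" using \<psi> by (simp add: Psi_def)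
  from fun_cong[OF fun_cong[OF fun_cong[OF this, of "base_act F g x"], of "base_act F g x'"], of "total_act F g u"]
  show ?thesis using assms by (simp add: clutching_act_def proj_act)
qed

abbreviation class_map where "class_map \<equiv> quotient_map_of F \<psi>"

lemma class_map_iff: "v \<in> class_map u \<longleftrightarrow> \<psi> (proj F u) (proj F v) u = v"
  by (simp add: quotient_map_of_def clutching_rel_def)

lemma class_map_psi: "proj F u = x \<Longrightarrow> class_map (\<psi> x x' u) = class_map u"
  by (auto simp: set_eq_iff class_map_iff psi_proj psi_trans)

lemma class_map_eq_iff: "class_map u = class_map v \<longleftrightarrow> \<psi> (proj F u) (proj F v) u = v"
proof
  assume "class_map u = class_map v"
  moreover have "v \<in> class_map v" by (simp add: class_map_iff psi_self)
  ultimately have "v \<in> class_map u" by simp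
  then show "\<psi> (proj F u) (proj F v) u = v" by (simp only: class_map_iff)
next
  assume "\<psi> (proj F u) (proj F v) u = v"
  then show "class_map u = class_map v" using class_map_psi[of u "proj F u" "proj F v"] by simp
qed

lemma class_map_memb: "v \<in> class_map u \<longleftrightarrow> class_map v = class_map u"
  by (metis class_map_iff class_map_eq_iff)

lemma class_map_self: "u \<in> class_map u"
  by (simp add: class_map_memb)

lemma quotient_act: "act (quotient_rep F \<psi>) g (class_map u) = class_map (total_act F g u)"
proof -
  have "class_map (total_act F g v) = class_map (total_act F g u)" if "v \<in> class_map u" for v
    using that psi_act[of u "proj F u" g "proj F v"]
    by (metis class_map_iff class_map_psi proj_act)
  then have "(\<Union>v\<in>class_map u. class_map (total_act F g v)) = (\<Union>v\<in>class_map u. class_map (total_act F g u))"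
    by (intro SUP_cong) auto
  then show ?thesis using class_map_self[of u] by (auto simp: quotient_rep_def)
qed

text \<open>Every class meets every fiber in exactly one vector. Linearity of the components of
  \<open>\<psi>\<close> makes all representatives produce the same class, so the unions defining the
  operations collapse.\<close>

lemma class_map_lin_iso: "lin_iso (fiber F x) (quotient_rep F \<psi>) class_map"
  unfolding lin_iso_def
proof (intro conjI ballI allI)
  show "bij_betw class_map (carrier (fiber F x)) (carrier (quotient_rep F \<psi>))"
    unfolding bij_betw_def
  proof
    show "inj_on class_map (carrier (fiber F x))"
      by (auto simp: inj_on_def class_map_eq_iff psi_self)
    have "\<exists>v. proj F v = x \<and> class_map v = class_map u" for u
      using class_map_psi[of u "proj F u" x] psi_proj[of u "proj F u" x] by blast
    then have "range class_map \<subseteq> class_map ` carrier (fiber F x)"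
      by (metis (mono_tags, lifting) carrier_fiber image_eqI image_subsetI mem_Collect_eq)
    moreover have "carrier (quotient_rep F \<psi>) = range class_map"
      by (auto simp: quotient_rep_def quotient_def quotient_map_of_def)
    ultimately show "class_map ` carrier (fiber F x) = carrier (quotient_rep F \<psi>)"
      by (metis image_mono subset_UNIV subset_antisym)
  qed
next
  fix u v assume uv: "u \<in> carrier (fiber F x)" "v \<in> carrier (fiber F x)"
  have *: "class_map (fadd F u' v') = class_map (fadd F u v)"
    if "u' \<in> class_map u" "v' \<in> class_map v" "proj F v' = proj F u'" for u' v'
  proof -
    have "u' = \<psi> x (proj F u') u" "v' = \<psi> x (proj F u') v"
      using that uv by (auto simp: class_map_iff)
    then have "fadd F u' v' = \<psi> x (proj F u') (fadd F u v)"
      using lin_isoD(4)[OF psi_lin_iso[of x "proj F u'"] uv] by simp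
    then show ?thesis using uv by (simp add: class_map_psi fadd_fiber)
  qed
  have "class_map u \<oplus>\<^bsub>quotient_rep F \<psi>\<^esub> class_map v =
      (\<Union>u'\<in>class_map u. \<Union>v'\<in>{v' \<in> class_map v. proj F v' = proj F u'}. class_map (fadd F u' v'))"
    by (simp add: quotient_rep_def)
  also have "\<dots> = class_map (fadd F u v)"
  proof
    show "(\<Union>u'\<in>class_map u. \<Union>v'\<in>{v' \<in> class_map v. proj F v' = proj F u'}. class_map (fadd F u' v'))
        \<subseteq> class_map (fadd F u v)"
      using * by blast
    show "class_map (fadd F u v) \<subseteq>
        (\<Union>u'\<in>class_map u. \<Union>v'\<in>{v' \<in> class_map v. proj F v' = proj F u'}. class_map (fadd F u' v'))"
      using class_map_self[of u] class_map_self[of v] uv by auto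
  qed
  finally show "class_map (u \<oplus>\<^bsub>fiber F x\<^esub> v) = class_map u \<oplus>\<^bsub>quotient_rep F \<psi>\<^esub> class_map v" by simp
next
  fix c u assume u: "u \<in> carrier (fiber F x)"
  have *: "class_map (fsmult F c u') = class_map (fsmult F c u)" if "u' \<in> class_map u" for u'
  proof -
    have "u' = \<psi> x (proj F u') u" using that u by (auto simp: class_map_iff)
    then have "fsmult F c u' = \<psi> x (proj F u') (fsmult F c u)"
      using lin_isoD(5)[OF psi_lin_iso[of x "proj F u'"] u] by simp
    then show ?thesis using u by (simp add: class_map_psi fsmult_fiber)
  qed
  have "c \<odot>\<^bsub>quotient_rep F \<psi>\<^esub> class_map u = (\<Union>u'\<in>class_map u. class_map (fsmult F c u'))"
    by (simp add: quotient_rep_def)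
  also have "\<dots> = class_map (fsmult F c u)"
    using * class_map_self[of u] by blast
  finally show "class_map (c \<odot>\<^bsub>fiber F x\<^esub> u) = c \<odot>\<^bsub>quotient_rep F \<psi>\<^esub> class_map u" by simp
qed

end

text \<open>\<open>a\<close> is constant on classes and descends to an isomorphism from the quotient
  to \<open>W\<close>. It is realized by lifting classes to one arbitrary fiber, here the one over
  \<open>undefined\<close>.\<close>

lemma clutch_Psi_ext:
  assumes a: "trivialization F W a"
  shows "clutch F a \<in> Psi_ext F W"
proof -
  let ?\<psi> = "clutch F a" and ?x = "undefined :: 'x"
  have \<psi>: "?\<psi> \<in> Psi F" using a by (rule clutch_Psi)
  define f where "f = (\<lambda>A. a (inv_into (carrier (fiber F ?x)) (quotient_map_of F ?\<psi>) A))"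
  note p = class_map_lin_iso[OF \<psi>]
  have "lin_iso (quotient_rep F ?\<psi>) W f"
    unfolding f_def by (rule lin_iso_compose[OF lin_iso_inv[OF p fiber_closed] triv_lin_iso[OF a]])
  moreover have fp: "f (quotient_map_of F ?\<psi> u) = a u" for u
  proof -
    have "quotient_map_of F ?\<psi> u = quotient_map_of F ?\<psi> (?\<psi> (proj F u) ?x u)"
      by (simp add: class_map_psi[OF \<psi>])
    then have "f (quotient_map_of F ?\<psi> u) = a (?\<psi> (proj F u) ?x u)"
      unfolding f_def using lin_isoD(1)[OF p, of ?x] clutch_proj(1)[OF a, of u]
      by (simp add: inv_into_f_f)
    then show ?thesis by (simp add: clutch_proj(2)[OF a])
  qed
  moreover have "\<exists>u. A = quotient_map_of F ?\<psi> u" if "A \<in> carrier (quotient_rep F ?\<psi>)" for A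
    using that lin_isoD(2)[OF p, of ?x] by auto
  then have "\<forall>g. \<forall>A\<in>carrier (quotient_rep F ?\<psi>). f (act (quotient_rep F ?\<psi>) g A) = act W g (f A)"
    using fp quotient_act[OF \<psi>] triv_act[OF a] by metis
  ultimately show ?thesis
    using \<psi> by (auto simp: Psi_ext_def isomorphic_rep_def rep_iso_def)
qed

text \<open>The trivialization is the quotient map followed by an isomorphism from the quotient to
  \<open>W\<close>.\<close>

lemma Psi_ext_clutch:
  assumes "\<psi> \<in> Psi_ext F W"
  shows "\<exists>a. trivialization F W a \<and> \<psi> = clutch F a"
proof -
  from assms obtain f where \<psi>: "\<psi> \<in> Psi F" and f: "rep_iso UNIV (quotient_rep F \<psi>) W f"
    by (auto simp: Psi_ext_def isomorphic_rep_def)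
  have lf: "lin_iso (quotient_rep F \<psi>) W f" using f by (simp add: rep_iso_def)
  note p = class_map_lin_iso[OF \<psi>]
  define a where "a u = f (quotient_map_of F \<psi> u)" for u
  have a: "trivialization F W a"
    unfolding trivialization_def
  proof (intro conjI allI)
    show "lin_iso (fiber F x) W a" for x
      unfolding a_def by (rule lin_iso_compose[OF p lf])
    show "a (total_act F g u) = act W g (a u)" for g u
      using f lin_isoD(3)[OF p[of "proj F u"], of u]
      by (simp add: a_def rep_iso_def flip: quotient_act[OF \<psi>])
  qed
  have "\<psi> = clutch F a"
  proof (intro ext)
    fix x x' u
    show "\<psi> x x' u = clutch F a x x' u"
    proof (cases "proj F u = x")
      case True
      have "a u = a (\<psi> x x' u)" using True by (simp add: a_def class_map_psi[OF \<psi>])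
      then show ?thesis using clutch_eq_iff[OF a True psi_proj[OF \<psi> True]] by metis
    next
      case False
      then show ?thesis using psi_extensional[OF \<psi>, of x x'] by (auto simp: clutch_def extensional_def)
    qed
  qed
  with a show ?thesis by blast
qed

lemma Psi_ext_eq: "Psi_ext F W = clutch F ` {a. trivialization F W a}"
  using clutch_Psi_ext Psi_ext_clutch by blast

end

section \<open>Coordinates on the fibers\<close>

abbreviation coords :: "nat \<Rightarrow> (nat \<Rightarrow> complex) set" where
  "coords n \<equiv> {v. \<forall>i\<ge>n. v i = 0}"

lemma coord_space_simps [simp]:
  "carrier (coord_space n) = coords n"
  "v \<oplus>\<^bsub>coord_space n\<^esub> w = (\<lambda>i. v i + w i)"
  "c \<odot>\<^bsub>coord_space n\<^esub> v = (\<lambda>i. c * v i)"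
  by (simp_all add: coord_space_def)

lemma basis_vec_coords: "j < n \<Longrightarrow> basis_vec j \<in> coords n"
  by (auto simp: basis_vec_def)

lemma coords_linear_expansion:
  fixes f :: "(nat \<Rightarrow> complex) \<Rightarrow> nat \<Rightarrow> complex"
  assumes add: "\<And>u v. u \<in> coords n \<Longrightarrow> v \<in> coords n \<Longrightarrow> f (\<lambda>i. u i + v i) = (\<lambda>i. f u i + f v i)"
    and scale: "\<And>c v. v \<in> coords n \<Longrightarrow> f (\<lambda>i. c * v i) = (\<lambda>i. c * f v i)" and v: "v \<in> coords n"
  shows "f v i = (\<Sum>j<n. v j * f (basis_vec j) i)"
proof -
  have "f (\<lambda>i. if i < m then v i else 0) i = (\<Sum>j<m. v j * f (basis_vec j) i)" if "m \<le> n" for m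
    using that
  proof (induction m)
    case 0
    show ?case using scale[of "\<lambda>_. 0" 0] by simp
  next
    case (Suc m)
    have "(\<lambda>i. if i < Suc m then v i else 0) = (\<lambda>i. (if i < m then v i else 0) + v m * basis_vec m i)"
      by (auto simp: basis_vec_def fun_eq_iff less_Suc_eq)
    moreover have "f (\<lambda>i. (if i < m then v i else 0) + v m * basis_vec m i) =
        (\<lambda>i. f (\<lambda>i. if i < m then v i else 0) i + f (\<lambda>i. v m * basis_vec m i) i)"
      using Suc.prems by (intro add) (auto simp: basis_vec_def)
    ultimately show ?case
      using Suc scale[OF basis_vec_coords[of m n], of "v m"] by simp
  qed
  moreover have "(\<lambda>i. if i < n then v i else 0) = v" using v by (auto simp: fun_eq_iff)
  ultimately show ?thesis by (metis order_refl)
qed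

definition mat_app :: "nat \<Rightarrow> complex mat \<Rightarrow> (nat \<Rightarrow> complex) \<Rightarrow> nat \<Rightarrow> complex" where
  "mat_app n A v = (\<lambda>i. if i < n then \<Sum>j<n. A $$ (i, j) * v j else 0)"

lemma mat_app_coords: "mat_app n A v \<in> coords n"
  by (simp add: mat_app_def)

lemma mat_app_mult:
  assumes A: "A \<in> carrier_mat n n" and B: "B \<in> carrier_mat n n"
  shows "mat_app n (A * B) v = mat_app n A (mat_app n B v)"
proof
  fix i
  have "(\<Sum>j<n. (\<Sum>k<n. A $$ (i, k) * B $$ (k, j)) * v j) = (\<Sum>k<n. A $$ (i, k) * (\<Sum>j<n. B $$ (k, j) * v j))"
    unfolding sum_distrib_left sum_distrib_right
    by (subst sum.swap) (simp add: mult.assoc)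
  moreover have "(\<Sum>j<n. (A * B) $$ (i, j) * v j) = (\<Sum>j<n. (\<Sum>k<n. A $$ (i, k) * B $$ (k, j)) * v j)"
    if "i < n"
    using that by (intro sum.cong refl) (simp add: mult_mat_entry[OF A B] del: index_mult_mat(1))
  ultimately show "mat_app n (A * B) v i = mat_app n A (mat_app n B v) i"
    by (simp add: mat_app_def del: index_mult_mat(1))
qed

lemma mat_app_diag: "v \<in> coords n \<Longrightarrow> mat_app n (diag n d) v = (\<lambda>i. d i * v i)"
  by (auto simp: mat_app_def fun_eq_iff diag_entry if_distrib if_distribR cong: if_cong)

lemma mat_app_one: "v \<in> coords n \<Longrightarrow> mat_app n (1\<^sub>m n) v = v"
  by (auto simp: mat_app_def fun_eq_iff if_distrib if_distribR cong: if_cong)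

lemma mat_app_basis_vec: "i < n \<Longrightarrow> j < n \<Longrightarrow> mat_app n A (basis_vec j) i = A $$ (i, j)"
  by (simp add: mat_app_def basis_vec_def if_distrib cong: if_cong)

lemma mat_app_add: "mat_app n A (\<lambda>i. u i + v i) = (\<lambda>i. mat_app n A u i + mat_app n A v i)"
  by (simp add: mat_app_def fun_eq_iff sum.distrib algebra_simps)

lemma mat_app_scale: "mat_app n A (\<lambda>i. c * v i) = (\<lambda>i. c * mat_app n A v i)"
  by (auto simp: mat_app_def fun_eq_iff sum_distrib_left algebra_simps)

lemma mat_eq_mat_app:
  assumes A: "A \<in> carrier_mat n n" and B: "B \<in> carrier_mat n n"
    and eq: "\<And>v. v \<in> coords n \<Longrightarrow> mat_app n A v = mat_app n B v"
  shows "A = B"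
proof (rule eq_square_matI[of _ n])
  fix i j assume ij: "i < n" "j < n"
  then show "A $$ (i, j) = B $$ (i, j)"
    using fun_cong[OF eq[OF basis_vec_coords[OF ij(2)]], of i] by (simp add: mat_app_basis_vec)
qed (use A B in simp_all)

lemma mat_app_inv:
  assumes A: "A \<in> carrier_mat n n" "det A \<noteq> 0" and v: "v \<in> coords n"
  shows "mat_app n A (mat_app n (mat_inv A) v) = v" "mat_app n (mat_inv A) (mat_app n A v) = v"
  using A v by (simp_all add: mat_inv[OF A] mat_app_one flip: mat_app_mult)

lemma det_nonzero_right_inverse:
  fixes A B :: "complex mat"
  assumes "A \<in> carrier_mat n n" "B \<in> carrier_mat n n" "A * B = 1\<^sub>m n"
  shows "det A \<noteq> 0"
  using det_mult[OF assms(1,2)] assms(3) by auto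

lemma det_diag_nonzero:
  assumes "\<And>i. i < n \<Longrightarrow> d i \<noteq> 0"
  shows "det (diag n d) \<noteq> 0"
proof (rule det_nonzero_right_inverse[of _ n "diag n (\<lambda>i. inverse (d i))"])
  show "diag n d * diag n (\<lambda>i. inverse (d i)) = 1\<^sub>m n"
  proof (rule eq_square_matI[of _ n])
    fix i j assume ij: "i < n" "j < n"
    show "(diag n d * diag n (\<lambda>i. inverse (d i))) $$ (i, j) = 1\<^sub>m n $$ (i, j)"
      unfolding mult_diag_entry(1)[OF diag_carrier ij] using ij assms by (simp add: diag_entry)
  qed simp_all
qed simp_all

definition diag_rep :: "nat \<Rightarrow> ('g \<Rightarrow> nat \<Rightarrow> complex) \<Rightarrow> ('g, nat \<Rightarrow> complex) rep" where
  "diag_rep n \<theta> = \<lparr>carrier = coords n, monoid.mult = undefined, one = undefined, ring.zero = (\<lambda>i. 0),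
     ring.add = (\<lambda>v w i. v i + w i), smult = (\<lambda>c v i. c * v i), act = (\<lambda>g v i. \<theta> g i * v i)\<rparr>"

lemma diag_rep_simps [simp]:
  "carrier (diag_rep n \<theta>) = coords n"
  "v \<oplus>\<^bsub>diag_rep n \<theta>\<^esub> w = (\<lambda>i. v i + w i)"
  "c \<odot>\<^bsub>diag_rep n \<theta>\<^esub> v = (\<lambda>i. c * v i)"
  "act (diag_rep n \<theta>) g v = (\<lambda>i. \<theta> g i * v i)"
  by (simp_all add: diag_rep_def)

lemma lin_iso_diag_rep [simp]: "lin_iso V (diag_rep n \<theta>) f \<longleftrightarrow> lin_iso V (coord_space n) f"
  by (simp add: lin_iso_def)

lemma lin_iso_mat_app:
  assumes A: "A \<in> carrier_mat n n" "det A \<noteq> 0"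
  shows "lin_iso (coord_space n) (coord_space n) (mat_app n A)"
  unfolding lin_iso_def
proof (intro conjI ballI allI)
  show "bij_betw (mat_app n A) (carrier (coord_space n)) (carrier (coord_space n))"
    by (rule bij_betwI[where g = "mat_app n (mat_inv A)"])
      (use mat_app_coords mat_app_inv[OF A] in auto)
qed (simp_all add: mat_app_add mat_app_scale)

lemma lin_iso_expansion:
  assumes "lin_iso (coord_space m) (coord_space n) f" "v \<in> coords m"
  shows "f v i = (\<Sum>j<m. v j * f (basis_vec j) i)"
  using lin_isoD(4,5)[OF assms(1)] assms(2)
  by (intro coords_linear_expansion) simp_all

lemma continuous_on_apply: "continuous_on S f \<Longrightarrow> continuous_on S (\<lambda>x. f x i)"
  for f :: "'t::topological_space \<Rightarrow> 'i \<Rightarrow> 'b::topological_space"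
  by (rule continuous_on_product_then_coordinatewise)

context equivariant_gbundle
begin

lemma fiber_chart:
  "\<exists>n c c'. lin_iso (fiber F x) (coord_space n) c \<and> (\<forall>i. continuous_on {u. proj F u = x} (\<lambda>u. c u i)) \<and>
     continuous_on (coords n) c' \<and> (\<forall>v\<in>coords n. proj F (c' v) = x \<and> c (c' v) = v)"
proof -
  have "vector_bundle F" using F[unfolded equivariant_bundle_def] by (rule conjunct1)
  from this[unfolded vector_bundle_def, THEN conjunct2, THEN conjunct2, THEN spec, of x]
  obtain U n \<phi> \<phi>' where U: "x \<in> U" and hom: "homeomorphism (proj F -` U) (U \<times> carrier (coord_space n)) \<phi> \<phi>'"
    and fst: "\<forall>u\<in>proj F -` U. fst (\<phi> u) = proj F u"
    and lin: "\<forall>y\<in>U. lin_iso (fiber F y) (coord_space n) (\<lambda>u. snd (\<phi> u))"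
    by (elim exE conjE)
  have "continuous_on (proj F -` U) \<phi>" using hom by (simp add: homeomorphism_def)
  then have "continuous_on {u. proj F u = x} \<phi>"
    by (rule continuous_on_subset) (use U in auto)
  then have 1: "continuous_on {u. proj F u = x} (\<lambda>u. snd (\<phi> u) i)" for i
    by (rule continuous_on_apply[OF continuous_on_snd])
  have "continuous_on (U \<times> coords n) \<phi>'" using hom by (simp add: homeomorphism_def)
  then have 2: "continuous_on (coords n) (\<lambda>v. \<phi>' (x, v))"
    by (rule continuous_on_compose2) (use U in \<open>auto intro: continuous_intros\<close>)
  have 3: "proj F (\<phi>' (x, v)) = x \<and> snd (\<phi> (\<phi>' (x, v))) = v" if "v \<in> coords n" for v
  proof -
    have xv: "(x, v) \<in> U \<times> carrier (coord_space n)" using U that by simp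
    then have "\<phi>' (x, v) \<in> proj F -` U" "\<phi> (\<phi>' (x, v)) = (x, v)"
      using hom unfolding homeomorphism_def by blast+
    then show ?thesis using fst by force
  qed
  show ?thesis
  proof (intro exI conjI allI ballI)
    show "lin_iso (fiber F x) (coord_space n) (\<lambda>u. snd (\<phi> u))" using lin U by blast
  qed (use 1 2 3 in blast)+
qed

text \<open>A linear isomorphism differs from the continuous chart of \<open>fiber_chart\<close> by
  a linear map of coordinate spaces, which is continuous by its explicit matrix formula.\<close>

lemma continuous_fiber_iso:
  assumes b: "lin_iso (fiber F x) (coord_space m) b"
  shows "continuous_on {u. proj F u = x} (\<lambda>u. b u i)" "continuous_on (coords m) (inv_into {u. proj F u = x} b)"
proof -
  obtain n c c' where c: "lin_iso (fiber F x) (coord_space n) c"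
    and cont: "\<And>i. continuous_on {u. proj F u = x} (\<lambda>u. c u i)" "continuous_on (coords n) c'"
    and c': "\<And>v. v \<in> coords n \<Longrightarrow> proj F (c' v) = x \<and> c (c' v) = v"
    using fiber_chart[of x] by blast
  have c_in: "c u \<in> coords n" if "proj F u = x" for u
    using lin_isoD(3)[OF c, of u] that by simp
  have c'c: "c' (c u) = u" if "proj F u = x" for u
    using lin_isoD(1)[OF c] c'[OF c_in[OF that]] that by (auto simp: inj_on_def)
  define B where "B = inv_into (carrier (fiber F x)) b"
  define C where "C = inv_into (carrier (fiber F x)) c"
  have C: "C v = c' v" if "v \<in> coords n" for v
    unfolding C_def using lin_isoD(1)[OF c] c'[OF that] by (intro inv_into_f_eq) auto
  have bC: "lin_iso (coord_space n) (coord_space m) (\<lambda>v. b (C v))"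
    unfolding C_def by (rule lin_iso_compose[OF lin_iso_inv[OF c fiber_closed] b])
  have cB: "lin_iso (coord_space m) (coord_space n) (\<lambda>v. c (B v))"
    unfolding B_def by (rule lin_iso_compose[OF lin_iso_inv[OF b fiber_closed] c])
  have b_eq: "b u i = (\<Sum>j<n. c u j * b (C (basis_vec j)) i)" if "u \<in> {u. proj F u = x}" for u
  proof -
    have "proj F u = x" using that by simp
    then show ?thesis
      using lin_iso_expansion[OF bC c_in, of u i] C[OF c_in, of u] c'c by metis
  qed
  have "continuous_on {u. proj F u = x} (\<lambda>u. \<Sum>j<n. c u j * b (C (basis_vec j)) i)"
    by (intro continuous_on_sum continuous_on_mult continuous_on_const cont(1))
  then show "continuous_on {u. proj F u = x} (\<lambda>u. b u i)"
    by (rule continuous_on_eq) (rule b_eq[symmetric])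
  have "continuous_on (coords m) (\<lambda>v. \<Sum>j<m. v j * c (B (basis_vec j)) i)" for i
    by (intro continuous_on_sum continuous_on_mult continuous_on_const continuous_on_apply[OF continuous_on_id])
  then have "continuous_on (coords m) (\<lambda>v. c (B v) i)" for i
    by (rule continuous_on_eq) (use lin_iso_expansion[OF cB] in auto)
  then have "continuous_on (coords m) (\<lambda>v. c (B v))"
    by (rule continuous_on_coordinatewise_then_product)
  moreover have BF: "proj F (B v) = x" if "v \<in> coords m" for v
    using lin_isoD(3)[OF lin_iso_inv[OF b fiber_closed], of v] that by (simp add: B_def)
  ultimately have "continuous_on (coords m) (\<lambda>v. c' (c (B v)))"
    by (intro continuous_on_compose2[OF cont(2)]) (use c_in BF in blast)+
  then show "continuous_on (coords m) (inv_into {u. proj F u = x} b)"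
    by (rule continuous_on_eq) (use BF c'c in \<open>simp add: B_def\<close>)
qed

end

section \<open>Clutching maps with diagonal quotient as a block orbit\<close>

text \<open>Numbering each class of indices by its least member turns equality of arbitrary values,
  here of characters, into equality of natural labels.\<close>

lemma Least_eq_iff: "(LEAST j. f j = f i) = (LEAST j. f j = f k) \<longleftrightarrow> f i = f k" for i k :: nat
proof
  assume "(LEAST j. f j = f i) = (LEAST j. f j = f k)"
  moreover have "f (LEAST j. f j = f i) = f i" "f (LEAST j. f j = f k) = f k" by (rule LeastI, rule refl)+
  ultimately show "f i = f k" by metis
qed simp

text \<open>\<open>a0\<close> is a reference trivialization, and \<open>r\<close> chooses group
  elements carrying \<open>x0\<close> to each point. With \<open>r x0 = 0\<close>, the matrix
  describing another trivialization over \<open>x0\<close> needs no twist.\<close>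

locale diagonal_bundle = equivariant_gbundle F
  for F :: "('g::topological_ab_group_add, 'x::{finite, discrete_topology}, 'e::topological_space) gbundle" +
  fixes n :: nat and \<theta> :: "'g \<Rightarrow> nat \<Rightarrow> complex" and a0 :: "'e \<Rightarrow> nat \<Rightarrow> complex" and r :: "'x \<Rightarrow> 'g" and x0 :: 'x
  assumes a0: "trivialization F (diag_rep n \<theta>) a0"
    and r: "base_act F (r x) x0 = x" and r0: "r x0 = 0"
    and \<theta>_0: "i < n \<Longrightarrow> \<theta> 0 i = 1" and \<theta>_add: "i < n \<Longrightarrow> \<theta> (g + h) i = \<theta> g i * \<theta> h i"
begin

abbreviation X where "X \<equiv> Psi_ext F (diag_rep n \<theta>)"

definition H where "H = {h. base_act F h x0 = x0}"
text \<open>Labels for the characters restricted to \<open>H\<close>: the value 0 outside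
  \<open>H\<close> makes equality of the two functions mean agreement on \<open>H\<close>.\<close>

definition s :: "nat \<Rightarrow> nat" where "s i = (LEAST j. (\<lambda>h. if h \<in> H then \<theta> h j else 0) = (\<lambda>h. if h \<in> H then \<theta> h i else 0))"
definition t :: "nat \<Rightarrow> nat" where "t i = (LEAST j. (\<lambda>g. \<theta> g j) = (\<lambda>g. \<theta> g i))"

lemma s_iff: "s i = s j \<longleftrightarrow> (\<forall>h\<in>H. \<theta> h i = \<theta> h j)"
proof -
  have "s i = s j \<longleftrightarrow> (\<lambda>h. if h \<in> H then \<theta> h i else 0) = (\<lambda>h. if h \<in> H then \<theta> h j else 0)"
    unfolding s_def by (rule Least_eq_iff)
  then show ?thesis by (auto simp: fun_eq_iff)
qed

lemma t_iff: "t i = t j \<longleftrightarrow> (\<forall>g. \<theta> g i = \<theta> g j)"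
proof -
  have "t i = t j \<longleftrightarrow> (\<lambda>g. \<theta> g i) = (\<lambda>g. \<theta> g j)"
    unfolding t_def by (rule Least_eq_iff)
  then show ?thesis by (auto simp: fun_eq_iff)
qed

lemma t_le: "t i \<le> i"
  unfolding t_def by (rule Least_le) (rule refl)

lemma \<theta>_inverse: "i < n \<Longrightarrow> \<theta> (- g) i * \<theta> g i = 1" "i < n \<Longrightarrow> \<theta> g i * \<theta> (- g) i = 1"
  using \<theta>_add[of i "- g" g] \<theta>_0[of i] by (simp_all add: mult.commute)

definition D where "D g = diag n (\<theta> g)"

lemma D_carrier [simp]: "D g \<in> carrier_mat n n"
  by (simp add: D_def)

lemma D_entry:
  assumes "A \<in> carrier_mat n n" "i < n" "j < n"
  shows "(D g * A) $$ (i, j) = \<theta> g i * A $$ (i, j)" "(A * D g) $$ (i, j) = A $$ (i, j) * \<theta> g j"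
  using assms by (simp_all add: D_def mult_diag_entry del: index_mult_mat(1))

lemma D_add: "D (g + h) = D g * D h"
proof (rule eq_square_matI[of _ n])
  fix i j assume ij: "i < n" "j < n"
  then show "D (g + h) $$ (i, j) = (D g * D h) $$ (i, j)"
    unfolding D_entry(1)[OF D_carrier ij] by (simp add: D_def diag_entry \<theta>_add)
qed simp_all

lemma D_0: "D 0 = 1\<^sub>m n"
  by (rule eq_matI) (auto simp: D_def diag_def \<theta>_0)

lemma D_inverse: "D (- g) * D g = 1\<^sub>m n" "D g * D (- g) = 1\<^sub>m n"
  by (simp_all add: D_0 flip: D_add)

lemma D_cancel: "A \<in> carrier_mat n n \<Longrightarrow> D (- g) * (D g * A) = A"
  "A \<in> carrier_mat n n \<Longrightarrow> D g * (D (- g) * A) = A"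
  by (simp_all add: D_inverse left_mult_one_mat[of _ n n] flip: square_mult_assoc[of _ n])

lemma det_D: "det (D g) \<noteq> 0"
  by (rule det_nonzero_right_inverse[OF _ _ D_inverse(2)]) simp_all

lemma mat_app_D: "v \<in> coords n \<Longrightarrow> mat_app n (D g) v = (\<lambda>i. \<theta> g i * v i)"
  by (simp add: D_def mat_app_diag)

text \<open>Schur's lemma in coordinates: entry \<open>(i, j)\<close> of
  \<open>D h * A - A * D h\<close> is \<open>(\<theta> h i - \<theta> h j)\<close> times that of
  \<open>A\<close>.\<close>

lemma block_mat_iff_commute:
  assumes p: "\<And>i j. p i = p j \<longleftrightarrow> (\<forall>h\<in>K. \<theta> h i = \<theta> h j)"
  shows "block_mat n p A \<longleftrightarrow> A \<in> carrier_mat n n \<and> (\<forall>h\<in>K. D h * A = A * D h)"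
proof
  assume A: "block_mat n p A"
  then have Ac: "A \<in> carrier_mat n n" by (rule block_mat_carrier)
  have "D h * A = A * D h" if h: "h \<in> K" for h
  proof (rule eq_square_matI[of _ n])
    fix i j assume ij: "i < n" "j < n"
    show "(D h * A) $$ (i, j) = (A * D h) $$ (i, j)"
      unfolding D_entry[OF Ac ij] using block_mat_entry[OF A ij] h p[of i j] by (cases "p i = p j") auto
  qed (use Ac in simp_all)
  with Ac show "A \<in> carrier_mat n n \<and> (\<forall>h\<in>K. D h * A = A * D h)" by blast
next
  assume A: "A \<in> carrier_mat n n \<and> (\<forall>h\<in>K. D h * A = A * D h)"
  then have Ac: "A \<in> carrier_mat n n" by blast
  have "A $$ (i, j) = 0" if ij: "i < n" "j < n" "p i \<noteq> p j" for i j
  proof -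
    from ij(3) obtain h where h: "h \<in> K" "\<theta> h i \<noteq> \<theta> h j" unfolding p by blast
    then have "\<theta> h i * A $$ (i, j) = A $$ (i, j) * \<theta> h j"
      using A by (simp flip: D_entry[OF Ac ij(1,2)])
    with h(2) show ?thesis by (simp add: mult.commute)
  qed
  with Ac show "block_mat n p A" by (simp add: block_mat_def)
qed

lemmas block_s_iff = block_mat_iff_commute[of s, OF s_iff]

lemma block_t_iff: "block_mat n t A \<longleftrightarrow> A \<in> carrier_mat n n \<and> (\<forall>g. D g * A = A * D g)"
  using block_mat_iff_commute[of t UNIV A] by (simp add: t_iff)

lemma block_t_imp_s: "block_mat n t A \<Longrightarrow> block_mat n s A"
  unfolding block_s_iff block_t_iff by blast

text \<open>If a trivialization is \<open>A\<close> times \<open>a0\<close> over \<open>x0\<close>,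
  equivariance forces it to be \<open>tw A x\<close> times \<open>a0\<close> over
  \<open>x\<close>.\<close>

definition tw :: "complex mat \<Rightarrow> 'x \<Rightarrow> complex mat" where
  "tw A x = D (r x) * A * D (- r x)"

lemma tw_carrier [simp]: "A \<in> carrier_mat n n \<Longrightarrow> tw A x \<in> carrier_mat n n"
  by (simp add: tw_def)

lemma tw_x0: "A \<in> carrier_mat n n \<Longrightarrow> tw A x0 = A"
  by (simp add: tw_def r0 D_0 right_mult_one_mat[of _ n n] left_mult_one_mat[of _ n n])

lemma det_tw: "A \<in> carrier_mat n n \<Longrightarrow> det A \<noteq> 0 \<Longrightarrow> det (tw A x) \<noteq> 0"
  unfolding tw_def by (intro det_mult_nonzero[of _ n]) (simp_all add: det_D)

lemma tw_mult:
  assumes "A \<in> carrier_mat n n" "B \<in> carrier_mat n n"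
  shows "tw (A * B) x = tw A x * tw B x"
  using assms by (simp add: tw_def square_mult_assoc[of _ n] D_cancel)

lemma tw_D:
  assumes "A \<in> carrier_mat n n"
  shows "tw A x * D (r x) = D (r x) * A"
  using assms by (simp add: tw_def square_mult_assoc[of _ n] D_inverse right_mult_one_mat[of _ n n])

lemma tw_block_t: "block_mat n t l \<Longrightarrow> tw l x = l"
  unfolding block_t_iff tw_def
  by (simp add: square_mult_assoc[of _ n] D_inverse right_mult_one_mat[of _ n n])

text \<open>Two elements carrying \<open>x0\<close> to \<open>x\<close> differ by an element of
  \<open>H\<close>, and \<open>A\<close> commutes with its diagonal matrix.\<close>

lemma tw_independent:
  assumes A: "block_mat n s A" and g: "base_act F g x0 = x"
  shows "tw A x = D g * A * D (- g)"
proof -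
  have Ac: "A \<in> carrier_mat n n" using A by (rule block_mat_carrier)
  define h where "h = - r x + g"
  have "base_act F h x0 = base_act F (- r x) (base_act F g x0)"
    unfolding h_def by (rule base_act_plus)
  then have "h \<in> H"
    using g base_act_inverse(1)[of "r x" x0] by (simp add: H_def r)
  then have "D h * A = A * D h" using A by (simp add: block_s_iff)
  then have "D h * A * D (- h) = A"
    using Ac by (simp add: square_mult_assoc[of _ n] D_inverse right_mult_one_mat[of _ n n])
  moreover have "g = r x + h" "- g = - h + - r x" by (simp_all add: h_def)
  then have "D g * A * D (- g) = D (r x) * (D h * A * D (- h)) * D (- r x)"
    using Ac by (simp only: D_add square_mult_assoc[of _ n] D_carrier square_mult_carrier)
  ultimately show ?thesis by (simp add: tw_def)
qed

definition triv :: "complex mat \<Rightarrow> 'e \<Rightarrow> nat \<Rightarrow> complex" where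
  "triv A u = mat_app n (tw A (proj F u)) (a0 u)"

definition q :: "complex mat \<Rightarrow> 'x \<Rightarrow> 'x \<Rightarrow> 'e \<Rightarrow> 'e" where
  "q A = clutch F (triv A)"

lemma a0_coords: "a0 u \<in> coords n"
  using triv_carrier[OF a0, of u] by simp

lemma a0_act: "a0 (total_act F g u) = mat_app n (D g) (a0 u)"
  using triv_act[OF a0, of g u] a0_coords by (simp add: mat_app_D)

lemma a0_lin_iso: "lin_iso (fiber F x) (coord_space n) a0"
  using triv_lin_iso[OF a0, of x] by simp

lemma a0_surj: "v \<in> coords n \<Longrightarrow> \<exists>u. proj F u = x \<and> a0 u = v"
  using triv_surj[OF a0, of v x] by simp

lemma triv_trivialization:
  assumes A: "block_mat n s A" "det A \<noteq> 0"
  shows "trivialization F (diag_rep n \<theta>) (triv A)"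
  unfolding trivialization_def
proof (intro conjI allI)
  have Ac: "A \<in> carrier_mat n n" using A by (simp add: block_mat_carrier)
  fix x
  have "lin_iso (fiber F x) (coord_space n) (\<lambda>u. mat_app n (tw A x) (a0 u))"
    by (rule lin_iso_compose[OF a0_lin_iso lin_iso_mat_app]) (simp_all add: Ac det_tw A)
  then have "lin_iso (fiber F x) (coord_space n) (triv A)"
    by (rule lin_iso_cong) (simp_all add: triv_def fiber_closed)
  then show "lin_iso (fiber F x) (diag_rep n \<theta>) (triv A)" by simp
next
  have Ac: "A \<in> carrier_mat n n" using A by (simp add: block_mat_carrier)
  fix g u
  let ?x = "proj F u"
  have "tw A (base_act F g ?x) = D (g + r ?x) * A * D (- (g + r ?x))"
    by (rule tw_independent[OF A(1)]) (simp add: base_act_plus r)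
  also have "\<dots> = D g * tw A ?x * D (- g)"
  proof -
    have "- (g + r ?x) = - r ?x + - g" by simp
    then show ?thesis using Ac by (simp only: tw_def D_add square_mult_assoc[of _ n] D_carrier square_mult_carrier)
  qed
  finally have "tw A (base_act F g ?x) * D g = D g * tw A ?x"
    using Ac by (simp add: square_mult_assoc[of _ n] D_inverse right_mult_one_mat[of _ n n])
  then have "triv A (total_act F g u) = mat_app n (D g) (triv A u)"
    using Ac by (simp add: triv_def proj_act a0_act flip: mat_app_mult)
  then show "triv A (total_act F g u) = act (diag_rep n \<theta>) g (triv A u)"
    using mat_app_coords by (simp add: mat_app_D triv_def)
qed

lemma q_eq_iff:
  assumes A: "block_mat n s A" "det A \<noteq> 0" and "proj F u = x" "proj F v = x'"
  shows "q A x x' u = v \<longleftrightarrow> triv A u = triv A v"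
  unfolding q_def by (rule clutch_eq_iff[OF triv_trivialization[OF A] assms(3,4)])

lemma q_proj:
  assumes A: "block_mat n s A" "det A \<noteq> 0" and "proj F u = x"
  shows "proj F (q A x x' u) = x'" "triv A (q A x x' u) = triv A u"
  unfolding q_def using clutch_proj[OF triv_trivialization[OF A] assms(3)] by auto

text \<open>\<open>A\<close> is the change of coordinates from \<open>a0\<close> to \<open>a\<close>
  over \<open>x0\<close>. Both intertwine the action of \<open>H\<close> on that fiber with the
  matrices \<open>D h\<close>, so \<open>A\<close> commutes with these; equivariance carries the
  identity to all other fibers.\<close>

lemma trivialization_triv:
  assumes a: "trivialization F (diag_rep n \<theta>) a"
  shows "\<exists>A. block_mat n s A \<and> det A \<noteq> 0 \<and> triv A = a"
proof -
  define b where "b = inv_into (carrier (fiber F x0)) a0"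
  have b: "proj F (b v) = x0" "a0 (b v) = v" if v: "v \<in> coords n" for v
  proof -
    have "v \<in> a0 ` carrier (fiber F x0)" using a0_surj[OF v, of x0] by auto
    then show "proj F (b v) = x0" "a0 (b v) = v"
      unfolding b_def using inv_into_into[of v a0 "carrier (fiber F x0)"] f_inv_into_f[of v a0 "carrier (fiber F x0)"]
      by auto
  qed
  have ba: "b (a0 u) = u" if "proj F u = x0" for u
    using b[OF a0_coords] triv_inj[OF a0, of "b (a0 u)" u] that by metis
  have f: "lin_iso (coord_space n) (coord_space n) (\<lambda>v. a (b v))"
    unfolding b_def using lin_iso_compose[OF lin_iso_inv[OF a0_lin_iso fiber_closed] triv_lin_iso[OF a]] by simp
  define A where "A = mat n n (\<lambda>(i, j). a (b (basis_vec j)) i)"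
  have Ac: "A \<in> carrier_mat n n" by (simp add: A_def)
  have a_coords: "a u \<in> coords n" for u using triv_carrier[OF a, of u] by simp
  have a_act: "a (total_act F g u) = mat_app n (D g) (a u)" for g u
    using triv_act[OF a, of g u] a_coords by (simp add: mat_app_D)
  have Av: "mat_app n A v = a (b v)" if v: "v \<in> coords n" for v
  proof
    fix i
    show "mat_app n A v i = a (b v) i"
    proof (cases "i < n")
      case True
      then show ?thesis
        unfolding lin_iso_expansion[OF f v] by (simp add: mat_app_def A_def mult.commute)
    next
      case False
      then show ?thesis using a_coords[of "b v"] by (simp add: mat_app_def)
    qed
  qed
  have Au: "mat_app n A (a0 u) = a u" if "proj F u = x0" for u
    using Av[OF a0_coords] ba[OF that] by simp
  have "\<exists>w. w \<in> coords n \<and> mat_app n A w = v" if v: "v \<in> coords n" for v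
  proof -
    obtain u where u: "proj F u = x0" "a u = v"
      using triv_surj[OF a, of v x0] v unfolding diag_rep_simps(1) by blast
    show ?thesis using a0_coords[of u] Au[OF u(1)] unfolding u(2) by blast
  qed
  then have "\<forall>v\<in>coords n. \<exists>w. w \<in> coords n \<and> mat_app n A w = v" by blast
  from bchoice[OF this] obtain w where
    w: "\<And>v. v \<in> coords n \<Longrightarrow> w v \<in> coords n \<and> mat_app n A (w v) = v" by blast
  define B where "B = mat n n (\<lambda>(i, j). w (basis_vec j) i)"
  have Bc: "B \<in> carrier_mat n n" by (simp add: B_def)
  have "A * B = 1\<^sub>m n"
  proof (rule eq_square_matI[of _ n])
    fix i j assume ij: "i < n" "j < n"
    have "(A * B) $$ (i, j) = mat_app n A (w (basis_vec j)) i"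
      unfolding mult_mat_entry[OF Ac Bc ij] using ij by (simp add: mat_app_def B_def)
    then show "(A * B) $$ (i, j) = 1\<^sub>m n $$ (i, j)"
      using w[OF basis_vec_coords[OF ij(2)]] ij by (simp add: basis_vec_def)
  qed (use Ac Bc in simp_all)
  then have det: "det A \<noteq> 0" by (rule det_nonzero_right_inverse[OF Ac Bc])
  have block: "block_mat n s A"
    unfolding block_s_iff
  proof (intro conjI ballI Ac)
    fix h assume "h \<in> H"
    then have h: "base_act F h x0 = x0" by (simp add: H_def)
    show "D h * A = A * D h"
    proof (rule mat_eq_mat_app[of _ n])
      fix v :: "nat \<Rightarrow> complex" assume v: "v \<in> coords n"
      let ?u = "b v"
      have "mat_app n (A * D h) v = mat_app n A (a0 (total_act F h ?u))"
        using b[OF v] by (simp add: mat_app_mult[OF Ac D_carrier] a0_act)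
      also have "\<dots> = mat_app n (D h) (a ?u)"
        using b[OF v] h by (subst Au) (simp_all add: proj_act a_act)
      also have "\<dots> = mat_app n (D h * A) v"
        using b[OF v] Au[of ?u] by (simp add: mat_app_mult[OF D_carrier Ac])
      finally show "mat_app n (D h * A) v = mat_app n (A * D h) v" ..
    qed (use Ac in simp_all)
  qed
  have "triv A u = a u" for u
  proof -
    define g where "g = r (proj F u)"
    define u' where "u' = total_act F (- g) u"
    have u': "proj F u' = x0"
      using base_act_inverse(1)[of g x0] by (simp add: u'_def proj_act g_def r)
    have "a u = mat_app n (D g) (a u')" by (simp add: u'_def flip: a_act)
    also have "a u' = mat_app n A (mat_app n (D (- g)) (a0 u))"
      using Au[OF u'] by (simp add: u'_def a0_act)
    finally show ?thesis
      using Ac by (simp add: triv_def tw_def g_def mat_app_mult)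
  qed
  with block det show ?thesis by blast
qed

lemma Psi_ext_q: "X = q ` {A. block_mat n s A \<and> det A \<noteq> 0}"
proof
  show "X \<subseteq> q ` {A. block_mat n s A \<and> det A \<noteq> 0}"
    unfolding Psi_ext_eq q_def using trivialization_triv by blast
  show "q ` {A. block_mat n s A \<and> det A \<noteq> 0} \<subseteq> X"
    unfolding Psi_ext_eq q_def using triv_trivialization by blast
qed

lemma triv_mult:
  assumes l: "block_mat n t l" and A: "A \<in> carrier_mat n n"
  shows "triv (l * A) u = mat_app n l (triv A u)"
  using assms block_mat_carrier[OF l] by (simp add: triv_def tw_mult tw_block_t mat_app_mult)

text \<open>Such an \<open>l\<close> commutes with every \<open>D g\<close>, hence is an
  automorphism of the representation; composing a trivialization with it leaves the gluing
  unchanged.\<close>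

lemma q_mult:
  assumes l: "block_mat n t l" "det l \<noteq> 0" and A: "block_mat n s A" "det A \<noteq> 0"
  shows "q (l * A) = q A"
proof (intro ext)
  fix x x' u
  have c: "A \<in> carrier_mat n n" "l \<in> carrier_mat n n" using l A by (simp_all add: block_mat_carrier)
  have lA: "block_mat n s (l * A)" "det (l * A) \<noteq> 0"
    using l A c by (simp_all add: block_mat_mult block_t_imp_s det_mult_nonzero[of _ n])
  show "q (l * A) x x' u = q A x x' u"
  proof (cases "proj F u = x")
    case True
    then show ?thesis
      using q_proj[OF A True, of x'] by (subst q_eq_iff[OF lA]) (simp_all add: triv_mult[OF l(1) c(1)])
  qed (simp add: q_def clutch_def)
qed

text \<open>The quotient \<open>l\<close> of the two matrices compares the trivializations over
  \<open>x0\<close>, and its twist compares them over \<open>x\<close>. A common clutching map makes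
  these agree, so conjugating \<open>l\<close> by any \<open>D g\<close> does nothing.\<close>

lemma q_eqD:
  assumes A: "block_mat n s A" "det A \<noteq> 0" and B: "block_mat n s B" "det B \<noteq> 0" and eq: "q A = q B"
  shows "\<exists>l. block_mat n t l \<and> det l \<noteq> 0 \<and> B = l * A"
proof -
  have c: "A \<in> carrier_mat n n" "B \<in> carrier_mat n n" using A B by (simp_all add: block_mat_carrier)
  define l where "l = B * mat_inv A"
  have lc: "l \<in> carrier_mat n n" using c by (simp add: l_def)
  have lA: "l * A = B" using c A by (simp add: l_def square_mult_assoc[of _ n] mat_inv right_mult_one_mat[of _ n n])
  have ls: "block_mat n s l" unfolding l_def using A B by (intro block_mat_mult block_mat_inv)
  have dl: "det l \<noteq> 0" unfolding l_def using A B c by (intro det_mult_nonzero[of _ n] det_mat_inv_nonzero[of _ n]) simp_all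
  \<comment> \<open>Moving a vector from \<open>x0\<close> to \<open>x\<close> by the common
    clutching map preserves both \<open>triv A\<close> and \<open>triv B\<close>, so the map between
    these values is the same over both points.\<close>
  have tw: "tw l x = l" for x
  proof (rule mat_eq_mat_app[of _ n])
    fix w :: "nat \<Rightarrow> complex" assume w: "w \<in> coords n"
    obtain u where u: "proj F u = x0" "a0 u = mat_app n (mat_inv A) w"
      using a0_surj[OF mat_app_coords] by blast
    let ?v = "q A x0 x u"
    have v: "proj F ?v = x" "triv A ?v = triv A u" "triv B ?v = triv B u"
      using q_proj[OF A u(1)] q_proj[OF B u(1)] eq by auto
    have Aw: "mat_app n A (a0 u) = w" using mat_app_inv(1)[OF c(1) A(2) w] u by simp
    have tA: "mat_app n (tw A x) (a0 ?v) = w"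
      using v(1,2) u(1) Aw c by (simp add: triv_def tw_x0)
    have tB: "mat_app n (tw B x) (a0 ?v) = mat_app n B (a0 u)"
      using v(1,3) u(1) c by (simp add: triv_def tw_x0)
    have "mat_app n (tw l x) w = mat_app n (tw (l * A) x) (a0 ?v)"
      using tA lc c by (simp add: tw_mult mat_app_mult)
    also have "\<dots> = mat_app n (l * A) (a0 u)" using tB by (simp add: lA)
    also have "\<dots> = mat_app n l w" using Aw lc c by (simp add: mat_app_mult)
    finally show "mat_app n (tw l x) w = mat_app n l w" .
  qed (use lc in simp_all)
  have "D g * l = l * D g" for g
  proof -
    have "D g * l * D (- g) = l"
      using tw_independent[OF ls, of g] tw by simp
    then have "D g * l * D (- g) * D g = l * D g" by simp
    then show ?thesis using lc by (simp add: square_mult_assoc[of _ n] D_inverse right_mult_one_mat[of _ n n])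
  qed
  then have "block_mat n t l" using lc by (simp add: block_t_iff)
  with dl lA show ?thesis by blast
qed

abbreviation lift where "lift x \<equiv> inv_into {u. proj F u = x} a0"

lemma q_formula:
  assumes A: "block_mat n s A" "det A \<noteq> 0" and u: "proj F u = x"
  shows "q A x x' u = lift x' (mat_app n (mat_inv (tw A x') * tw A x) (a0 u))"
proof -
  have c: "A \<in> carrier_mat n n" using A by (simp add: block_mat_carrier)
  obtain v where v: "proj F v = x'" "a0 v = mat_app n (mat_inv (tw A x') * tw A x) (a0 u)"
    using a0_surj[OF mat_app_coords] by blast
  have "lift x' (a0 v) = v"
    using lin_isoD(1)[OF a0_lin_iso[of x']] v by (intro inv_into_f_f) auto
  moreover have "triv A v = triv A u"
    using v u c det_tw[OF c A(2), of x'] mat_app_coords[of n "tw A x" "a0 u"]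
    by (simp add: triv_def mat_app_mult mat_app_inv)
  ultimately show ?thesis
    using q_eq_iff[OF A u v(1)] v(2) by simp
qed

lemma q_continuous:
  "continuous_on {a. block_mat n s (mat n n (\<lambda>(i, j). a i j)) \<and> det (mat n n (\<lambda>(i, j). a i j)) \<noteq> 0}
     (\<lambda>a. q (mat n n (\<lambda>(i, j). a i j)))"
proof (intro continuous_on_coordinatewise_then_product)
  let ?S = "{a. block_mat n s (mat n n (\<lambda>(i, j). a i j)) \<and> det (mat n n (\<lambda>(i, j). a i j)) \<noteq> 0}"
  let ?M = "\<lambda>a :: nat \<Rightarrow> nat \<Rightarrow> complex. mat n n (\<lambda>(i, j). a i j)"
  fix x x' u
  let ?N = "\<lambda>a. mat_inv (tw (?M a) x') * tw (?M a) x"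
  show "continuous_on ?S (\<lambda>a. q (?M a) x x' u)"
  proof (cases "proj F u = x")
    case True
    have "continuous_on ?S (\<lambda>a. a i j)" for i j :: nat
      by (rule continuous_on_apply[OF continuous_on_apply[OF continuous_on_id]])
    then have M: "cont_mat n ?S ?M" by (intro cont_mat_mat)
    then have tw: "cont_mat n ?S (\<lambda>a. tw (?M a) y)" for y
      unfolding tw_def by (intro cont_mat_mult cont_mat_const) simp_all
    have "cont_mat n ?S (\<lambda>a. ?N a)"
      by (intro cont_mat_mult cont_mat_inv tw) (rule det_tw, simp_all)
    then have "continuous_on ?S (\<lambda>a. mat_app n (?N a) (a0 u))"
      unfolding mat_app_def
    proof (intro continuous_on_coordinatewise_then_product)
      fix i assume C: "cont_mat n ?S (\<lambda>a. ?N a)"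
      show "continuous_on ?S (\<lambda>a. if i < n then \<Sum>j<n. (?N a) $$ (i, j) * a0 u j else 0)"
      proof (cases "i < n")
        case True
        then have "continuous_on ?S (\<lambda>a. \<Sum>j<n. (?N a) $$ (i, j) * a0 u j)"
          using C by (intro continuous_on_sum continuous_on_mult continuous_on_const) (simp add: cont_mat_def)
        then show ?thesis using True by simp
      qed simp
    qed
    then have "continuous_on ?S (\<lambda>a. lift x' (mat_app n (?N a) (a0 u)))"
      by (rule continuous_on_compose2[OF continuous_fiber_iso(2)[OF a0_lin_iso]]) (use mat_app_coords in blast)
    then show ?thesis
      by (rule continuous_on_eq) (use q_formula True in auto)
  next
    case False
    \<comment> \<open>Outside the fiber over \<open>x\<close> the component has the constant value
      \<open>undefined\<close>.\<close>
    show ?thesis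
      by (rule continuous_on_eq[OF continuous_on_const[of _ undefined]])
        (use False in \<open>simp add: q_def clutch_def\<close>)
  qed
qed

section \<open>Character sums and local sections\<close>

text \<open>Orthogonality of characters. The quotient \<open>\<rho>\<close> of the two characters is
  trivial on \<open>H\<close>, so it is a function on the base. Translating by some \<open>g\<close>
  with \<open>\<rho> g \<noteq> 1\<close> multiplies the sum by \<open>\<rho> g\<close> while only
  permuting its terms.\<close>

lemma sum_character:
  assumes ij: "i < n" "j < n" "s i = s j" "t i \<noteq> t j"
  shows "(\<Sum>x\<in>UNIV. \<theta> (- r x) i * \<theta> (r x) j) = 0"
proof -
  define \<rho> where "\<rho> g = \<theta> (- g) i * \<theta> g j" for g
  have add: "\<rho> (g + h) = \<rho> g * \<rho> h" for g h
  proof -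
    have "- (g + h) = - g + - h" by simp
    then have "\<theta> (- (g + h)) i = \<theta> (- g) i * \<theta> (- h) i" using ij by (simp only: \<theta>_add)
    then show ?thesis using ij by (simp add: \<rho>_def \<theta>_add)
  qed
  have one: "\<rho> h = 1" if "h \<in> H" for h
    using ij that \<theta>_inverse(1)[of i h] by (simp add: \<rho>_def s_iff)
  obtain g where g: "\<theta> g i \<noteq> \<theta> g j" using ij(4) by (auto simp: t_iff)
  have "\<rho> g \<noteq> 1"
  proof
    assume "\<rho> g = 1"
    then have "\<theta> g i * \<rho> g = \<theta> g i" by simp
    moreover have "\<theta> g i * \<rho> g = \<theta> g j" using \<theta>_inverse(2)[OF ij(1), of g] by (simp add: \<rho>_def flip: mult.assoc)
    ultimately show False using g by simp
  qed
  have shift: "\<rho> (r (base_act F g x)) = \<rho> g * \<rho> (r x)" for x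
  proof -
    \<comment> \<open>The choice \<open>r\<close> need not be compatible with the action of
      \<open>g\<close>; the defect \<open>h\<close> fixes \<open>x0\<close>, and
      \<open>\<rho>\<close> does not see it.\<close>
    define h where "h = - (g + r x) + r (base_act F g x)"
    have "base_act F h x0 = base_act F (- (g + r x)) (base_act F (r (base_act F g x)) x0)"
      unfolding h_def by (rule base_act_plus)
    also have "\<dots> = base_act F (- (g + r x)) (base_act F (g + r x) x0)"
      by (simp add: r base_act_plus)
    also have "\<dots> = x0" by (rule base_act_inverse)
    finally have "h \<in> H" by (simp only: H_def mem_Collect_eq)
    have "r (base_act F g x) = g + r x + h" by (simp add: h_def)
    then show ?thesis by (simp add: add one[OF \<open>h \<in> H\<close>])
  qed
  have "bij (base_act F g)"
    by (rule bij_betwI[where g = "base_act F (- g)"]) auto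
  then have "(\<Sum>x\<in>UNIV. \<rho> (r (base_act F g x))) = (\<Sum>x\<in>UNIV. \<rho> (r x))"
    by (rule sum.reindex_bij_betw)
  then have "\<rho> g * (\<Sum>x\<in>UNIV. \<rho> (r x)) = (\<Sum>x\<in>UNIV. \<rho> (r x))"
    by (simp add: shift sum_distrib_left)
  with \<open>\<rho> g \<noteq> 1\<close> have "(\<Sum>x\<in>UNIV. \<rho> (r x)) = 0" by simp
  then show ?thesis by (simp add: \<rho>_def)
qed

text \<open>
  The matrix \<open>A\<inverse> D (r x) A\<close> can be read off from the clutching map \<open>q A\<close>. Averaging
  \<open>C A\<inverse>\<close> over the conjugations by \<open>D (r x)\<close> produces a matrix commuting with all \<open>D g\<close>, so
  the section below changes \<open>A\<close> only within its fiber under \<open>q\<close>.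
\<close>
definition holonomy :: "'x \<Rightarrow> ('x \<Rightarrow> 'x \<Rightarrow> 'e \<Rightarrow> 'e) \<Rightarrow> complex mat" where
  "holonomy x \<psi> = mat n n (\<lambda>(i, j).
     a0 (\<psi> x x0 (lift x (mat_app n (D (r x)) (basis_vec j)))) i)"

text \<open>Entrywise form of the sum over \<open>x\<close> of
  \<open>D (- r x) * Y * D (r x)\<close>. It is left unnormalized, since only invertibility of the
  result matters.\<close>

definition average :: "complex mat \<Rightarrow> complex mat" where
  "average Y = mat n n (\<lambda>(i, j). Y $$ (i, j) * (\<Sum>x\<in>UNIV. \<theta> (- r x) i * \<theta> (r x) j))"

text \<open>Expressed through the holonomies of \<open>\<psi>\<close> alone, so that continuity is
  visible and no matrix representing \<open>\<psi>\<close> is chosen. \<open>C\<close> selects the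
  point near which the value is invertible.\<close>

definition section_map :: "complex mat \<Rightarrow> ('x \<Rightarrow> 'x \<Rightarrow> 'e \<Rightarrow> 'e) \<Rightarrow> complex mat" where
  "section_map C \<psi> = mat n n (\<lambda>(i, j). \<Sum>x\<in>UNIV. (D (- r x) * C * holonomy x \<psi>) $$ (i, j))"

lemma holonomy_carrier [simp]: "holonomy x \<psi> \<in> carrier_mat n n"
  by (simp add: holonomy_def)

lemma a0_inv:
  assumes "v \<in> coords n"
  shows "proj F (lift x v) = x" "a0 (lift x v) = v"
proof -
  have "v \<in> a0 ` {u. proj F u = x}" using a0_surj[OF assms, of x] by auto
  then show "proj F (lift x v) = x" "a0 (lift x v) = v"
    using inv_into_into[of v a0 "{u. proj F u = x}"] f_inv_into_f[of v a0 "{u. proj F u = x}"] by auto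
qed

text \<open>A vector over \<open>x0\<close> is moved to \<open>x\<close> by \<open>r x\<close> and
  clutched back. In the coordinates \<open>triv A\<close> the clutching is invisible and
  \<open>D (r x)\<close> remains; in the coordinates \<open>a0\<close> it is conjugated by
  \<open>A\<close>.\<close>

lemma holonomy_q:
  assumes A: "block_mat n s A" "det A \<noteq> 0"
  shows "holonomy x (q A) = mat_inv A * (D (r x) * A)"
proof -
  have c: "A \<in> carrier_mat n n" using A by (simp add: block_mat_carrier)
  have "A * holonomy x (q A) = D (r x) * A"
  proof (rule eq_square_matI[of _ n])
    fix i j assume ij: "i < n" "j < n"
    define u where "u = lift x (mat_app n (D (r x)) (basis_vec j))"
    have u: "proj F u = x" "a0 u = mat_app n (D (r x)) (basis_vec j)"
      unfolding u_def using a0_inv[OF mat_app_coords] by auto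
    have v: "proj F (q A x x0 u) = x0" "triv A (q A x x0 u) = triv A u"
      using q_proj[OF A u(1), of x0] by auto
    have "(A * holonomy x (q A)) $$ (i, j) = mat_app n A (a0 (q A x x0 u)) i"
      unfolding mult_mat_entry[OF c holonomy_carrier ij]
      using ij by (simp add: mat_app_def holonomy_def u_def)
    also have "\<dots> = mat_app n (tw A x * D (r x)) (basis_vec j) i"
      using u v c by (simp add: triv_def tw_x0 mat_app_mult)
    also have "\<dots> = (D (r x) * A) $$ (i, j)"
      unfolding tw_D[OF c] by (rule mat_app_basis_vec[OF ij])
    finally show "(A * holonomy x (q A)) $$ (i, j) = (D (r x) * A) $$ (i, j)" .
  qed (use c in simp_all)
  then have "mat_inv A * (A * holonomy x (q A)) = mat_inv A * (D (r x) * A)" by simp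
  then show ?thesis
    using c A by (simp add: mat_inv left_mult_one_mat[of _ n n] flip: square_mult_assoc[of _ n])
qed

text \<open>Inserting the holonomies, \<open>A\<close> splits off on the right and the remaining sum
  is the average of \<open>C\<close> times the inverse of \<open>A\<close>.\<close>

lemma section_map_q:
  assumes A: "block_mat n s A" "det A \<noteq> 0" and C: "C \<in> carrier_mat n n"
  shows "section_map C (q A) = average (C * mat_inv A) * A"
proof (rule eq_square_matI[of _ n])
  have c: "A \<in> carrier_mat n n" using A by (simp add: block_mat_carrier)
  let ?Y = "C * mat_inv A"
  have Y: "?Y \<in> carrier_mat n n" using c C by simp
  have avg: "average ?Y \<in> carrier_mat n n" by (simp add: average_def)
  fix i j assume ij: "i < n" "j < n"
  have 1: "(D (- r x) * C * holonomy x (q A)) $$ (i, j) = (\<Sum>k<n. \<theta> (- r x) i * ?Y $$ (i, k) * \<theta> (r x) k * A $$ (k, j))" for x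
  proof -
    have "D (- r x) * C * holonomy x (q A) = (D (- r x) * ?Y) * (D (r x) * A)"
      unfolding holonomy_q[OF A] using c C by (simp add: square_mult_assoc[of _ n])
    moreover have "((D (- r x) * ?Y) * (D (r x) * A)) $$ (i, j) = (\<Sum>k<n. (D (- r x) * ?Y) $$ (i, k) * (D (r x) * A) $$ (k, j))"
      using c Y ij by (intro mult_mat_entry) simp_all
    moreover have "\<dots> = (\<Sum>k<n. \<theta> (- r x) i * ?Y $$ (i, k) * \<theta> (r x) k * A $$ (k, j))"
      using ij by (intro sum.cong refl) (simp add: D_entry[OF Y] D_entry[OF c] del: index_mult_mat(1))
    ultimately show ?thesis by simp
  qed
  have "section_map C (q A) $$ (i, j) = (\<Sum>x\<in>UNIV. \<Sum>k<n. \<theta> (- r x) i * ?Y $$ (i, k) * \<theta> (r x) k * A $$ (k, j))"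
    using ij by (simp add: section_map_def 1 del: index_mult_mat(1))
  also have "\<dots> = (\<Sum>k<n. \<Sum>x\<in>UNIV. \<theta> (- r x) i * ?Y $$ (i, k) * \<theta> (r x) k * A $$ (k, j))"
    by (rule sum.swap)
  also have "\<dots> = (\<Sum>k<n. average ?Y $$ (i, k) * A $$ (k, j))"
    using ij by (intro sum.cong refl)
      (simp add: average_def sum_distrib_left sum_distrib_right ac_simps del: index_mult_mat(1))
  also have "\<dots> = (average ?Y * A) $$ (i, j)"
    by (rule mult_mat_entry[OF avg c ij, symmetric])
  finally show "section_map C (q A) $$ (i, j) = (average ?Y * A) $$ (i, j)" .
qed (use block_mat_carrier[OF A(1)] in \<open>simp_all add: section_map_def average_def\<close>)

text \<open>Entries between different classes of \<open>s\<close> are zero already in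
  \<open>Y\<close>. Inside a class of \<open>s\<close>, entries between different classes of
  \<open>t\<close> are multiplied by a vanishing character sum.\<close>

lemma average_block:
  assumes "block_mat n s Y"
  shows "block_mat n t (average Y)"
  unfolding block_mat_def
proof (intro conjI allI impI)
  fix i j assume ij: "i < n" "j < n" "t i \<noteq> t j"
  show "average Y $$ (i, j) = 0"
    using ij block_mat_entry[OF assms ij(1,2)] sum_character[OF ij(1,2) _ ij(3)]
    by (cases "s i = s j") (simp_all add: average_def)
qed (simp add: average_def)

lemma average_one: "average (1\<^sub>m n) = diag n (\<lambda>_. of_nat (CARD('x)))"
  by (rule eq_matI) (auto simp: average_def diag_def \<theta>_inverse)

lemma section_map_continuous:
  assumes C: "C \<in> carrier_mat n n"
  shows "cont_mat n (X) (section_map C)"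
  unfolding section_map_def[abs_def]
proof (rule cont_mat_mat)
  fix i j assume ij: "i < n" "j < n"
  have "cont_mat n X (\<lambda>\<psi>. holonomy x \<psi>)" for x
    unfolding holonomy_def
  proof (rule cont_mat_mat)
    fix i j
    define u where "u = lift x (mat_app n (D (r x)) (basis_vec j))"
    have u: "proj F u = x"
      unfolding u_def using a0_inv[OF mat_app_coords] by auto
    have "continuous_on X (\<lambda>\<psi>. \<psi> x x0 u)"
      by (rule continuous_on_apply[OF continuous_on_apply[OF continuous_on_apply[OF continuous_on_id]]])
    moreover have "proj F (\<psi> x x0 u) = x0" if "\<psi> \<in> X" for \<psi>
      using that psi_proj[of \<psi> u x x0] u by (simp add: Psi_ext_def)
    ultimately have "continuous_on X (\<lambda>\<psi>. a0 (\<psi> x x0 u) i)"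
      by (intro continuous_on_compose2[OF continuous_fiber_iso(1)[OF a0_lin_iso]]) auto
    then show "continuous_on X (\<lambda>\<psi>. a0 (\<psi> x x0 (lift x (mat_app n (D (r x)) (basis_vec j)))) i)"
      by (simp add: u_def)
  qed
  then have "cont_mat n X (\<lambda>\<psi>. D (- r x) * C * holonomy x \<psi>)" for x
    using C by (intro cont_mat_mult cont_mat_const) simp_all
  then show "continuous_on X (\<lambda>\<psi>. \<Sum>x\<in>UNIV. (D (- r x) * C * holonomy x \<psi>) $$ (i, j))"
    using ij by (intro continuous_on_sum) (simp add: cont_mat_def)
qed

text \<open>At \<open>q C\<close> the average is the number of base points times the identity, so
  the section is invertible there. Wherever it is invertible, it differs from a representing matrix
  by an invertible left factor that \<open>q\<close> ignores.\<close>

lemma local_sections: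
  assumes C: "block_mat n s C" "det C \<noteq> 0"
  shows "\<exists>\<sigma>. cont_mat n (X) \<sigma> \<and>
      (\<forall>\<psi>\<in>X. block_mat n s (\<sigma> \<psi>)) \<and> det (\<sigma> (q C)) \<noteq> 0 \<and>
      (\<forall>\<psi>\<in>X. det (\<sigma> \<psi>) \<noteq> 0 \<longrightarrow> q (\<sigma> \<psi>) = \<psi>)"
proof (intro exI conjI ballI impI)
  have Cc: "C \<in> carrier_mat n n" using C by (simp add: block_mat_carrier)
  show "cont_mat n (X) (section_map C)"
    using Cc by (rule section_map_continuous)
  have avg: "block_mat n t (average (C * mat_inv A))" if "block_mat n s A" "det A \<noteq> 0" for A
    using that C by (intro average_block block_mat_mult block_mat_inv)
  have "average (C * mat_inv C) = diag n (\<lambda>_. of_nat (CARD('x)))"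
    using C Cc by (simp add: mat_inv average_one)
  then have "section_map C (q C) = diag n (\<lambda>_. of_nat (CARD('x))) * C"
    using section_map_q[OF C Cc] by simp
  then show "det (section_map C (q C)) \<noteq> 0"
    using C Cc by (simp add: det_mult_nonzero[of _ n] det_diag_nonzero)
  fix \<psi> assume "\<psi> \<in> X"
  then obtain A where A: "block_mat n s A" "det A \<noteq> 0" "\<psi> = q A" unfolding Psi_ext_q by blast
  then have eq: "section_map C \<psi> = average (C * mat_inv A) * A" using section_map_q[OF A(1,2) Cc] by simp
  show "block_mat n s (section_map C \<psi>)"
    unfolding eq by (rule block_mat_mult[OF block_t_imp_s[OF avg[OF A(1,2)]] A(1)])
  assume "det (section_map C \<psi>) \<noteq> 0"
  then have "det (average (C * mat_inv A)) \<noteq> 0"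
    using block_mat_carrier[OF avg[OF A(1,2)]] block_mat_carrier[OF A(1)] unfolding eq by (auto simp: det_mult[of _ n])
  then show "q (section_map C \<psi>) = \<psi>"
    unfolding eq using q_mult[OF avg[OF A(1,2)] _ A(1,2)] A(3) by simp
qed

sublocale block_orbit n s t "X" q
proof
  show "t i \<le> n" if "i < n" for i using t_le[of i] that by simp
  show "s i = s j" if "t i = t j" for i j using that by (simp add: s_iff t_iff)
  show "\<exists>A. block_mat n s A \<and> det A \<noteq> 0 \<and> q A = \<psi>" if "\<psi> \<in> X" for \<psi>
    using that unfolding Psi_ext_q by blast
  show "q A \<in> X" if "block_mat n s A" "det A \<noteq> 0" for A
    using that unfolding Psi_ext_q by blast
qed (fact q_eqD q_mult q_continuous local_sections)+

lemma Psi_ext_nonempty: "X \<noteq> {}"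
  unfolding Psi_ext_q using one_Z by (auto simp: Z_def)

end

section \<open>Diagonal coordinates for representations of compact abelian groups\<close>

lemma rep_iso_compose:
  assumes f: "rep_iso S U V f" and g: "rep_iso S V W g"
  shows "rep_iso S U W (\<lambda>u. g (f u))"
  using f g lin_isoD(3)[of U V f] by (auto simp: rep_iso_def lin_iso_compose)

lemma rep_iso_inv:
  assumes f: "rep_iso S V W f" and V: "lin_closed V" "\<And>g v. v \<in> carrier V \<Longrightarrow> act V g v \<in> carrier V"
  shows "rep_iso S W V (inv_into (carrier V) f)"
  unfolding rep_iso_def
proof (intro conjI ballI)
  have lf: "lin_iso V W f" using f by (simp add: rep_iso_def)
  then show "lin_iso W V (inv_into (carrier V) f)" using V(1) by (rule lin_iso_inv)
  note D = lin_isoD[OF lf]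
  fix g w assume g: "g \<in> S" and "w \<in> carrier W"
  then obtain v where v: "v \<in> carrier V" "w = f v" using D(2) by blast
  have "inv_into (carrier V) f (f (act V g v)) = act V g v"
    by (rule inv_into_f_f[OF D(1) V(2)[OF v(1)]])
  moreover have "f (act V g v) = act W g w" using f g v by (simp add: rep_iso_def)
  ultimately show "inv_into (carrier V) f (act W g w) = act V g (inv_into (carrier V) f w)"
    using inv_into_f_f[OF D(1) v(1)] v(2) by simp
qed

lemma Psi_ext_cong:
  assumes f: "rep_iso UNIV W W' f" and W: "lin_closed W" "\<And>g v. v \<in> carrier W \<Longrightarrow> act W g v \<in> carrier W"
  shows "Psi_ext F W = Psi_ext F W'"
  using rep_iso_compose[OF _ f] rep_iso_compose[OF _ rep_iso_inv[OF f W]]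
  unfolding Psi_ext_def isomorphic_rep_def by blast

lemma representationD:
  assumes "representation W"
  shows "lin_closed W" "w \<in> carrier W \<Longrightarrow> act W g w \<in> carrier W" "w \<in> carrier W \<Longrightarrow> act W 0 w = w"
    "w \<in> carrier W \<Longrightarrow> act W (g + h) w = act W g (act W h w)" "lin_iso W W (act W g)"
  using assms lin_closed_module unfolding representation_def is_action_def by blast+

lemma continuous_map_lin_functional:
  assumes l: "lin_functional W l"
  shows "topspace (fd_topology W) = carrier W" "continuous_map (fd_topology W) euclidean l"
proof -
  let ?B = "{{v \<in> carrier W. l v \<in> N} | l N. lin_functional W l \<and> open N}"
  have B: "{v \<in> carrier W. l v \<in> N} \<in> ?B" if "open N" for N using l that by blast
  have "\<Union>?B \<subseteq> carrier W" by blast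
  moreover have "carrier W \<subseteq> \<Union>?B" using B[of UNIV] by auto
  ultimately show top: "topspace (fd_topology W) = carrier W"
    by (simp add: fd_topology_def topology_generated_by_topspace)
  show "continuous_map (fd_topology W) euclidean l"
    unfolding continuous_map_def top
  proof (intro conjI allI impI)
    fix N :: "complex set" assume "openin euclidean N"
    then show "openin (fd_topology W) {v \<in> carrier W. l v \<in> N}"
      unfolding fd_topology_def by (intro topology_generated_by_Basis B) simp
  qed simp
qed

text \<open>Compactness of the group enters here: a matrix coefficient is a continuous function on
  it.\<close>

lemma bounded_matrix_coefficient:
  fixes W :: "('g::topological_group_add, 'w) rep"
  assumes W: "representation W" and l: "lin_functional W l" and w: "w \<in> carrier W"
    and compact: "compact (UNIV :: 'g set)"
  shows "\<exists>B. \<forall>g. cmod (l (act W g w)) \<le> B"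
proof -
  have "continuous_map (prod_topology euclidean (fd_topology W)) (fd_topology W) (\<lambda>(g, v). act W g v)"
    using W by (simp add: representation_def)
  from continuous_map_compose[OF this continuous_map_lin_functional(2)[OF l]]
  have 1: "continuous_map (prod_topology euclidean (fd_topology W)) euclidean (l \<circ> (\<lambda>(g, v). act W g v))" .
  have "continuous_map euclidean (prod_topology euclidean (fd_topology W)) (\<lambda>g. (g, w))"
    using w by (simp add: continuous_map_pairwise comp_def continuous_map_lin_functional(1)[OF l])
  from continuous_map_compose[OF this 1]
  have "continuous_on UNIV (\<lambda>g. l (act W g w))" by (simp add: comp_def)
  then have "compact (range (\<lambda>g. l (act W g w)))" using compact by (rule compact_continuous_image)
  then have "bounded (range (\<lambda>g. l (act W g w)))" by (rule compact_imp_bounded)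
  then show ?thesis by (auto simp: bounded_iff)
qed

text \<open>Arbitrary linear coordinates \<open>k\<close> transport the action to
  \<open>coords n\<close>, where it is a bounded commuting family and can be diagonalized.\<close>

lemma diagonal_coordinates:
  fixes W :: "('g::topological_ab_group_add, 'w) rep"
  assumes W: "representation W" and compact: "compact (UNIV :: 'g set)"
    and k: "lin_iso W (coord_space n) k"
  shows "\<exists>m \<theta> f. rep_iso UNIV W (diag_rep m \<theta>) f"
proof -
  note WD = representationD[OF W]
  define j where "j = inv_into (carrier W) k"
  have j: "lin_iso (coord_space n) W j" unfolding j_def by (rule lin_iso_inv[OF k WD(1)])
  have jk: "j (k w) = w" if "w \<in> carrier W" for w
    unfolding j_def using lin_isoD(1)[OF k] that by (rule inv_into_f_f)
  have kj: "k (j v) = v" if "v \<in> coords n" for v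
    unfolding j_def using lin_isoD(2)[OF k] that by (intro f_inv_into_f) simp
  define T where "T g v = k (act W g (j v))" for g v
  have lT: "lin_iso (coord_space n) (coord_space n) (T g)" for g
    unfolding T_def by (rule lin_iso_compose[OF lin_iso_compose[OF j WD(5)] k])
  note TD = lin_isoD[OF lT, simplified coord_space_simps]
  have jW: "j v \<in> carrier W" if "v \<in> coords n" for v using lin_isoD(3)[OF j, of v] that by simp
  have kV: "k w \<in> coords n" if "w \<in> carrier W" for w using lin_isoD(3)[OF k that] by simp
  interpret bounded_action n T "coords n"
  proof
    show "coords n = {v. \<forall>i\<ge>n. v i = 0}" by (rule refl)
    show "T g v \<in> coords n" if "v \<in> coords n" for g v using TD(3) that by blast
    show "T g (u + v) = T g u + T g v" if "u \<in> coords n" "v \<in> coords n" for g u v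
      using TD(4)[OF that] by (simp add: plus_fun_def)
    show "T g (fscale c v) = fscale c (T g v)" if "v \<in> coords n" for g v c
      using TD(5)[OF that] by (simp add: fscale_def)
    show "T 0 v = v" if "v \<in> coords n" for v
      using kj[OF that] WD(3)[OF jW[OF that]] by (simp add: T_def)
    show "T (g + h) v = T g (T h v)" if "v \<in> coords n" for g h v
      using jk[OF WD(2)[OF jW[OF that]]] WD(4)[OF jW[OF that]] by (simp add: T_def)
    show "\<exists>B. \<forall>g. cmod (T g v i) \<le> B" if "v \<in> coords n" for v i
      unfolding T_def
    proof (rule bounded_matrix_coefficient[OF W _ jW[OF that] compact, of "\<lambda>w. k w i"])
      show "lin_functional W (\<lambda>w. k w i)"
        using lin_isoD(4,5)[OF k] by (simp add: lin_functional_def)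
    qed
  qed
  obtain m f \<theta> where f: "bij_betw f (coords n) (coords m)"
      "\<forall>u\<in>coords n. \<forall>v\<in>coords n. f (u + v) = f u + f v"
      "\<forall>c. \<forall>v\<in>coords n. f (fscale c v) = fscale c (f v)"
    and act: "\<forall>g. \<forall>v\<in>coords n. f (T g v) = (\<lambda>i. \<theta> g i * f v i)"
    using diagonalization by (elim exE conjE)
  have "lin_iso (coord_space n) (diag_rep m \<theta>) f"
    using f by (simp add: lin_iso_def plus_fun_def fscale_def)
  then have "lin_iso W (diag_rep m \<theta>) (\<lambda>w. f (k w))"
    by (rule lin_iso_compose[OF k])
  moreover have "f (k (act W g w)) = act (diag_rep m \<theta>) g (f (k w))" if w: "w \<in> carrier W" for g w
    using act[rule_format, OF kV[OF w], of g] by (simp add: T_def jk[OF w])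
  ultimately have "rep_iso UNIV W (diag_rep m \<theta>) (\<lambda>w. f (k w))"
    by (simp add: rep_iso_def)
  then show ?thesis by blast
qed

text \<open>On the vector with coordinates \<open>basis_vec i\<close>, the \<open>i\<close>-th
  coordinate of the action by \<open>g\<close> is \<open>\<theta> g i\<close>, so the action laws
  become the character identities.\<close>

lemma diagonal_characters:
  assumes W: "representation W" and f: "rep_iso UNIV W (diag_rep m \<theta>) f" and i: "i < m"
  shows "\<theta> 0 i = 1" "\<theta> (g + h) i = \<theta> g i * \<theta> h i"
proof -
  note WD = representationD[OF W]
  have lf: "lin_iso W (diag_rep m \<theta>) f" using f by (simp add: rep_iso_def)
  have act: "f (act W g w) = (\<lambda>i. \<theta> g i * f w i)" if "w \<in> carrier W" for g w
    using f that by (simp add: rep_iso_def)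
  have "basis_vec i \<in> f ` carrier W"
    using lin_isoD(2)[OF lf] basis_vec_coords[OF i] by simp
  then obtain w where w: "w \<in> carrier W" "f w = basis_vec i" by auto
  have *: "f (act W g w) i = \<theta> g i" for g
    by (simp add: act w basis_vec_def)
  show "\<theta> 0 i = 1" using *[of 0] w WD(3) by (simp add: basis_vec_def)
  have "f (act W (g + h) w) i = \<theta> g i * f (act W h w) i"
    unfolding WD(4)[OF w(1)] using act[OF WD(2)[OF w(1)], of g h] by simp
  then show "\<theta> (g + h) i = \<theta> g i * \<theta> h i" by (simp add: *)
qed

section \<open>Existence of an equivariant trivialization\<close>

context equivariant_gbundle
begin

text \<open>The isomorphism \<open>b\<close> over \<open>x0\<close> is spread over the base by
  equivariance along \<open>r\<close>. The elements \<open>g + r x\<close> and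
  \<open>r (base_act F g x)\<close> differ by an element \<open>h\<close> of the isotropy group of
  \<open>x0\<close>, which is absorbed because \<open>b\<close> is equivariant for that
  group.\<close>

lemma trivialization_exists:
  assumes W: "representation W" and f: "rep_iso (isotropy F x0) W (fiber F x0) f"
    and r: "\<And>x. base_act F (r x) x0 = x"
  shows "\<exists>a. trivialization F W a"
proof -
  note WD = representationD[OF W]
  have lf: "lin_iso W (fiber F x0) f" using f by (simp add: rep_iso_def)
  define b where "b = inv_into (carrier W) f"
  have b: "rep_iso (isotropy F x0) (fiber F x0) W b"
    unfolding b_def by (rule rep_iso_inv[OF f WD(1,2)])
  then have lb: "lin_iso (fiber F x0) W b" by (simp add: rep_iso_def)
  have bW: "b u \<in> carrier W" if "proj F u = x0" for u using lin_isoD(3)[OF lb, of u] that by simp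
  have b_act: "b (total_act F h u) = act W h (b u)" if "base_act F h x0 = x0" "proj F u = x0" for h u
    using b that by (simp add: rep_iso_def isotropy_def fiber_def)
  define a where "a u = act W (r (proj F u)) (b (total_act F (- r (proj F u)) u))" for u
  have base_back: "base_act F (- r x) x = x0" for x
    using base_act_inverse(1)[of "r x" x0] by (simp add: r)
  have "trivialization F W a"
    unfolding trivialization_def
  proof (intro conjI allI)
    fix x
    have "lin_iso (fiber F x) (fiber F x0) (total_act F (- r x))"
      using total_act_linear[of x "- r x"] by (simp add: base_back)
    then have "lin_iso (fiber F x) W (\<lambda>u. act W (r x) (b (total_act F (- r x) u)))"
      by (rule lin_iso_compose[OF lin_iso_compose[OF _ lb] WD(5)])
    then show "lin_iso (fiber F x) W a"
      by (rule lin_iso_cong) (simp_all add: a_def fiber_closed)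
  next
    fix g u
    define x where "x = proj F u"
    define u0 where "u0 = total_act F (- r x) u"
    have u0: "proj F u0 = x0" by (simp add: u0_def proj_act x_def base_back)
    define h where "h = - r (base_act F g x) + (g + r x)"
    have "base_act F h x0 = base_act F (- r (base_act F g x)) (base_act F (g + r x) x0)"
      unfolding h_def by (rule base_act_plus)
    also have "\<dots> = x0" by (simp add: base_act_plus r base_back)
    finally have h: "base_act F h x0 = x0" .
    have u: "u = total_act F (r x) u0" by (simp add: u0_def)
    have "total_act F (- r (base_act F g x)) (total_act F g u) = total_act F h u0"
      unfolding h_def total_act_plus u[symmetric] ..
    then have "a (total_act F g u) = act W (r (base_act F g x)) (act W h (b u0))"
      using b_act[OF h u0] by (simp add: a_def proj_act x_def)
    also have "\<dots> = act W (r (base_act F g x) + h) (b u0)"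
      using WD(4)[OF bW[OF u0]] by simp
    also have "r (base_act F g x) + h = g + r x"
      unfolding h_def by (simp only: add.assoc[symmetric] right_minus add_0_left)
    also have "act W (g + r x) (b u0) = act W g (a u)"
      using WD(4)[OF bW[OF u0]] by (simp add: a_def x_def u0_def)
    finally show "a (total_act F g u) = act W g (a u)" .
  qed
  then show ?thesis by blast
qed

lemma trivialization_compose:
  assumes "trivialization F W a" "rep_iso UNIV W W' f"
  shows "trivialization F W' (\<lambda>u. f (a u))"
  using assms triv_carrier[OF assms(1)] unfolding trivialization_def rep_iso_def
  by (auto intro: lin_iso_compose)

end

text \<open>\<open>simply_connected\<close> holds vacuously for the empty set, hence the separate
  conjunct on nonemptiness.\<close>

theorem corollary1p5:
  fixes V :: "'m::euclidean_space set"
    and \<A> :: "('g::{topological_ab_group_add, t2_space, second_countable_topology} set \<times> ('g \<Rightarrow> 'm)) set"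
    and F :: "('g, 'x::{finite, discrete_topology}, 'e::topological_space) gbundle"
    and W :: "('g, 'w) rep"
  assumes "lie_group V \<A>"
    and "compact (UNIV :: 'g set)"
    and "equivariant_bundle F"
    and "\<forall>x y. \<exists>g. base_act F g x = y"
    and "rep_extension F W"
  shows "Psi_ext F W \<noteq> {} \<and> simply_connected (Psi_ext F W)"
proof -
  interpret equivariant_gbundle F by unfold_locales (fact assms(3))
  define x0 :: 'x where "x0 = undefined"
  have W: "representation W" and iso: "isomorphic_rep (isotropy F x0) W (fiber F x0)"
    using assms(5) by (auto simp: rep_extension_def)
  obtain f0 where f0: "rep_iso (isotropy F x0) W (fiber F x0) f0"
    using iso by (auto simp: isomorphic_rep_def)
  then have lf0: "lin_iso W (fiber F x0) f0" by (simp add: rep_iso_def)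
  obtain n c where c: "lin_iso (fiber F x0) (coord_space n) c"
    using fiber_chart[of x0] by blast
  \<comment> \<open>Linear coordinates on \<open>W\<close> are borrowed from the bundle chart at
    \<open>x0\<close> through the extension isomorphism.\<close>
  obtain m \<theta> f where f: "rep_iso UNIV W (diag_rep m \<theta>) f"
    using diagonal_coordinates[OF W assms(2) lin_iso_compose[OF lf0 c]] by blast
  obtain r0 where r0: "\<And>x. base_act F (r0 x) x0 = x"
    using assms(4) by metis
  define r where "r x = (if x = x0 then 0 else r0 x)" for x
  have r: "base_act F (r x) x0 = x" "r x0 = 0" for x by (simp_all add: r_def r0)
  obtain a where a: "trivialization F W a"
    using trivialization_exists[OF W f0 r(1)] by blast
  interpret diagonal_bundle F m \<theta> "\<lambda>u. f (a u)" r x0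
  proof
    show "trivialization F (diag_rep m \<theta>) (\<lambda>u. f (a u))"
      by (rule trivialization_compose[OF a f])
  qed (simp_all add: r diagonal_characters[OF W f])
  have "Psi_ext F W = Psi_ext F (diag_rep m \<theta>)"
    by (rule Psi_ext_cong[OF f representationD(1,2)[OF W]])
  then show ?thesis
    using Psi_ext_nonempty simply_connected_orbit by simp
qed

end
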